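(* Let $f:\mathcal{C}^d\to\mathcal{S}$ be a (scalar) noncommutative function on the set $\mathcal{C}^d$ of Schur spectral contractions in $d$ variables which is positivity preserving. Then there are complex coefficients $c_\alpha$, indexed by words $\alpha$ in the letters $1,\dots,d$ (including the empty word), with $c_\alpha\ge 0$ for every $\alpha$, such that for every generalized Schur product $*$ and every $X\in\mathcal{C}^d\cap\mathcal{S}_*^d$ the series $\sum_\alpha c_\alpha X^\alpha$ converges and equals $f(X)$. Here $X^\alpha=X_{\alpha_1}*X_{\alpha_2}*\cdots*X_{\alpha_k}$ for $\alpha=\alpha_1\cdots\alpha_k$, and $X^{\emptyset}$ is the identity element of $*$.
   Context: Generalized Schur product: given unital associative algebras $\mathcal{A}$ (dim $n$), $\mathcal{B}$ (dim $m$) and linear bijections $v_{\mathcal{A}}:\mathcal{A}\to\mathbb{C}^n$, $v_{\mathcal{B}}:\mathcal{B}\to\mathbb{C}^m$, it is the unique bilinear product $*$ on $n\times m$ complex matrices with $v_{\mathcal{A}}(a)v_{\mathcal{B}}(b)^* * v_{\mathcal{A}}(c)v_{\mathcal{B}}(d)^* = v_{\mathcal{A}}(ac)v_{\mathcal{B}}(bd)^*$. $\mathcal{S}_*$ denotes $n\times m$ matrices with product $*$; $\mathcal{S}^d=\bigsqcup_*\mathcal{S}_*^d$ (disjoint union over all generalized Schur products), $\mathcal{S}=\mathcal{S}^1$. A generalized Schur product is positivity preserving if $n=m$ and the $*$-product of two positive semidefinite matrices is positive semidefinite. Schur spectral contraction: $X=(X_1,\dots,X_d)\in\mathcal{S}_*^d$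 ($n\times m$ matrices) is one if there exist tuples $A=(A_i)$ of $m\times m$ and $B=(B_i)$ of $n\times n$ matrices such that each $Y_i=\begin{pmatrix}A_i & X_i^*\\ X_i & B_i\end{pmatrix}$ is positive definite and the tuple $(Y_1,\dots,Y_d)$ has joint spectral radius $<1$, where the $(m+n)\times(m+n)$ matrices carry the generalized Schur product built from the direct sum algebras on both sides (so that the $X$-blocks multiply via $*$), and the joint spectral radius of $(Y_i)$ in a finite-dimensional algebra is $\lim_{k}\max_{|w|=k}\|Y_w\|^{1/k}$ with $Y_w$ the product of the $Y_{i}$ along the word $w$. $\mathcal{C}^d$ is the set of all Schur spectral contractions (over all $*$). Scalar noncommutative function $f:\mathcal{U}\to\mathcal{S}$ ($\mathcal{U}\subseteq\mathcal{S}^d$): (1) $f(X)$ lies in the algebra (in $\mathcal{S}_*$) generated by $X_1,\dots,X_d$; (2) whenever $\varphi$ is a homomorphism from the algebra generated by $X\in\mathcal{U}$ to the algebra generated by $Y\in\mathcal{U}$ with $\varphi(X_i)=Y_i$, then $f(Y)=\varphi(f(X))$. $f$ is positivity preserving if whenever $X\in\mathcal{S}_*^d\cap\mathcal{U}$ with $*$ positivity preserving and each $X_i\ge0$, then $f(X)\ge 0$. *)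

theory Defs
  imports Complex_Main "Jordan_Normal_Form.Matrix"
begin

text \<open>An n-dimensional unital associative algebra together with a linear bijection
  v to C^n is the same as C^n with a bilinear associative unital multiplication;
  it is described by structure constants S i k p = p-th coordinate of e_i e_k.\<close>

type_synonym sconst = "nat \<Rightarrow> nat \<Rightarrow> nat \<Rightarrow> complex"

definition unital_assoc_alg :: "nat \<Rightarrow> sconst \<Rightarrow> bool" where
  "unital_assoc_alg n S \<longleftrightarrow>
     (\<forall>i<n. \<forall>j<n. \<forall>k<n. \<forall>p<n.
        (\<Sum>q<n. S i j q * S q k p) = (\<Sum>q<n. S j k q * S i q p)) \<and>
     (\<exists>u::nat \<Rightarrow> complex. \<forall>i<n. \<forall>p<n.
        (\<Sum>k<n. u k * S k i p) = (if i = p then 1 else 0) \<and>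
        (\<Sum>k<n. u k * S i k p) = (if i = p then 1 else 0))"

text \<open>The generalized Schur product on n x m matrices determined by the algebras
  (A, v_A) and (B, v_B): e_i e_j^* * e_k e_l^* = (e_i e_k)(e_j e_l)^*.\<close>

definition schur_prod ::
  "nat \<Rightarrow> nat \<Rightarrow> sconst \<Rightarrow> sconst \<Rightarrow> complex mat \<Rightarrow> complex mat \<Rightarrow> complex mat" where
  "schur_prod n m SA SB X Y = mat n m (\<lambda>(p,q).
     \<Sum>i<n. \<Sum>j<m. \<Sum>k<n. \<Sum>l<m. X $$ (i,j) * Y $$ (k,l) * SA i k p * cnj (SB j l q))"

text \<open>A generalized Schur product is identified by (n, m, *), * being the product map.\<close>

type_synonym gsp = "nat \<times> nat \<times> (complex mat \<Rightarrow> complex mat \<Rightarrow> complex mat)"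

definition is_gsp :: "gsp \<Rightarrow> bool" where
  "is_gsp G \<longleftrightarrow> (case G of (n, m, mul) \<Rightarrow>
     (\<exists>SA SB. unital_assoc_alg n SA \<and> unital_assoc_alg m SB \<and> mul = schur_prod n m SA SB))"

definition gsp_unit :: "gsp \<Rightarrow> complex mat" where
  "gsp_unit G = (case G of (n, m, mul) \<Rightarrow>
     (THE e. e \<in> carrier_mat n m \<and> (\<forall>Z \<in> carrier_mat n m. mul e Z = Z \<and> mul Z e = Z)))"

text \<open>A point of S^d = disjoint union of S_*^d: a product G together with a d-tuple
  (a list of length d) of n x m matrices.  Letters of words are 0,...,d-1.\<close>

type_synonym pt = "gsp \<times> complex mat list"

definition Sd :: "nat \<Rightarrow> pt set" where
  "Sd d = {(G, X). is_gsp G \<and> length X = d \<and>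
     (\<forall>i<d. X ! i \<in> carrier_mat (fst G) (fst (snd G)))}"

definition words :: "nat \<Rightarrow> nat \<Rightarrow> nat list set" where
  "words d k = {\<alpha>. length \<alpha> = k \<and> set \<alpha> \<subseteq> {..<d}}"

definition words_upto :: "nat \<Rightarrow> nat \<Rightarrow> nat list set" where
  "words_upto d N = {\<alpha>. length \<alpha> \<le> N \<and> set \<alpha> \<subseteq> {..<d}}"

definition all_words :: "nat \<Rightarrow> nat list set" where
  "all_words d = {\<alpha>. set \<alpha> \<subseteq> {..<d}}"

definition monomial :: "gsp \<Rightarrow> complex mat list \<Rightarrow> nat list \<Rightarrow> complex mat" where
  "monomial G X \<alpha> = foldr (\<lambda>i Z. (snd (snd G)) (X ! i) Z) \<alpha> (gsp_unit G)"

definition lin_comb :: "gsp \<Rightarrow> complex mat list \<Rightarrow> nat list set \<Rightarrow> (nat list \<Rightarrow> complex) \<Rightarrow> complex mat" where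
  "lin_comb G X W c = mat (fst G) (fst (snd G))
      (\<lambda>(p,q). \<Sum>\<alpha>\<in>W. c \<alpha> * monomial G X \<alpha> $$ (p,q))"

definition alg_gen :: "nat \<Rightarrow> pt \<Rightarrow> complex mat set" where
  "alg_gen d P = (case P of (G, X) \<Rightarrow>
     {Z. \<exists>W c. finite W \<and> W \<subseteq> all_words d \<and> Z = lin_comb G X W c})"

definition alg_hom :: "nat \<Rightarrow> pt \<Rightarrow> pt \<Rightarrow> (complex mat \<Rightarrow> complex mat) \<Rightarrow> bool" where
  "alg_hom d P Q \<phi> \<longleftrightarrow> (case P of (G, X) \<Rightarrow> case Q of (H, Y) \<Rightarrow>
     (\<forall>Z \<in> alg_gen d P. \<phi> Z \<in> alg_gen d Q) \<and>
     (\<forall>Z \<in> alg_gen d P. \<forall>W \<in> alg_gen d P. \<phi> (Z + W) = \<phi> Z + \<phi> W) \<and>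
     (\<forall>Z \<in> alg_gen d P. \<forall>a::complex. \<phi> (a \<cdot>\<^sub>m Z) = a \<cdot>\<^sub>m \<phi> Z) \<and>
     (\<forall>Z \<in> alg_gen d P. \<forall>W \<in> alg_gen d P.
        \<phi> ((snd (snd G)) Z W) = (snd (snd H)) (\<phi> Z) (\<phi> W)) \<and>
     \<phi> (gsp_unit G) = gsp_unit H)"

definition nc_function :: "nat \<Rightarrow> pt set \<Rightarrow> (pt \<Rightarrow> complex mat) \<Rightarrow> bool" where
  "nc_function d U f \<longleftrightarrow> U \<subseteq> Sd d \<and>
     (\<forall>P \<in> U. f P \<in> alg_gen d P) \<and>
     (\<forall>P \<in> U. \<forall>Q \<in> U. \<forall>\<phi>. alg_hom d P Q \<phi> \<and> (\<forall>i<d. \<phi> (snd P ! i) = snd Q ! i)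
        \<longrightarrow> f Q = \<phi> (f P))"

definition qform :: "complex mat \<Rightarrow> complex vec \<Rightarrow> complex" where
  "qform M x = (\<Sum>i<dim_row M. \<Sum>j<dim_col M. cnj (x $ i) * M $$ (i,j) * x $ j)"

definition psd :: "complex mat \<Rightarrow> bool" where
  "psd M \<longleftrightarrow> square_mat M \<and>
     (\<forall>x \<in> carrier_vec (dim_row M). Im (qform M x) = 0 \<and> Re (qform M x) \<ge> 0)"

definition pd :: "complex mat \<Rightarrow> bool" where
  "pd M \<longleftrightarrow> square_mat M \<and>
     (\<forall>x \<in> carrier_vec (dim_row M). x \<noteq> 0\<^sub>v (dim_row M) \<longrightarrow>
        Im (qform M x) = 0 \<and> Re (qform M x) > 0)"

definition pos_preserving_gsp :: "gsp \<Rightarrow> bool" where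
  "pos_preserving_gsp G \<longleftrightarrow> (case G of (n, m, mul) \<Rightarrow> n = m \<and>
     (\<forall>A \<in> carrier_mat n n. \<forall>B \<in> carrier_mat n n. psd A \<and> psd B \<longrightarrow> psd (mul A B)))"

definition pos_preserving_ncf :: "nat \<Rightarrow> pt set \<Rightarrow> (pt \<Rightarrow> complex mat) \<Rightarrow> bool" where
  "pos_preserving_ncf d U f \<longleftrightarrow>
     (\<forall>G X. (G, X) \<in> U \<and> pos_preserving_gsp G \<and> (\<forall>i<d. psd (X ! i)) \<longrightarrow> psd (f (G, X)))"

definition adj :: "complex mat \<Rightarrow> complex mat" where
  "adj X = mat (dim_col X) (dim_row X) (\<lambda>(i,j). cnj (X $$ (j,i)))"

definition dsum_sc :: "nat \<Rightarrow> sconst \<Rightarrow> sconst \<Rightarrow> sconst" where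
  "dsum_sc m SB SA i k p =
     (if i < m \<and> k < m \<and> p < m then SB i k p
      else if m \<le> i \<and> m \<le> k \<and> m \<le> p then SA (i - m) (k - m) (p - m) else 0)"

definition frob_norm :: "complex mat \<Rightarrow> real" where
  "frob_norm M = sqrt (\<Sum>i<dim_row M. \<Sum>j<dim_col M. (cmod (M $$ (i,j)))\<^sup>2)"

text \<open>Joint spectral radius of the tuple Ys (in the algebra of (n,m,mul)) is < 1:
  the limit of max_{|w|=k} ||Y_w||^{1/k} exists and is < 1 (max over no words := 0).\<close>
definition jsr_lt1 :: "gsp \<Rightarrow> complex mat list \<Rightarrow> bool" where
  "jsr_lt1 G Ys \<longleftrightarrow> (\<exists>L < 1.
     (\<lambda>k. Max (insert 0 ((\<lambda>w. frob_norm (monomial G Ys w) powr (1 / real k))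
                 ` words (length Ys) k))) \<longlonglongrightarrow> L)"

definition schur_spectral_contraction :: "nat \<Rightarrow> pt \<Rightarrow> bool" where
  "schur_spectral_contraction d P \<longleftrightarrow> P \<in> Sd d \<and>
     (case P of ((n, m, mul), X) \<Rightarrow>
       \<exists>SA SB. unital_assoc_alg n SA \<and> unital_assoc_alg m SB \<and> mul = schur_prod n m SA SB \<and>
       (\<exists>A B. length A = d \<and> length B = d \<and>
          (\<forall>i<d. A ! i \<in> carrier_mat m m \<and> B ! i \<in> carrier_mat n n) \<and>
          (let Ys = map (\<lambda>i. four_block_mat (A ! i) (adj (X ! i)) (X ! i) (B ! i)) [0..<d];
               SD = dsum_sc m SB SA
           in (\<forall>i<d. pd (Ys ! i)) \<and>
              jsr_lt1 (m + n, m + n, schur_prod (m + n) (m + n) SD SD) Ys)))"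

definition Cd :: "nat \<Rightarrow> pt set" where
  "Cd d = {P. schur_spectral_contraction d P}"

end

theory Submission
  imports Defs "HOL-Analysis.L2_Norm"
begin

text \<open>
  If \<open>y\<close> is a tuple of positive semidefinite matrices and \<open>W\<close> a tuple of entrywise nonnegative matrices, the
  tensor product of the algebra of \<open>y\<close> with a full matrix algebra carries the positive point \<open>y \<otimes> W\<close>, and
  positivity of \<open>f\<close> there says that \<open>\<Sum>\<^sub>w p\<^sub>w y\<^sup>w (W\<^sup>w)\<^sub>u\<^sub>v\<close> is positive semidefinite for all \<open>u, v\<close>, where \<open>p\<close> is a
  polynomial that represents \<open>f\<close> at \<open>y \<otimes> W\<close>. Truncated shifts on words yield coefficients \<open>c\<^sub>\<alpha> \<ge> 0\<close> that compute \<open>f\<close>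
  at all nilpotent points. For \<open>0 < t < 1\<close>, a bidiagonal matrix with diagonal \<open>1, t, 0, \<dots>, 0\<close> gives, for the
  remainder \<open>R\<^sub>N\<close> of \<open>f\<close> after the terms of degree below \<open>N\<close>, the inequalities
  \<open>0 \<le> R\<^sub>N(ty) \<le> t\<^sup>N R\<^sub>N(y) \<le> t\<^sup>N f(y)\<close>, so the series converges to \<open>f\<close> at \<open>ty\<close>.
  A Schur spectral contraction is a corner of a positive tuple of joint spectral radius less than 1,
  and every such tuple has the form \<open>ty\<close> with \<open>y\<close> of the same kind.
\<close>

section \<open>Algebras given by structure constants\<close>

text \<open>The axioms give at each point only some polynomial representing \<open>f\<close>.
  Polynomials at different points are linked by homomorphisms alone, and no continuity of
  \<open>f\<close> is available. The remedy is to put everything to be compared into one point: a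
  polynomial representing \<open>f\<close> at a point represents it wherever the relations of that
  point hold, so the values at \<open>y\<close> and \<open>ty\<close> and the low-degree parts can
  be read off from one polynomial at one amplified point, where positivity applies. The auxiliary
  matrices are nilpotent or triangular, whereas a nonzero positive semidefinite matrix is never
  nilpotent in the ordinary product. A generalized Schur product escapes this: the entries of
  \<open>W\<close> are listed along the diagonal of a larger matrix, which is positive semidefinite
  as soon as they are nonnegative, while such diagonals still multiply like the matrices
  \<open>W\<close>. Membership in the domain asks for a limit in \<open>jsr_lt1\<close>.
  Contractivity of all words of one fixed length implies it and is an open condition, which yields
  the positive definite perturbations and the factor \<open>t < 1\<close>.\<close>

lemma submultiplicative_root_limit:
  fixes a :: "nat \<Rightarrow> real"
  assumes nonneg: "\<And>k. 0 \<le> a k"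
    and submult: "\<And>k l. a (k + l) \<le> a k * a l"
    and m: "m > 0" "a m < 1"
  shows "\<exists>L<1. (\<lambda>k. a k powr (1 / real k)) \<longlonglongrightarrow> L"
proof -
  define r where "r = (\<lambda>k. a k powr (1 / real k))"
  \<comment> \<open>Fekete's argument: the limit is the infimum of the roots, which is below 1 as
    soon as one root is.\<close>
  define L where "L = Inf (r ` {1..})"
  have bdd: "bdd_below (r ` {1..})"
    by (rule bdd_belowI[of _ 0]) (auto simp: r_def)
  have L_le: "L \<le> r k" if "k \<ge> 1" for k
    unfolding L_def using that by (intro cInf_lower[OF _ bdd]) auto
  have "r m < 1" using m nonneg[of m] powr_less_mono2[of "1 / real m" "a m" 1] by (simp add: r_def)
  then have "L < 1" using L_le[of m] m by linarith
  have upper: "eventually (\<lambda>k. r k < c) sequentially" if c: "L < c" for c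
  proof -
    define b where "b = (L + c) / 2"
    have b: "L < b" "b < c" using c by (auto simp: b_def)
    obtain n where n: "n \<ge> 1" "r n < b"
      using b(1) cInf_lessD[of "r ` {1..}" b] unfolding L_def by auto
    have b0: "b > 0" using n(2) unfolding r_def by (meson less_le_trans not_less powr_ge_zero)
    have an: "a n \<le> b ^ n"
    proof -
      have "a n = r n ^ n"
      proof (cases "a n = 0")
        case False
        then have "a n > 0" using nonneg[of n] by linarith
        then have "r n powr real n = a n" using n unfolding r_def by (simp add: powr_powr)
        then show ?thesis using n \<open>a n > 0\<close> by (simp add: powr_realpow r_def)
      qed (use n in \<open>simp add: r_def\<close>)
      also have "\<dots> \<le> b ^ n" using n by (intro power_mono) (auto simp: r_def)
      finally show ?thesis .
    qed
    \<comment> \<open>Splitting off blocks of length \<open>n\<close> costs a factor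
      \<open>b ^ n\<close> each and leaves an index below \<open>n\<close>, which \<open>B\<close>
      absorbs. The summand 1 keeps \<open>B\<close> positive, so that its roots tend to 1.\<close>
    define B where "B = 1 + (\<Sum>i<n. a i / b ^ i)"
    have B1: "B \<ge> 1" unfolding B_def using nonneg b0 by (simp add: sum_nonneg)
    have rest: "a i \<le> B * b ^ i" if "i < n" for i
    proof -
      have "a i / b ^ i \<le> (\<Sum>i<n. a i / b ^ i)"
        using that nonneg b0 by (intro member_le_sum) auto
      then have "a i / b ^ i \<le> B" by (simp add: B_def)
      then show ?thesis using b0 by (simp add: field_simps)
    qed
    have bound: "a k \<le> B * b ^ k" for k
    proof (induction k rule: less_induct)
      case (less k)
      show ?case
      proof (cases "k < n")
        case False
        have "a k \<le> a n * a (k - n)" using submult[of n "k - n"] False by simp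
        also have "\<dots> \<le> b ^ n * (B * b ^ (k - n))"
          using an less[of "k - n"] n False nonneg b0 by (intro mult_mono) auto
        also have "\<dots> = B * b ^ k" using False by (simp flip: power_add)
        finally show ?thesis .
      qed (use rest in auto)
    qed
    have "((\<lambda>k. B powr (1 / real k)) \<longlongrightarrow> B powr 0) sequentially"
      using B1 by (intro tendsto_intros) (auto simp: lim_1_over_n)
    then have "((\<lambda>k. B powr (1 / real k) * b) \<longlongrightarrow> 1 * b) sequentially"
      using B1 by (intro tendsto_intros) auto
    then have "eventually (\<lambda>k. B powr (1 / real k) * b < c) sequentially"
      using b by (intro order_tendstoD) auto
    then show ?thesis using eventually_gt_at_top[of 0]
    proof eventually_elim
      case (elim k)
      have "r k \<le> (B * b ^ k) powr (1 / real k)"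
        unfolding r_def using bound nonneg by (intro powr_mono2) auto
      also have "\<dots> = B powr (1 / real k) * b"
        using B1 b0 elim by (simp add: powr_mult powr_powr flip: powr_realpow)
      finally show ?case using elim by linarith
    qed
  qed
  have "r \<longlonglongrightarrow> L"
  proof (rule order_tendstoI)
    fix c assume "c < L"
    then show "eventually (\<lambda>k. c < r k) sequentially"
      using L_le by (intro eventually_sequentiallyI[of 1]) force
  qed (rule upper)
  then show ?thesis using \<open>L < 1\<close> unfolding r_def by blast
qed

section \<open>Coordinates, words and norms\<close>

lemma sum_rotate3:
  "(\<Sum>a\<in>A. \<Sum>b\<in>B. \<Sum>c\<in>C. f a b c) = (\<Sum>b\<in>B. \<Sum>c\<in>C. \<Sum>a\<in>A. f a b c)"
  by (subst sum.swap) (intro sum.cong refl sum.swap)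

definition smul :: "'i set \<Rightarrow> ('i \<Rightarrow> 'i \<Rightarrow> 'i \<Rightarrow> complex) \<Rightarrow> ('i \<Rightarrow> complex) \<Rightarrow> ('i \<Rightarrow> complex) \<Rightarrow> 'i \<Rightarrow> complex" where
  "smul I S x y = (\<lambda>p. \<Sum>i\<in>I. \<Sum>k\<in>I. x i * y k * S i k p)"

definition word_val :: "'i set \<Rightarrow> ('i \<Rightarrow> 'i \<Rightarrow> 'i \<Rightarrow> complex) \<Rightarrow> ('i \<Rightarrow> complex) \<Rightarrow>
    (nat \<Rightarrow> 'i \<Rightarrow> complex) \<Rightarrow> nat list \<Rightarrow> 'i \<Rightarrow> complex" where
  "word_val I S u Y w = foldr (\<lambda>i z. smul I S (Y i) z) w u"

text \<open>For finite-dimensional algebras this is equivalent to joint spectral radius less than 1, but it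
  needs no limit to exist.\<close>

definition vanishing :: "nat \<Rightarrow> 'i set \<Rightarrow> (nat list \<Rightarrow> 'i \<Rightarrow> complex) \<Rightarrow> bool" where
  "vanishing d I V \<longleftrightarrow> (\<forall>e>0. \<exists>k0. \<forall>w\<in>all_words d. k0 \<le> length w \<longrightarrow> (\<forall>p\<in>I. cmod (V w p) < e))"

definition l2n :: "'i set \<Rightarrow> ('i \<Rightarrow> complex) \<Rightarrow> real" where
  "l2n I x = L2_set (\<lambda>p. cmod (x p)) I"

text \<open>The inserted 0 is the convention of \<open>jsr_lt1\<close> for an empty alphabet, which
  has no words of positive length.\<close>

definition word_max :: "nat \<Rightarrow> 'i set \<Rightarrow> (nat list \<Rightarrow> 'i \<Rightarrow> complex) \<Rightarrow> nat \<Rightarrow> real" where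
  "word_max d I V k = Max (insert 0 ((\<lambda>w. l2n I (V w)) ` words d k))"

lemma smul_cong:
  assumes "\<And>i. i \<in> I \<Longrightarrow> x i = x' i" "\<And>i. i \<in> I \<Longrightarrow> y i = y' i"
  shows "smul I S x y = smul I S x' y'"
  unfolding smul_def by (intro ext sum.cong refl) (simp add: assms)

lemma word_val_Nil [simp]: "word_val I S u Y [] = u"
  by (simp add: word_val_def)

lemma word_val_Cons [simp]: "word_val I S u Y (i # w) = smul I S (Y i) (word_val I S u Y w)"
  by (simp add: word_val_def)

lemma finite_words [simp]: "finite (words d k)"
  using finite_lists_length_eq[of "{..<d}" k] by (simp add: words_def conj_commute)

lemma l2n_nonneg [simp]: "0 \<le> l2n I x"
  by (simp add: l2n_def)

lemma norm_le_l2n: "finite I \<Longrightarrow> p \<in> I \<Longrightarrow> cmod (x p) \<le> l2n I x"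
  unfolding l2n_def using member_le_L2_set[of I p "\<lambda>p. cmod (x p)"] by simp

lemma l2n_le_sum: "l2n I x \<le> (\<Sum>p\<in>I. cmod (x p))"
  unfolding l2n_def by (rule order_trans[OF L2_set_le_sum_abs]) simp

lemma l2n_cong: "(\<And>p. p \<in> I \<Longrightarrow> x p = y p) \<Longrightarrow> l2n I x = l2n I y"
  unfolding l2n_def by (intro L2_set_cong) auto

lemma word_max_nonneg [simp]: "0 \<le> word_max d I V k"
  unfolding word_max_def by (intro Max_ge) auto

lemma l2n_le_word_max: "w \<in> words d k \<Longrightarrow> l2n I (V w) \<le> word_max d I V k"
  unfolding word_max_def by (intro Max_ge) auto

lemma word_max_le_iff:
  "0 \<le> c \<Longrightarrow> word_max d I V k \<le> c \<longleftrightarrow> (\<forall>w\<in>words d k. l2n I (V w) \<le> c)"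
  unfolding word_max_def by (subst Max_le_iff) auto

lemma word_max_less_iff:
  "0 < c \<Longrightarrow> word_max d I V k < c \<longleftrightarrow> (\<forall>w\<in>words d k. l2n I (V w) < c)"
  unfolding word_max_def by (subst Max_less_iff) auto

text \<open>Index sets are arbitrary finite sets, so that tensor products are indexed by Cartesian
  products. Coordinate vectors are total functions with arbitrary values off \<open>I\<close>;
  identities are therefore claimed only at \<open>p \<in> I\<close>.\<close>

locale sc_algebra =
  fixes I :: "'i set" and S :: "'i \<Rightarrow> 'i \<Rightarrow> 'i \<Rightarrow> complex" and u :: "'i \<Rightarrow> complex"
  assumes fin [simp]: "finite I"
    and struct_assoc: "\<And>i j k p. i \<in> I \<Longrightarrow> j \<in> I \<Longrightarrow> k \<in> I \<Longrightarrow> p \<in> I \<Longrightarrow>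
      (\<Sum>q\<in>I. S i j q * S q k p) = (\<Sum>q\<in>I. S j k q * S i q p)"
    and unit_left: "\<And>i p. i \<in> I \<Longrightarrow> p \<in> I \<Longrightarrow> (\<Sum>k\<in>I. u k * S k i p) = (if i = p then 1 else 0)"
    and unit_right: "\<And>i p. i \<in> I \<Longrightarrow> p \<in> I \<Longrightarrow> (\<Sum>k\<in>I. u k * S i k p) = (if i = p then 1 else 0)"
begin

abbreviation mul where "mul \<equiv> smul I S"
abbreviation wv where "wv \<equiv> word_val I S u"

lemma mul_unit_left: assumes "p \<in> I" shows "mul u x p = x p"
proof -
  have "mul u x p = (\<Sum>k\<in>I. x k * (\<Sum>i\<in>I. u i * S i k p))"
    unfolding smul_def sum_distrib_left by (subst sum.swap) (simp add: mult_ac)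
  also have "\<dots> = (\<Sum>k\<in>I. x k * (if p = k then 1 else 0))"
    by (intro sum.cong refl) (simp add: unit_left assms)
  also have "\<dots> = x p" using assms by (simp add: if_distrib[of "(*) _"] cong: if_cong)
  finally show ?thesis .
qed

lemma mul_unit_right: assumes "p \<in> I" shows "mul x u p = x p"
proof -
  have "mul x u p = (\<Sum>k\<in>I. x k * (\<Sum>i\<in>I. u i * S k i p))"
    unfolding smul_def sum_distrib_left by (simp add: mult_ac)
  also have "\<dots> = (\<Sum>k\<in>I. x k * (if p = k then 1 else 0))"
    by (intro sum.cong refl) (simp add: unit_right assms)
  also have "\<dots> = x p" using assms by (simp add: if_distrib[of "(*) _"] cong: if_cong)
  finally show ?thesis .
qed

lemma mul_assoc: assumes "p \<in> I" shows "mul (mul x y) z p = mul x (mul y z) p"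
proof -
  have "mul (mul x y) z p = (\<Sum>q\<in>I. \<Sum>k\<in>I. \<Sum>i\<in>I. \<Sum>j\<in>I. x i * y j * z k * (S i j q * S q k p))"
    unfolding smul_def sum_distrib_left sum_distrib_right by (simp add: mult_ac)
  also have "\<dots> = (\<Sum>q\<in>I. \<Sum>i\<in>I. \<Sum>j\<in>I. \<Sum>k\<in>I. x i * y j * z k * (S i j q * S q k p))"
    by (rule sum.cong[OF refl]) (rule sum_rotate3)
  also have "\<dots> = (\<Sum>i\<in>I. \<Sum>j\<in>I. \<Sum>q\<in>I. \<Sum>k\<in>I. x i * y j * z k * (S i j q * S q k p))"
    by (rule sum_rotate3)
  also have "\<dots> = (\<Sum>i\<in>I. \<Sum>j\<in>I. \<Sum>k\<in>I. \<Sum>q\<in>I. x i * y j * z k * (S i j q * S q k p))"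
    by (rule sum.cong[OF refl], rule sum.cong[OF refl], rule sum.swap)
  also have "\<dots> = (\<Sum>i\<in>I. \<Sum>j\<in>I. \<Sum>k\<in>I. x i * y j * z k * (\<Sum>q\<in>I. S i j q * S q k p))"
    by (simp add: sum_distrib_left)
  also have "\<dots> = (\<Sum>i\<in>I. \<Sum>j\<in>I. \<Sum>k\<in>I. x i * y j * z k * (\<Sum>q\<in>I. S j k q * S i q p))"
    by (intro sum.cong refl) (simp add: struct_assoc assms)
  also have "\<dots> = (\<Sum>i\<in>I. \<Sum>j\<in>I. \<Sum>k\<in>I. \<Sum>q\<in>I. x i * y j * z k * (S j k q * S i q p))"
    by (simp add: sum_distrib_left)
  also have "\<dots> = (\<Sum>i\<in>I. \<Sum>q\<in>I. \<Sum>j\<in>I. \<Sum>k\<in>I. x i * y j * z k * (S j k q * S i q p))"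
    by (rule sum.cong[OF refl]) (rule sum_rotate3[symmetric])
  also have "\<dots> = mul x (mul y z) p"
    unfolding smul_def sum_distrib_left sum_distrib_right by (simp add: mult_ac)
  finally show ?thesis .
qed

lemma wv_append: "p \<in> I \<Longrightarrow> wv Y (v @ w) p = mul (wv Y v) (wv Y w) p"
proof (induction v arbitrary: p)
  case (Cons i v)
  have "wv Y ((i # v) @ w) p = mul (Y i) (mul (wv Y v) (wv Y w)) p"
    using Cons.IH by (simp cong: smul_cong)
  then show ?case using mul_assoc[OF Cons.prems] by simp
qed (simp add: mul_unit_left)

lemma unit_unique:
  assumes "\<And>x p. p \<in> I \<Longrightarrow> mul e x p = x p" "p \<in> I"
  shows "e p = u p"
  using assms mul_unit_right by metis

text \<open>A crude bound for the bilinear product; multiplied by it, the norm becomes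
  submultiplicative. The summand 1 keeps it positive in the zero algebra.\<close>

definition mulC :: real where "mulC = 1 + (\<Sum>p\<in>I. \<Sum>i\<in>I. \<Sum>k\<in>I. cmod (S i k p))"

lemma mulC_pos: "0 < mulC"
  unfolding mulC_def by (intro add_pos_nonneg) (auto intro!: sum_nonneg)

lemma l2n_mul: "l2n I (mul x y) \<le> mulC * l2n I x * l2n I y"
proof -
  have "l2n I (mul x y) \<le> (\<Sum>p\<in>I. cmod (mul x y p))" by (rule l2n_le_sum)
  also have "\<dots> \<le> (\<Sum>p\<in>I. \<Sum>i\<in>I. \<Sum>k\<in>I. cmod (S i k p) * (l2n I x * l2n I y))"
    unfolding smul_def
    by (intro sum_mono order_trans[OF norm_sum])
       (auto simp: norm_mult mult_ac intro!: mult_left_mono mult_mono norm_le_l2n)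
  also have "\<dots> \<le> mulC * l2n I x * l2n I y"
    unfolding mulC_def by (simp add: sum_distrib_right distrib_right mult.assoc)
  finally show ?thesis .
qed

lemma word_max_submult:
  "mulC * word_max d I (wv Y) (k + l) \<le> (mulC * word_max d I (wv Y) k) * (mulC * word_max d I (wv Y) l)"
proof -
  have "word_max d I (wv Y) (k + l) \<le> mulC * word_max d I (wv Y) k * word_max d I (wv Y) l"
  proof (subst word_max_le_iff)
    show "\<forall>w\<in>words d (k + l). l2n I (wv Y w) \<le> mulC * word_max d I (wv Y) k * word_max d I (wv Y) l"
    proof
      fix w assume w: "w \<in> words d (k + l)"
      let ?v = "take k w" and ?w = "drop k w"
      have vw: "?v \<in> words d k" "?w \<in> words d l" using w set_take_subset[of k w] set_drop_subset[of k w]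
        by (auto simp: words_def)
      have "l2n I (wv Y w) = l2n I (mul (wv Y ?v) (wv Y ?w))"
        using wv_append[of _ Y ?v ?w] by (intro l2n_cong) simp
      also have "\<dots> \<le> mulC * l2n I (wv Y ?v) * l2n I (wv Y ?w)" by (rule l2n_mul)
      also have "\<dots> \<le> mulC * word_max d I (wv Y) k * word_max d I (wv Y) l"
        using vw mulC_pos by (intro mult_mono l2n_le_word_max mult_left_mono) auto
      finally show "l2n I (wv Y w) \<le> mulC * word_max d I (wv Y) k * word_max d I (wv Y) l" .
    qed
  qed (use mulC_pos in auto)
  then show ?thesis using mulC_pos by (simp add: mult_ac)
qed

text \<open>One contractive length is enough, by submultiplicativity. The roots of the constant
  \<open>mulC\<close> tend to 1, so removing it does not change the limit.\<close>

lemma root_limit_if_contractive: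
  assumes "m > 0" "\<And>w. w \<in> words d m \<Longrightarrow> mulC * l2n I (wv Y w) < 1"
  shows "\<exists>L<1. (\<lambda>k. word_max d I (wv Y) k powr (1 / real k)) \<longlonglongrightarrow> L"
proof -
  let ?a = "\<lambda>k. mulC * word_max d I (wv Y) k"
  have "word_max d I (wv Y) m < 1 / mulC"
    using assms mulC_pos by (subst word_max_less_iff) (auto simp: field_simps)
  then have "?a m < 1" using mulC_pos by (simp add: field_simps)
  then obtain L where L: "L < 1" "(\<lambda>k. ?a k powr (1 / real k)) \<longlonglongrightarrow> L"
    using submultiplicative_root_limit[of ?a m] word_max_submult mulC_pos assms(1) by auto
  have "(\<lambda>k. mulC powr (1 / real k)) \<longlonglongrightarrow> mulC powr 0"
    using mulC_pos by (intro tendsto_intros) (auto simp: lim_1_over_n)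
  then have "(\<lambda>k. ?a k powr (1 / real k) / mulC powr (1 / real k)) \<longlonglongrightarrow> L / 1"
    using mulC_pos L by (intro tendsto_intros) auto
  moreover have "?a k powr (1 / real k) / mulC powr (1 / real k) = word_max d I (wv Y) k powr (1 / real k)" for k
    using mulC_pos by (simp add: powr_mult)
  ultimately show ?thesis using L(1) by auto
qed

lemma contractive_if_vanishing:
  assumes "vanishing d I (wv Y)"
  shows "\<exists>m>0. \<forall>w\<in>words d m. mulC * l2n I (wv Y w) < 1"
proof -
  \<comment> \<open>The norm is at most \<open>card I\<close> times a bound for the entries; adding
    1 makes the final bound \<open>1 / mulC\<close> strict, also for empty \<open>I\<close>.\<close>
  define e where "e = 1 / (mulC * (1 + real (card I)))"
  have e: "e > 0" using mulC_pos by (simp add: e_def)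
  obtain k0 where k0: "\<And>w p. w \<in> all_words d \<Longrightarrow> k0 \<le> length w \<Longrightarrow> p \<in> I \<Longrightarrow> cmod (wv Y w p) < e"
    using assms e unfolding vanishing_def by blast
  have "mulC * l2n I (wv Y w) < 1" if "w \<in> words d (Suc k0)" for w
  proof -
    have "l2n I (wv Y w) \<le> (\<Sum>p\<in>I. cmod (wv Y w p))" by (rule l2n_le_sum)
    also have "\<dots> \<le> (\<Sum>p\<in>I. e)"
      using that by (intro sum_mono less_imp_le k0) (auto simp: words_def all_words_def)
    also have "\<dots> < (1 + real (card I)) * e" using e by (simp add: algebra_simps)
    also have "\<dots> = 1 / mulC" by (simp add: e_def)
    finally show ?thesis using mulC_pos by (simp add: field_simps)
  qed
  then show ?thesis by blast
qed

text \<open>At a fixed length there are finitely many words, each continuous in \<epsilon>, so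
  contractivity survives small perturbations in any direction \<open>E\<close>. The condition with
  the limit does not show this stability directly.\<close>

lemma perturbation_contractive:
  assumes "\<forall>w\<in>words d m. mulC * l2n I (wv Y w) < 1"
  shows "\<exists>\<epsilon>>0. \<forall>w\<in>words d m. mulC * l2n I (wv (\<lambda>i p. Y i p + of_real \<epsilon> * E i p) w) < 1"
proof -
  have cont: "((\<lambda>\<epsilon>. wv (\<lambda>i p. Y i p + of_real \<epsilon> * E i p) w p) \<longlongrightarrow> wv Y w p) (at_right (0::real))" for w p
  proof (induction w arbitrary: p)
    case (Cons i w)
    have "((\<lambda>\<epsilon>. Y i p + of_real \<epsilon> * E i p) \<longlongrightarrow> Y i p + of_real 0 * E i p) (at_right (0::real))" for p
      by (intro tendsto_intros)
    then have "((\<lambda>\<epsilon>. Y i p + of_real \<epsilon> * E i p) \<longlongrightarrow> Y i p) (at_right (0::real))" for p by simp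
    then show ?case unfolding word_val_Cons smul_def by (intro tendsto_intros Cons.IH)
  qed simp
  have "eventually (\<lambda>\<epsilon>. \<forall>w\<in>words d m. mulC * l2n I (wv (\<lambda>i p. Y i p + of_real \<epsilon> * E i p) w) < 1) (at_right 0)"
  proof (intro eventually_ball_finite ballI)
    fix w assume w: "w \<in> words d m"
    have "((\<lambda>\<epsilon>. mulC * l2n I (wv (\<lambda>i p. Y i p + of_real \<epsilon> * E i p) w)) \<longlongrightarrow> mulC * l2n I (wv Y w)) (at_right (0::real))"
      unfolding l2n_def L2_set_def by (intro tendsto_intros cont)
    then show "eventually (\<lambda>\<epsilon>. mulC * l2n I (wv (\<lambda>i p. Y i p + of_real \<epsilon> * E i p) w) < 1) (at_right 0)"
      using assms w by (intro order_tendstoD) auto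
  qed simp
  moreover have "eventually (\<lambda>\<epsilon>. \<epsilon> > 0) (at_right (0::real))"
    by (simp add: eventually_at_right_less)
  ultimately have "eventually (\<lambda>\<epsilon>. \<epsilon> > 0 \<and> (\<forall>w\<in>words d m. mulC * l2n I (wv (\<lambda>i p. Y i p + of_real \<epsilon> * E i p) w) < 1)) (at_right 0)"
    by eventually_elim auto
  then show ?thesis using eventually_happens'[of "at_right (0::real)"] by (auto simp: trivial_limit_at_right_real)
qed

end

lemma vanishing_if_root_limit:
  assumes "finite I" "L < 1" "(\<lambda>k. word_max d I V k powr (1 / real k)) \<longlonglongrightarrow> L"
  shows "vanishing d I V"
  unfolding vanishing_def
proof (intro allI impI)
  fix e :: real assume e: "e > 0"
  \<comment> \<open>The maximum with 1/2 keeps \<open>r\<close> positive without an argument on the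
    sign of \<open>L\<close>.\<close>
  define r where "r = max ((L + 1) / 2) (1 / 2)"
  have r: "L < r" "0 < r" "r < 1" using assms(2) by (auto simp: r_def max_def)
  have "eventually (\<lambda>k. word_max d I V k powr (1 / real k) < r) sequentially"
    using assms(3) r by (intro order_tendstoD) auto
  moreover have "eventually (\<lambda>k. r ^ k < e) sequentially"
    using r e by (intro order_tendstoD(2)[OF LIMSEQ_realpow_zero]) auto
  ultimately have "eventually (\<lambda>k. word_max d I V k < e) sequentially"
    using eventually_gt_at_top[of 0]
  proof eventually_elim
    case (elim k)
    have "word_max d I V k = (word_max d I V k powr (1 / real k)) powr real k"
      using elim by (simp add: powr_powr)
    also have "\<dots> \<le> r powr real k" using elim r by (intro powr_mono2) auto
    finally show ?case using elim r by (simp add: powr_realpow)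
  qed
  then obtain k0 where k0: "\<And>k. k \<ge> k0 \<Longrightarrow> word_max d I V k < e"
    unfolding eventually_sequentially by blast
  show "\<exists>k0. \<forall>w\<in>all_words d. k0 \<le> length w \<longrightarrow> (\<forall>p\<in>I. cmod (V w p) < e)"
  proof (intro exI ballI impI)
    fix w p assume "w \<in> all_words d" "k0 \<le> length w" "p \<in> I"
    then show "cmod (V w p) < e"
      using norm_le_l2n[OF assms(1), of p "V w"] l2n_le_word_max[of w d "length w" I V] k0[of "length w"]
      by (auto simp: words_def all_words_def)
  qed
qed

section \<open>Generalized Schur products\<close>

text \<open>Structure constants of the tensor product of the left algebra with the complex conjugate
  of the right one; matrices with the generalized Schur product are its coordinate vectors.\<close>

definition gsc :: "('i \<Rightarrow> 'i \<Rightarrow> 'i \<Rightarrow> complex) \<Rightarrow> ('j \<Rightarrow> 'j \<Rightarrow> 'j \<Rightarrow> complex) \<Rightarrow>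
    'i \<times> 'j \<Rightarrow> 'i \<times> 'j \<Rightarrow> 'i \<times> 'j \<Rightarrow> complex" where
  "gsc SA SB = (\<lambda>(i,j) (k,l) (p,q). SA i k p * cnj (SB j l q))"

definition tensor_unit :: "('i \<Rightarrow> complex) \<Rightarrow> ('j \<Rightarrow> complex) \<Rightarrow> 'i \<times> 'j \<Rightarrow> complex" where
  "tensor_unit u v = (\<lambda>(i,j). u i * cnj (v j))"

lemma gsc_apply [simp]: "gsc SA SB (i,j) (k,l) (p,q) = SA i k p * cnj (SB j l q)"
  by (simp add: gsc_def)

lemma tensor_unit_apply [simp]: "tensor_unit u v (i,j) = u i * cnj (v j)"
  by (simp add: tensor_unit_def)

lemma sc_algebra_gsc:
  assumes "sc_algebra I SA u" "sc_algebra J SB v"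
  shows "sc_algebra (I \<times> J) (gsc SA SB) (tensor_unit u v)"
proof -
  interpret A: sc_algebra I SA u by fact
  interpret B: sc_algebra J SB v by fact
  have split: "(\<Sum>z\<in>I\<times>J. F (fst z) * cnj (H (snd z))) = (\<Sum>a\<in>I. F a) * cnj (\<Sum>b\<in>J. H b)" for F H
    by (simp add: sum_product sum.cartesian_product case_prod_unfold)
  show ?thesis
  proof
    fix x y z w assume "x \<in> I \<times> J" "y \<in> I \<times> J" "z \<in> I \<times> J" "w \<in> I \<times> J"
    then obtain i j k l p q r s where xs: "x = (i,j)" "y = (k,l)" "z = (p,q)" "w = (r,s)"
      "i \<in> I" "k \<in> I" "p \<in> I" "r \<in> I" "j \<in> J" "l \<in> J" "q \<in> J" "s \<in> J" by auto
    have "(\<Sum>t\<in>I\<times>J. gsc SA SB x y t * gsc SA SB t z w)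
        = (\<Sum>t\<in>I\<times>J. (SA i k (fst t) * SA (fst t) p r) * cnj (SB j l (snd t) * SB (snd t) q s))"
      by (intro sum.cong refl) (auto simp: xs)
    also have "\<dots> = (\<Sum>t\<in>I\<times>J. (SA k p (fst t) * SA i (fst t) r) * cnj (SB l q (snd t) * SB j (snd t) s))"
      using xs A.struct_assoc[of i k p r] B.struct_assoc[of j l q s]
      by (simp only: split[of "\<lambda>a. SA i k a * SA a p r" "\<lambda>b. SB j l b * SB b q s"]
            split[of "\<lambda>a. SA k p a * SA i a r" "\<lambda>b. SB l q b * SB j b s"])
    also have "\<dots> = (\<Sum>t\<in>I\<times>J. gsc SA SB y z t * gsc SA SB x t w)"
      by (intro sum.cong refl) (auto simp: xs)
    finally show "(\<Sum>t\<in>I\<times>J. gsc SA SB x y t * gsc SA SB t z w) = (\<Sum>t\<in>I\<times>J. gsc SA SB y z t * gsc SA SB x t w)" .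
  next
    fix x y assume "x \<in> I \<times> J" "y \<in> I \<times> J"
    then obtain i j k l where xs: "x = (i,j)" "y = (k,l)"
      "i \<in> I" "k \<in> I" "j \<in> J" "l \<in> J" by auto
    have "(\<Sum>t\<in>I\<times>J. tensor_unit u v t * gsc SA SB t x y)
        = (\<Sum>t\<in>I\<times>J. (u (fst t) * SA (fst t) i k) * cnj (v (snd t) * SB (snd t) j l))"
      by (intro sum.cong refl) (auto simp: xs)
    also have "\<dots> = (if i = k then 1 else 0) * cnj (if j = l then 1 else 0)"
      using xs A.unit_left[of i k] B.unit_left[of j l]
      by (simp only: split[of "\<lambda>a. u a * SA a i k" "\<lambda>b. v b * SB b j l"])
    finally show "(\<Sum>t\<in>I\<times>J. tensor_unit u v t * gsc SA SB t x y) = (if x = y then 1 else 0)"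
      by (auto simp: xs)
    have "(\<Sum>t\<in>I\<times>J. tensor_unit u v t * gsc SA SB x t y)
        = (\<Sum>t\<in>I\<times>J. (u (fst t) * SA i (fst t) k) * cnj (v (snd t) * SB j (snd t) l))"
      by (intro sum.cong refl) (auto simp: xs)
    also have "\<dots> = (if i = k then 1 else 0) * cnj (if j = l then 1 else 0)"
      using xs A.unit_right[of i k] B.unit_right[of j l]
      by (simp only: split[of "\<lambda>a. u a * SA i a k" "\<lambda>b. v b * SB j b l"])
    finally show "(\<Sum>t\<in>I\<times>J. tensor_unit u v t * gsc SA SB x t y) = (if x = y then 1 else 0)"
      by (auto simp: xs)
  qed simp
qed

text \<open>Forgetting the coordinates outside \<open>\<iota> ` I\<close> is a homomorphism onto the algebra with index set \<open>I\<close>.\<close>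

definition sc_restrict :: "('i \<Rightarrow> 'j) \<Rightarrow> 'i set \<Rightarrow> ('i \<Rightarrow> 'i \<Rightarrow> 'i \<Rightarrow> complex) \<Rightarrow>
    'j set \<Rightarrow> ('j \<Rightarrow> 'j \<Rightarrow> 'j \<Rightarrow> complex) \<Rightarrow> bool" where
  "sc_restrict \<iota> I S J T \<longleftrightarrow> inj_on \<iota> I \<and> \<iota> ` I \<subseteq> J \<and>
     (\<forall>p\<in>I. \<forall>i\<in>J. \<forall>k\<in>J. i \<notin> \<iota> ` I \<or> k \<notin> \<iota> ` I \<longrightarrow> T i k (\<iota> p) = 0) \<and>
     (\<forall>p\<in>I. \<forall>i\<in>I. \<forall>k\<in>I. T (\<iota> i) (\<iota> k) (\<iota> p) = S i k p)"

lemma smul_restrict: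
  assumes fin: "finite J" and r: "sc_restrict \<iota> I S J T" and p: "p \<in> I"
  shows "smul J T x y (\<iota> p) = smul I S (\<lambda>i. x (\<iota> i)) (\<lambda>i. y (\<iota> i)) p"
proof -
  have inj: "inj_on \<iota> I" and sub: "\<iota> ` I \<subseteq> J"
    and zero: "\<And>i k. i \<in> J \<Longrightarrow> k \<in> J \<Longrightarrow> i \<notin> \<iota> ` I \<or> k \<notin> \<iota> ` I \<Longrightarrow> T i k (\<iota> p) = 0"
    and same: "\<And>i k. i \<in> I \<Longrightarrow> k \<in> I \<Longrightarrow> T (\<iota> i) (\<iota> k) (\<iota> p) = S i k p"
    using r p by (auto simp: sc_restrict_def)
  have "smul J T x y (\<iota> p) = (\<Sum>i\<in>\<iota> ` I. \<Sum>k\<in>J. x i * y k * T i k (\<iota> p))"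
    unfolding smul_def using fin sub zero
    by (intro sum.mono_neutral_right ballI sum.neutral) auto
  also have "\<dots> = (\<Sum>i\<in>\<iota> ` I. \<Sum>k\<in>\<iota> ` I. x i * y k * T i k (\<iota> p))"
    using fin sub zero by (intro sum.cong refl sum.mono_neutral_right ballI) auto
  also have "\<dots> = smul I S (\<lambda>i. x (\<iota> i)) (\<lambda>i. y (\<iota> i)) p"
    unfolding smul_def by (simp add: sum.reindex[OF inj] same)
  finally show ?thesis .
qed

text \<open>The restriction is a surjective homomorphism, so it carries the unit to an element that
  acts as a unit, which settles the empty word.\<close>

lemma word_val_restrict:
  fixes I :: "'i set" and J :: "'j set"
  assumes I: "sc_algebra I S u" and J: "sc_algebra J T v"
    and r: "sc_restrict \<iota> I S J T"
    and Y: "\<And>i p. i \<in> set w \<Longrightarrow> p \<in> I \<Longrightarrow> Y i (\<iota> p) = X i p"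
    and p: "p \<in> I"
  shows "word_val J T v Y w (\<iota> p) = word_val I S u X w p"
proof -
  interpret A: sc_algebra I S u by fact
  interpret B: sc_algebra J T v by fact
  note mul = smul_restrict[OF B.fin r]
  have inj: "inj_on \<iota> I" and sub: "\<iota> ` I \<subseteq> J" using r by (auto simp: sc_restrict_def)
  have unit: "v (\<iota> p) = u p" if "p \<in> I" for p
  proof (rule A.unit_unique[OF _ that])
    fix x :: "'i \<Rightarrow> complex" and p assume p: "p \<in> I"
    \<comment> \<open>Surjectivity: an extension of \<open>x\<close> to \<open>J\<close>. Its values
      outside the image of \<open>\<iota>\<close> are irrelevant, because the restricted product
      never reads them.\<close>
    define x' where "x' = (\<lambda>j. x (the_inv_into I \<iota> j))"
    have x': "x' (\<iota> i) = x i" if "i \<in> I" for i using inj that by (simp add: x'_def the_inv_into_f_f)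
    have "x p = smul J T v x' (\<iota> p)" using B.mul_unit_left[of "\<iota> p" x'] sub p x' by auto
    also have "\<dots> = smul I S (\<lambda>p. v (\<iota> p)) x p"
      using p x' by (subst mul[OF p]) (auto intro: fun_cong[OF smul_cong])
    finally show "smul I S (\<lambda>p. v (\<iota> p)) x p = x p" ..
  qed
  show ?thesis using p Y
  proof (induction w arbitrary: p)
    case (Cons i w)
    have "word_val J T v Y (i # w) (\<iota> p)
        = smul I S (\<lambda>p. Y i (\<iota> p)) (\<lambda>p. word_val J T v Y w (\<iota> p)) p"
      using Cons.prems by (simp add: mul)
    also have "\<dots> = smul I S (X i) (word_val I S u X w) p"
      using Cons by (intro fun_cong[OF smul_cong]) auto
    finally show ?case by simp
  qed (simp add: unit)
qed

section \<open>Matrices, monomials and noncommutative polynomials\<close>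

lemma unital_assoc_alg_iff: "unital_assoc_alg n S \<longleftrightarrow> (\<exists>u. sc_algebra {..<n} S u)"
proof
  assume S: "unital_assoc_alg n S"
  then obtain u where u: "\<forall>i<n. \<forall>p<n. (\<Sum>k<n. u k * S k i p) = (if i = p then 1 else 0) \<and>
      (\<Sum>k<n. u k * S i k p) = (if i = p then 1 else 0)"
    unfolding unital_assoc_alg_def by blast
  have "sc_algebra {..<n} S u"
    by unfold_locales (use S u in \<open>simp_all add: unital_assoc_alg_def\<close>)
  then show "\<exists>u. sc_algebra {..<n} S u" by blast
next
  assume "\<exists>u. sc_algebra {..<n} S u"
  then obtain u where "sc_algebra {..<n} S u" by blast
  then interpret sc_algebra "{..<n}" S u .
  show "unital_assoc_alg n S"
    unfolding unital_assoc_alg_def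
    by (intro conjI allI impI exI[of _ u]) (simp_all add: struct_assoc unit_left unit_right)
qed

lemma lin_comb_carrier [simp]: "lin_comb G X W c \<in> carrier_mat (fst G) (fst (snd G))"
  by (simp add: lin_comb_def)

lemma lin_comb_index:
  "p < fst G \<Longrightarrow> q < fst (snd G) \<Longrightarrow>
    lin_comb G X W c $$ (p,q) = (\<Sum>\<alpha>\<in>W. c \<alpha> * monomial G X \<alpha> $$ (p,q))"
  by (simp add: lin_comb_def)

lemma smul_sum:
  "smul I S (\<lambda>z. \<Sum>a\<in>A. c a * x a z) (\<lambda>z. \<Sum>b\<in>B. c' b * y b z) p
    = (\<Sum>a\<in>A. \<Sum>b\<in>B. c a * c' b * smul I S (x a) (y b) p)"
proof -
  have "smul I S (\<lambda>z. \<Sum>a\<in>A. c a * x a z) (\<lambda>z. \<Sum>b\<in>B. c' b * y b z) p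
      = (\<Sum>i\<in>I. \<Sum>k\<in>I. \<Sum>a\<in>A. \<Sum>b\<in>B. c a * c' b * (x a i * y b k * S i k p))"
    unfolding smul_def sum_product unfolding sum_distrib_right by (simp add: mult_ac)
  also have "\<dots> = (\<Sum>i\<in>I. \<Sum>a\<in>A. \<Sum>b\<in>B. \<Sum>k\<in>I. c a * c' b * (x a i * y b k * S i k p))"
    by (rule sum.cong[OF refl]) (rule sum_rotate3)
  also have "\<dots> = (\<Sum>a\<in>A. \<Sum>b\<in>B. \<Sum>i\<in>I. \<Sum>k\<in>I. c a * c' b * (x a i * y b k * S i k p))"
    by (rule sum_rotate3)
  finally show ?thesis by (simp add: smul_def sum_distrib_left)
qed

definition conv_words :: "nat list set \<Rightarrow> nat list set \<Rightarrow> nat list set" where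
  "conv_words W W' = (\<lambda>(v,w). v @ w) ` (W \<times> W')"

text \<open>A word can be a concatenation in several ways, so all pairs of factors
  contribute.\<close>

definition conv_coeff :: "nat list set \<Rightarrow> (nat list \<Rightarrow> complex) \<Rightarrow> nat list set \<Rightarrow> (nat list \<Rightarrow> complex) \<Rightarrow> nat list \<Rightarrow> complex" where
  "conv_coeff W c W' c' \<alpha> = (\<Sum>(v,w)\<in>{z \<in> W \<times> W'. fst z @ snd z = \<alpha>}. c v * c' w)"

locale gsp_algebra = A: sc_algebra "{..<n}" SA uA + B: sc_algebra "{..<m}" SB uB
  for n m :: nat and SA SB :: sconst and uA uB :: "nat \<Rightarrow> complex"
begin

abbreviation "idx \<equiv> {..<n} \<times> {..<m}"
abbreviation "G \<equiv> (n, m, schur_prod n m SA SB)"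
abbreviation "wvG \<equiv> word_val idx (gsc SA SB) (tensor_unit uA uB)"

sublocale T: sc_algebra idx "gsc SA SB" "tensor_unit uA uB"
  by (rule sc_algebra_gsc) unfold_locales

lemma is_gsp: "is_gsp G"
  unfolding is_gsp_def using unital_assoc_alg_iff A.sc_algebra_axioms B.sc_algebra_axioms by auto

lemma schur_prod_carrier [simp]: "schur_prod n m SA SB X Y \<in> carrier_mat n m"
  by (simp add: schur_prod_def)

lemma schur_prod_index:
  assumes "z \<in> idx"
  shows "schur_prod n m SA SB X Y $$ z = smul idx (gsc SA SB) (($$) X) (($$) Y) z"
proof -
  obtain p q where z: "z = (p,q)" "p < n" "q < m" using assms by auto
  show ?thesis
    by (simp add: z schur_prod_def smul_def mult.assoc sum.cartesian_product')
qed

lemma gsp_unit_eq: "gsp_unit G = mat n m (tensor_unit uA uB)"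
proof -
  let ?e = "mat n m (tensor_unit uA uB)"
  have e: "($$) ?e z = tensor_unit uA uB z" if "z \<in> idx" for z using that by auto
  have left: "schur_prod n m SA SB ?e Z = Z" if "Z \<in> carrier_mat n m" for Z
  proof (rule eq_matI)
    fix i j assume ij: "i < dim_row Z" "j < dim_col Z"
    then have z: "(i,j) \<in> idx" using that by auto
    have "smul idx (gsc SA SB) (($$) ?e) (($$) Z) = smul idx (gsc SA SB) (tensor_unit uA uB) (($$) Z)"
      using e by (intro smul_cong) auto
    then show "schur_prod n m SA SB ?e Z $$ (i,j) = Z $$ (i,j)"
      using schur_prod_index[OF z] T.mul_unit_left[OF z] by simp
  qed (use that in \<open>auto simp: schur_prod_def\<close>)
  have right: "schur_prod n m SA SB Z ?e = Z" if "Z \<in> carrier_mat n m" for Z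
  proof (rule eq_matI)
    fix i j assume ij: "i < dim_row Z" "j < dim_col Z"
    then have z: "(i,j) \<in> idx" using that by auto
    have "smul idx (gsc SA SB) (($$) Z) (($$) ?e) = smul idx (gsc SA SB) (($$) Z) (tensor_unit uA uB)"
      using e by (intro smul_cong) auto
    then show "schur_prod n m SA SB Z ?e $$ (i,j) = Z $$ (i,j)"
      using schur_prod_index[OF z] T.mul_unit_right[OF z] by simp
  qed (use that in \<open>auto simp: schur_prod_def\<close>)
  have "(THE e. e \<in> carrier_mat n m \<and> (\<forall>Z\<in>carrier_mat n m. schur_prod n m SA SB e Z = Z \<and> schur_prod n m SA SB Z e = Z)) = ?e"
  proof (rule the_equality)
    fix e assume "e \<in> carrier_mat n m \<and> (\<forall>Z\<in>carrier_mat n m. schur_prod n m SA SB e Z = Z \<and> schur_prod n m SA SB Z e = Z)"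
    then show "e = ?e" using right[of e] by (metis mat_carrier)
  qed (use left right in auto)
  then show ?thesis by (simp add: gsp_unit_def)
qed

lemma monomial_Nil: "monomial G X [] = mat n m (tensor_unit uA uB)"
  by (simp add: monomial_def gsp_unit_eq)

lemma monomial_Cons: "monomial G X (i # w) = schur_prod n m SA SB (X ! i) (monomial G X w)"
  by (simp add: monomial_def)

lemma monomial_carrier [simp]: "monomial G X w \<in> carrier_mat n m"
  by (cases w) (simp_all add: monomial_Nil monomial_Cons)

lemma monomial_index: "z \<in> idx \<Longrightarrow> monomial G X w $$ z = wvG (\<lambda>i. ($$) (X ! i)) w z"
proof (induction w arbitrary: z)
  case (Cons i w)
  then show ?case
    by (simp add: monomial_Cons schur_prod_index cong: smul_cong)
qed (auto simp: monomial_Nil)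

lemma monomial_append:
  "monomial G X (v @ w) = schur_prod n m SA SB (monomial G X v) (monomial G X w)"
proof (rule eq_matI)
  fix i j assume "i < dim_row (schur_prod n m SA SB (monomial G X v) (monomial G X w))"
    "j < dim_col (schur_prod n m SA SB (monomial G X v) (monomial G X w))"
  then have z: "(i,j) \<in> idx" by (auto simp: schur_prod_def)
  then show "monomial G X (v @ w) $$ (i,j) = schur_prod n m SA SB (monomial G X v) (monomial G X w) $$ (i,j)"
    by (simp add: schur_prod_index monomial_index T.wv_append cong: smul_cong)
qed (use carrier_matD[OF monomial_carrier] in \<open>auto simp: schur_prod_def\<close>)

lemma monomial_single:
  assumes "X ! i \<in> carrier_mat n m" shows "monomial G X [i] = X ! i"
proof (rule eq_matI)
  fix a b assume "a < dim_row (X ! i)" "b < dim_col (X ! i)"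
  then have z: "(a,b) \<in> idx" using assms by auto
  then show "monomial G X [i] $$ (a,b) = X ! i $$ (a,b)"
    by (simp add: monomial_index T.mul_unit_right)
qed (use assms carrier_matD[OF monomial_carrier] in auto)

lemma lin_comb_mult:
  assumes "finite W" "finite W'"
  shows "schur_prod n m SA SB (lin_comb G X W c) (lin_comb G X W' c')
    = lin_comb G X (conv_words W W') (conv_coeff W c W' c')"
proof (rule eq_matI)
  fix i j assume "i < dim_row (lin_comb G X (conv_words W W') (conv_coeff W c W' c'))"
    "j < dim_col (lin_comb G X (conv_words W W') (conv_coeff W c W' c'))"
  then have ij: "i < n" "j < m" and z: "(i,j) \<in> idx" by (auto simp: lin_comb_def)
  let ?M = "\<lambda>\<alpha>. ($$) (monomial G X \<alpha>)"
  have "schur_prod n m SA SB (lin_comb G X W c) (lin_comb G X W' c') $$ (i,j)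
      = smul idx (gsc SA SB) (\<lambda>z. \<Sum>\<alpha>\<in>W. c \<alpha> * ?M \<alpha> z) (\<lambda>z. \<Sum>\<alpha>\<in>W'. c' \<alpha> * ?M \<alpha> z) (i,j)"
    unfolding schur_prod_index[OF z]
    by (intro fun_cong[OF smul_cong]) (auto simp: lin_comb_index)
  also have "\<dots> = (\<Sum>v\<in>W. \<Sum>w\<in>W'. c v * c' w * smul idx (gsc SA SB) (?M v) (?M w) (i,j))"
    by (rule smul_sum)
  also have "\<dots> = (\<Sum>z\<in>W\<times>W'. c (fst z) * c' (snd z) * ?M (fst z @ snd z) (i,j))"
    by (simp add: monomial_append schur_prod_index[OF z] sum.cartesian_product case_prod_unfold)
  also have "\<dots> = (\<Sum>\<alpha>\<in>(\<lambda>z. fst z @ snd z) ` (W \<times> W').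
      \<Sum>z | z \<in> W \<times> W' \<and> fst z @ snd z = \<alpha>. c (fst z) * c' (snd z) * ?M (fst z @ snd z) (i,j))"
    by (rule sum.image_gen) (use assms in auto)
  also have "\<dots> = (\<Sum>\<alpha>\<in>conv_words W W'. conv_coeff W c W' c' \<alpha> * ?M \<alpha> (i,j))"
    unfolding conv_words_def conv_coeff_def case_prod_unfold sum_distrib_right
    by (intro sum.cong refl) auto
  finally show "schur_prod n m SA SB (lin_comb G X W c) (lin_comb G X W' c') $$ (i,j)
      = lin_comb G X (conv_words W W') (conv_coeff W c W' c') $$ (i,j)"
    by (simp add: lin_comb_index ij)
qed (auto simp: lin_comb_def schur_prod_def)

lemma lin_comb_singleton: "lin_comb G X {w} (\<lambda>_. 1) = monomial G X w"
  using carrier_matD[OF monomial_carrier] by (intro eq_matI) (auto simp: lin_comb_def)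

end

text \<open>\<open>lin_comb\<close> ignores coefficients outside its set of words; they may be
  nonzero and have to be masked before adding.\<close>

definition add_coeff :: "nat list set \<Rightarrow> (nat list \<Rightarrow> complex) \<Rightarrow> nat list set \<Rightarrow> (nat list \<Rightarrow> complex) \<Rightarrow> nat list \<Rightarrow> complex" where
  "add_coeff W c W' c' \<alpha> = (if \<alpha> \<in> W then c \<alpha> else 0) + (if \<alpha> \<in> W' then c' \<alpha> else 0)"

lemma sum_add_coeff:
  assumes "finite W" "finite W'"
  shows "(\<Sum>\<alpha>\<in>W \<union> W'. add_coeff W c W' c' \<alpha> * g \<alpha>) = (\<Sum>\<alpha>\<in>W. c \<alpha> * g \<alpha>) + (\<Sum>\<alpha>\<in>W'. c' \<alpha> * g \<alpha>)"
proof -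
  have 1: "(\<Sum>\<alpha>\<in>W \<union> W'. (if \<alpha> \<in> W then c \<alpha> else 0) * g \<alpha>) = (\<Sum>\<alpha>\<in>W. c \<alpha> * g \<alpha>)"
    using assms by (intro sum.mono_neutral_cong_right) auto
  have 2: "(\<Sum>\<alpha>\<in>W \<union> W'. (if \<alpha> \<in> W' then c' \<alpha> else 0) * g \<alpha>) = (\<Sum>\<alpha>\<in>W'. c' \<alpha> * g \<alpha>)"
    using assms by (intro sum.mono_neutral_cong_right) auto
  show ?thesis by (simp add: add_coeff_def distrib_right sum.distrib 1 2)
qed

lemma lin_comb_add:
  assumes "finite W" "finite W'"
  shows "lin_comb G X W c + lin_comb G X W' c' = lin_comb G X (W \<union> W') (add_coeff W c W' c')"
  by (rule eq_matI) (auto simp: lin_comb_def sum_add_coeff assms)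

lemma lin_comb_smult: "a \<cdot>\<^sub>m lin_comb G X W c = lin_comb G X W (\<lambda>\<alpha>. a * c \<alpha>)"
  by (rule eq_matI) (auto simp: lin_comb_def sum_distrib_left mult.assoc)

lemma Sd_gsp_algebra:
  assumes "(G, X) \<in> Sd d"
  shows "\<exists>n m SA SB uA uB. gsp_algebra n m SA SB uA uB \<and> G = (n, m, schur_prod n m SA SB) \<and>
    length X = d \<and> (\<forall>i<d. X ! i \<in> carrier_mat n m)"
proof -
  obtain n m mul where G: "G = (n, m, mul)" by (cases G) auto
  then obtain SA SB where S: "unital_assoc_alg n SA" "unital_assoc_alg m SB" "mul = schur_prod n m SA SB"
    and X: "length X = d" "\<And>i. i < d \<Longrightarrow> X ! i \<in> carrier_mat n m"
    using assms unfolding Sd_def is_gsp_def by auto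
  then obtain uA uB where "sc_algebra {..<n} SA uA" "sc_algebra {..<m} SB uB"
    unfolding unital_assoc_alg_iff by auto
  then have "gsp_algebra n m SA SB uA uB" by (simp add: gsp_algebra_def)
  then show ?thesis using G S X by blast
qed

text \<open>If all polynomial relations of \<open>X\<close> hold at \<open>Y\<close>, evaluation at
  \<open>Y\<close> factors through the algebra generated by \<open>X\<close>. This is a homomorphism
  matching the generators, so one polynomial represents \<open>f\<close> at both points.\<close>

lemma nc_function_transfer:
  assumes f: "nc_function d U f" and P: "(G, X) \<in> U" and Q: "(H, Y) \<in> U"
    and rel: "\<And>W c. finite W \<Longrightarrow> W \<subseteq> all_words d \<Longrightarrow>
        lin_comb G X W c = 0\<^sub>m (fst G) (fst (snd G)) \<Longrightarrow> lin_comb H Y W c = 0\<^sub>m (fst H) (fst (snd H))"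
    and W: "finite W" "W \<subseteq> all_words d" and fP: "f (G, X) = lin_comb G X W c"
  shows "f (H, Y) = lin_comb H Y W c"
proof -
  have Sd: "(G, X) \<in> Sd d" "(H, Y) \<in> Sd d" using f P Q by (auto simp: nc_function_def)
  obtain n m SA SB uA uB where 1: "gsp_algebra n m SA SB uA uB" and G: "G = (n, m, schur_prod n m SA SB)"
    and X: "\<forall>i<d. X ! i \<in> carrier_mat n m"
    using Sd_gsp_algebra[OF Sd(1)] by blast
  obtain n' m' SA' SB' uA' uB' where 2: "gsp_algebra n' m' SA' SB' uA' uB'" and H: "H = (n', m', schur_prod n' m' SA' SB')"
    and Y: "\<forall>i<d. Y ! i \<in> carrier_mat n' m'"
    using Sd_gsp_algebra[OF Sd(2)] by blast
  interpret P: gsp_algebra n m SA SB uA uB by (rule 1)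
  interpret Q: gsp_algebra n' m' SA' SB' uA' uB' by (rule 2)
  have wd: "lin_comb H Y W c = lin_comb H Y W' c'"
    if "finite W" "W \<subseteq> all_words d" "finite W'" "W' \<subseteq> all_words d" "lin_comb G X W c = lin_comb G X W' c'" for W W' c c'
  proof -
    \<comment> \<open>The hypothesis speaks of polynomials that vanish at \<open>X\<close>; it is
      applied to the difference of the two.\<close>
    let ?V = "W \<union> W'" and ?c = "add_coeff W c W' (\<lambda>\<alpha>. - 1 * c' \<alpha>)"
    have eq: "lin_comb G' X' ?V ?c = lin_comb G' X' W c + - 1 \<cdot>\<^sub>m lin_comb G' X' W' c'" for G' X'
      using that by (simp add: lin_comb_add lin_comb_smult)
    have "lin_comb G X ?V ?c = 0\<^sub>m (fst G) (fst (snd G))"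
      unfolding eq that(5) by (rule eq_matI) (auto simp: lin_comb_def)
    then have "lin_comb H Y W c + - 1 \<cdot>\<^sub>m lin_comb H Y W' c' = 0\<^sub>m (fst H) (fst (snd H))"
      using rel[of ?V ?c] that unfolding eq by auto
    then have z: "(lin_comb H Y W c + - 1 \<cdot>\<^sub>m lin_comb H Y W' c') $$ (i,j) = 0" if "i < fst H" "j < fst (snd H)" for i j
      using that by simp
    show ?thesis
    proof (rule eq_matI)
      fix i j assume "i < dim_row (lin_comb H Y W' c')" "j < dim_col (lin_comb H Y W' c')"
      then have ij: "i < fst H" "j < fst (snd H)" by (auto simp: lin_comb_def)
      then show "lin_comb H Y W c $$ (i,j) = lin_comb H Y W' c' $$ (i,j)"
        using z[OF ij] carrier_matD[OF lin_comb_carrier[of H Y W' c']] by simp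
    qed (auto simp: lin_comb_def)
  qed
  \<comment> \<open>\<open>SOME\<close> chooses a polynomial for each element of the generated
    algebra; by \<open>wd\<close> the value does not depend on the choice.\<close>
  define \<phi> where "\<phi> Z = (let (W, c) = SOME (W, c). finite W \<and> W \<subseteq> all_words d \<and> Z = lin_comb G X W c
      in lin_comb H Y W c)" for Z
  have \<phi>: "\<phi> (lin_comb G X W c) = lin_comb H Y W c" if "finite W" "W \<subseteq> all_words d" for W c
  proof -
    let ?P = "\<lambda>(W', c'). finite W' \<and> W' \<subseteq> all_words d \<and> lin_comb G X W c = lin_comb G X W' c'"
    obtain W' c' where s: "(SOME z. ?P z) = (W', c')" by (cases "SOME z. ?P z")
    have "?P (SOME z. ?P z)" by (rule someI[of ?P "(W, c)"]) (use that in simp)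
    then have "lin_comb H Y W c = lin_comb H Y W' c'" using s that by (intro wd) auto
    then show ?thesis using s by (simp add: \<phi>_def)
  qed
  have aw: "{[]} \<subseteq> all_words d" "i < d \<Longrightarrow> {[i]} \<subseteq> all_words d" for i by (auto simp: all_words_def)
  have conv: "finite (conv_words W W')" "conv_words W W' \<subseteq> all_words d"
    if "finite W" "W \<subseteq> all_words d" "finite W'" "W' \<subseteq> all_words d" for W W'
    using that by (simp add: conv_words_def, fastforce simp: conv_words_def all_words_def)
  have "alg_hom d (G, X) (H, Y) \<phi>"
    unfolding alg_hom_def prod.case
  proof (intro conjI ballI allI)
    fix Z assume "Z \<in> alg_gen d (G, X)"
    then obtain W c where Z: "finite W" "W \<subseteq> all_words d" "Z = lin_comb G X W c" by (auto simp: alg_gen_def)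
    then show "\<phi> Z \<in> alg_gen d (H, Y)" using \<phi>[OF Z(1,2)] by (auto simp: alg_gen_def)
    show "\<phi> (a \<cdot>\<^sub>m Z) = a \<cdot>\<^sub>m \<phi> Z" for a
      unfolding Z(3) lin_comb_smult \<phi>[OF Z(1,2)] ..
    fix Z' assume "Z' \<in> alg_gen d (G, X)"
    then obtain W' c' where Z': "finite W'" "W' \<subseteq> all_words d" "Z' = lin_comb G X W' c'" by (auto simp: alg_gen_def)
    show "\<phi> (Z + Z') = \<phi> Z + \<phi> Z'"
      using Z Z' by (simp add: lin_comb_add \<phi>)
    have "\<phi> (schur_prod n m SA SB Z Z') = lin_comb H Y (conv_words W W') (conv_coeff W c W' c')"
      unfolding Z Z' using P.lin_comb_mult[OF Z(1) Z'(1)] \<phi>[OF conv] Z(1,2) Z'(1,2) by (simp add: G)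
    also have "\<dots> = schur_prod n' m' SA' SB' (\<phi> Z) (\<phi> Z')"
      unfolding Z Z' using Q.lin_comb_mult[OF Z(1) Z'(1)] \<phi> Z(1,2) Z'(1,2) by (simp add: H)
    finally show "\<phi> (snd (snd G) Z Z') = snd (snd H) (\<phi> Z) (\<phi> Z')" by (simp add: G H)
  next
    have "gsp_unit G = lin_comb G X {[]} (\<lambda>_. 1)" "gsp_unit H = lin_comb H Y {[]} (\<lambda>_. 1)"
      unfolding G H P.lin_comb_singleton Q.lin_comb_singleton by (simp_all add: monomial_def)
    then show "\<phi> (gsp_unit G) = gsp_unit H" using \<phi>[OF _ aw(1)] by simp
  qed
  moreover have "\<phi> (X ! i) = Y ! i" if "i < d" for i
  proof -
    have "X ! i = lin_comb G X {[i]} (\<lambda>_. 1)" "Y ! i = lin_comb H Y {[i]} (\<lambda>_. 1)"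
      unfolding G H P.lin_comb_singleton Q.lin_comb_singleton
      using P.monomial_single[of X i] Q.monomial_single[of Y i] X Y that by simp_all
    then show ?thesis using \<phi>[OF _ aw(2)[OF that]] by simp
  qed
  ultimately have "f (H, Y) = \<phi> (f (G, X))" using f P Q unfolding nc_function_def by auto
  then show ?thesis using \<phi>[OF W] fP by simp
qed

section \<open>Positive semidefinite kernels\<close>

lemma sum_mult_sum:
  "(\<Sum>i\<in>A. f i) * y * (\<Sum>j\<in>B. g j) = (\<Sum>i\<in>A. \<Sum>j\<in>B. f i * y * g j :: complex)"
  unfolding sum_distrib_right[of f A y] sum_product ..

text \<open>In this order on the complex numbers \<open>0 \<le> z\<close> says that \<open>z\<close>
  is real and nonnegative, so hermitian symmetry is a consequence. Arbitrary index sets fit the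
  tensor products.\<close>

definition psd_kernel :: "'a set \<Rightarrow> ('a \<times> 'a \<Rightarrow> complex) \<Rightarrow> bool" where
  "psd_kernel A x \<longleftrightarrow> (\<forall>\<xi>. 0 \<le> (\<Sum>i\<in>A. \<Sum>j\<in>A. cnj (\<xi> i) * x (i,j) * \<xi> j))"

lemma psd_kernelD: "psd_kernel A x \<Longrightarrow> 0 \<le> (\<Sum>i\<in>A. \<Sum>j\<in>A. cnj (\<xi> i) * x (i,j) * \<xi> j)"
  by (simp add: psd_kernel_def)

lemma psd_kernel_cong:
  assumes "\<And>i j. i \<in> A \<Longrightarrow> j \<in> A \<Longrightarrow> x (i,j) = y (i,j)"
  shows "psd_kernel A x \<longleftrightarrow> psd_kernel A y"
  unfolding psd_kernel_def using assms by (simp cong: sum.cong)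

lemma psd_kernel_subset:
  assumes "psd_kernel A x" "B \<subseteq> A" "finite A"
  shows "psd_kernel B x"
  unfolding psd_kernel_def
proof
  fix \<xi> :: "'a \<Rightarrow> complex"
  let ?\<xi> = "\<lambda>i. if i \<in> B then \<xi> i else 0"
  have "(\<Sum>i\<in>A. \<Sum>j\<in>A. cnj (?\<xi> i) * x (i,j) * ?\<xi> j) = (\<Sum>i\<in>B. \<Sum>j\<in>A. cnj (?\<xi> i) * x (i,j) * ?\<xi> j)"
    using assms by (intro sum.mono_neutral_right) auto
  also have "\<dots> = (\<Sum>i\<in>B. \<Sum>j\<in>B. cnj (\<xi> i) * x (i,j) * \<xi> j)"
    using assms by (intro sum.cong refl sum.mono_neutral_cong_right) auto
  finally show "0 \<le> (\<Sum>i\<in>B. \<Sum>j\<in>B. cnj (\<xi> i) * x (i,j) * \<xi> j)"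
    using psd_kernelD[OF assms(1), of ?\<xi>] by simp
qed

lemma psd_kernel_diag:
  assumes "psd_kernel A x" "finite A" "i \<in> A" shows "0 \<le> x (i,i)"
  using psd_kernelD[OF psd_kernel_subset[OF assms(1), of "{i}"], of "\<lambda>_. 1"] assms by simp

lemma psd_kernel_two:
  assumes "psd_kernel A x" "finite A" "i \<in> A" "j \<in> A" "i \<noteq> j"
  shows "0 \<le> cnj a * x (i,i) * a + cnj a * x (i,j) * b + (cnj b * x (j,i) * a + cnj b * x (j,j) * b)"
  using psd_kernelD[OF psd_kernel_subset[OF assms(1), of "{i,j}"], of "\<lambda>k. if k = i then a else b"] assms
  by simp

text \<open>Reality of the form at the vectors \<open>(1,1)\<close> and \<open>(1,\<i>)\<close> ties
  the imaginary and the real parts of the two entries.\<close>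

lemma psd_kernel_hermitian:
  assumes "psd_kernel A x" "finite A" "i \<in> A" "j \<in> A"
  shows "x (j,i) = cnj (x (i,j))"
proof (cases "i = j")
  case True
  then show ?thesis using psd_kernel_diag[OF assms(1-3)] by (simp add: complex_eq_iff less_eq_complex_def)
next
  case False
  have d: "Im (x (i,i)) = 0" "Im (x (j,j)) = 0"
    using psd_kernel_diag[OF assms(1,2)] assms by (auto simp: less_eq_complex_def)
  show ?thesis
    using psd_kernel_two[OF assms False, of 1 1] psd_kernel_two[OF assms False, of 1 \<i>] d
    by (auto simp: complex_eq_iff less_eq_complex_def)
qed

text \<open>Diagonal entries control all others; this turns estimates between kernels into entrywise
  convergence.\<close>

lemma psd_kernel_norm_le:
  assumes "psd_kernel A x" "finite A" "i \<in> A" "j \<in> A"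
  shows "cmod (x (i,j)) \<le> Re (x (i,i)) + Re (x (j,j))"
proof (cases "i = j \<or> x (i,j) = 0")
  case True
  have "0 \<le> x (i,i)" "0 \<le> x (j,j)" using psd_kernel_diag[OF assms(1,2)] assms by auto
  then show ?thesis using True by (auto simp: less_eq_complex_def cmod_def)
next
  case False
  \<comment> \<open>A phase that turns both cross terms into
    \<open>- cmod (x (i,j))\<close>.\<close>
  define a where "a = - (x (i,j) / of_real (cmod (x (i,j))))"
  have sq: "cnj (x (i,j)) * x (i,j) = of_real (cmod (x (i,j))) * of_real (cmod (x (i,j)))"
    by (metis complex_norm_square mult.commute of_real_mult power2_eq_square)
  have a: "cnj a * a = 1" "cnj a * x (i,j) = - of_real (cmod (x (i,j)))"
    using False sq by (simp_all add: a_def)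
  have a': "cnj (x (i,j)) * a = - of_real (cmod (x (i,j)))"
    using arg_cong[OF a(2), of cnj] by (simp add: mult.commute)
  have "0 \<le> cnj a * x (i,i) * a + cnj a * x (i,j) + (cnj (x (i,j)) * a + x (j,j))"
    using psd_kernel_two[OF assms(1-4), of a 1] False psd_kernel_hermitian[OF assms] by simp
  also have "cnj a * x (i,i) * a = x (i,i)" using a by (simp add: mult.commute mult.left_commute)
  finally have "0 \<le> Re (x (i,i)) - 2 * cmod (x (i,j)) + Re (x (j,j))"
    using a a' by (simp add: less_eq_complex_def)
  moreover have "0 \<le> Re (x (i,i))" "0 \<le> Re (x (j,j))"
    using psd_kernel_diag[OF assms(1,2)] assms by (auto simp: less_eq_complex_def)
  ultimately show ?thesis by linarith
qed

lemma psd_kernel_zero_row: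
  assumes "psd_kernel A x" "finite A" "i \<in> A" "j \<in> A" "x (i,i) = 0"
  shows "x (i,j) = 0"
proof (rule ccontr)
  assume nz: "x (i,j) \<noteq> 0"
  then have ij: "i \<noteq> j" using assms by auto
  \<comment> \<open>Chosen so that the form would have real part -1 at the test vector with entries
    \<open>- s * x (i,j)\<close> and 1.\<close>
  define s where "s = (Re (x (j,j)) + 1) / (2 * (cmod (x (i,j)))\<^sup>2)"
  have "0 \<le> Re (cnj (- of_real s * x (i,j)) * x (i,j) + cnj (x (i,j)) * (- of_real s * x (i,j)) + x (j,j))"
    using psd_kernel_two[OF assms(1-4) ij, of "- of_real s * x (i,j)" 1] assms(5)
      psd_kernel_hermitian[OF assms(1-4)]
    by (simp add: less_eq_complex_def)
  also have "\<dots> = - 2 * s * (cmod (x (i,j)))\<^sup>2 + Re (x (j,j))"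
    unfolding cmod_power2 by (simp add: algebra_simps power2_eq_square)
  also have "\<dots> = - 1" using nz by (simp add: s_def field_simps)
  finally show False by simp
qed

lemma psd_kernel_sum:
  "(\<And>r. r \<in> R \<Longrightarrow> psd_kernel A (x r)) \<Longrightarrow> psd_kernel A (\<lambda>z. \<Sum>r\<in>R. x r z)"
proof -
  assume psd: "\<And>r. r \<in> R \<Longrightarrow> psd_kernel A (x r)"
  have "(\<Sum>i\<in>A. \<Sum>j\<in>A. cnj (\<xi> i) * (\<Sum>r\<in>R. x r (i,j)) * \<xi> j)
      = (\<Sum>r\<in>R. \<Sum>i\<in>A. \<Sum>j\<in>A. cnj (\<xi> i) * x r (i,j) * \<xi> j)" for \<xi>
    unfolding sum_distrib_left sum_distrib_right by (rule sum_rotate3[symmetric])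
  then show "psd_kernel A (\<lambda>z. \<Sum>r\<in>R. x r z)"
    unfolding psd_kernel_def by (simp add: sum_nonneg psd_kernelD[OF psd])
qed

lemma psd_kernel_add: "psd_kernel A x \<Longrightarrow> psd_kernel A y \<Longrightarrow> psd_kernel A (\<lambda>z. x z + y z)"
  unfolding psd_kernel_def by (simp add: distrib_left distrib_right sum.distrib add_nonneg_nonneg)

lemma psd_kernel_scale:
  assumes "psd_kernel A x" "0 \<le> c" shows "psd_kernel A (\<lambda>z. c * x z)"
proof -
  have "(\<Sum>i\<in>A. \<Sum>j\<in>A. cnj (\<xi> i) * (c * x (i,j)) * \<xi> j) = c * (\<Sum>i\<in>A. \<Sum>j\<in>A. cnj (\<xi> i) * x (i,j) * \<xi> j)" for \<xi>
    by (simp add: sum_distrib_left mult_ac)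
  then show ?thesis using assms unfolding psd_kernel_def by simp
qed

lemma psd_kernel_congruence:
  assumes "psd_kernel A y"
  shows "psd_kernel P (\<lambda>(p,q). \<Sum>k\<in>A. \<Sum>l\<in>A. L p k * y (k,l) * cnj (L q l))"
  unfolding psd_kernel_def
proof
  fix \<xi> :: "'b \<Rightarrow> complex"
  define \<zeta> where "\<zeta> = (\<lambda>l. \<Sum>q\<in>P. cnj (L q l) * \<xi> q)"
  have "(\<Sum>i\<in>P. \<Sum>j\<in>P. cnj (\<xi> i) * (\<Sum>k\<in>A. \<Sum>l\<in>A. L i k * y (k,l) * cnj (L j l)) * \<xi> j)
      = (\<Sum>i\<in>P. \<Sum>j\<in>P. \<Sum>k\<in>A. \<Sum>l\<in>A. (L i k * cnj (\<xi> i)) * y (k,l) * (cnj (L j l) * \<xi> j))"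
    by (simp add: sum_distrib_left sum_distrib_right mult_ac)
  also have "\<dots> = (\<Sum>i\<in>P. \<Sum>k\<in>A. \<Sum>l\<in>A. \<Sum>j\<in>P. (L i k * cnj (\<xi> i)) * y (k,l) * (cnj (L j l) * \<xi> j))"
    by (rule sum.cong[OF refl]) (rule sum_rotate3)
  also have "\<dots> = (\<Sum>k\<in>A. \<Sum>l\<in>A. \<Sum>i\<in>P. \<Sum>j\<in>P. (L i k * cnj (\<xi> i)) * y (k,l) * (cnj (L j l) * \<xi> j))"
    by (rule sum_rotate3)
  also have "\<dots> = (\<Sum>k\<in>A. \<Sum>l\<in>A. cnj (\<zeta> k) * y (k,l) * \<zeta> l)"
    unfolding \<zeta>_def cnj_sum sum_mult_sum by simp
  finally show "0 \<le> (\<Sum>i\<in>P. \<Sum>j\<in>P. cnj (\<xi> i) * (case (i, j) of (p, q) \<Rightarrow> \<Sum>k\<in>A. \<Sum>l\<in>A. L p k * y (k,l) * cnj (L q l)) * \<xi> j)"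
    using psd_kernelD[OF assms, of \<zeta>] by simp
qed

lemma psd_kernel_pullback:
  assumes "psd_kernel A y" "finite A" "\<And>p. p \<in> P \<Longrightarrow> g p \<in> A"
  shows "psd_kernel P (\<lambda>(p,q). y (g p, g q))"
proof -
  let ?L = "\<lambda>p k. if g p = k then 1 else 0 :: complex"
  have "(\<Sum>k\<in>A. \<Sum>l\<in>A. ?L p k * y (k,l) * cnj (?L q l)) = y (g p, g q)" if "p \<in> P" "q \<in> P" for p q
  proof -
    have "(\<Sum>k\<in>A. \<Sum>l\<in>A. ?L p k * y (k,l) * cnj (?L q l)) = (\<Sum>k\<in>A. if g p = k then (\<Sum>l\<in>A. if g q = l then y (k,l) else 0) else 0)"
      by (intro sum.cong refl) (auto intro!: sum.cong)
    then show ?thesis using assms that by simp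
  qed
  then show ?thesis
    using psd_kernel_congruence[OF assms(1), of P ?L] by (subst psd_kernel_cong) auto
qed

lemma psd_kernel_schur_complement:
  fixes x :: "'a \<times> 'a \<Rightarrow> complex"
  assumes "psd_kernel (insert a A) x" "finite A" "a \<notin> A"
  shows "psd_kernel A (\<lambda>(i,j). x (i,j) - x (i,a) * x (a,j) / x (a,a))"
  unfolding psd_kernel_def
proof
  fix \<xi> :: "'a \<Rightarrow> complex"
  define b where "b = (\<Sum>j\<in>A. x (a,j) * \<xi> j)"
  define Q where "Q = (\<Sum>i\<in>A. \<Sum>j\<in>A. cnj (\<xi> i) * x (i,j) * \<xi> j)"
  define r where "r = x (a,a)"
  have r: "cnj r = r" using psd_kernel_diag[OF assms(1)] assms
    by (auto simp: r_def complex_eq_iff less_eq_complex_def)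
  have b': "cnj b = (\<Sum>i\<in>A. cnj (\<xi> i) * x (i,a))"
    unfolding b_def cnj_sum using psd_kernel_hermitian[OF assms(1), of a] assms
    by (intro sum.cong refl) auto
  \<comment> \<open>The minimiser of the form in the coordinate \<open>a\<close>. For
    \<open>r = 0\<close> division by zero makes it 0, and the complement is just the restriction of
    \<open>x\<close>.\<close>
  let ?\<xi> = "\<lambda>i. if i = a then - b / r else \<xi> i"
  have A: "?\<xi> i = \<xi> i" if "i \<in> A" for i using that assms by auto
  have "0 \<le> (\<Sum>i\<in>insert a A. \<Sum>j\<in>insert a A. cnj (?\<xi> i) * x (i,j) * ?\<xi> j)"
    by (rule psd_kernelD[OF assms(1)])
  also have "\<dots> = cnj (- b / r) * r * (- b / r) + (\<Sum>j\<in>A. cnj (- b / r) * x (a,j) * \<xi> j)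
      + (\<Sum>i\<in>A. cnj (\<xi> i) * x (i,a) * (- b / r) + (\<Sum>j\<in>A. cnj (\<xi> i) * x (i,j) * \<xi> j))"
    using assms A by (simp add: r_def cong: sum.cong)
  also have "\<dots> = cnj (- b / r) * r * (- b / r) + cnj (- b / r) * b + (cnj b * (- b / r) + Q)"
    unfolding b' Q_def sum.distrib sum_distrib_right unfolding b_def sum_distrib_left by (simp add: mult.assoc)
  also have "\<dots> = Q - cnj b * b / r" by (cases "r = 0") (simp_all add: r)
  also have "cnj b * b / r = (\<Sum>i\<in>A. \<Sum>j\<in>A. cnj (\<xi> i) * (x (i,a) * x (a,j) / r) * \<xi> j)"
    unfolding b' unfolding b_def sum_product sum_divide_distrib by (simp add: mult_ac)
  also have "Q - \<dots> = (\<Sum>i\<in>A. \<Sum>j\<in>A. cnj (\<xi> i) * (x (i,j) - x (i,a) * x (a,j) / r) * \<xi> j)"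
    unfolding Q_def by (simp add: sum_subtractf[symmetric] left_diff_distrib right_diff_distrib)
  finally show "0 \<le> (\<Sum>i\<in>A. \<Sum>j\<in>A. cnj (\<xi> i) * (case (i, j) of (i, j) \<Rightarrow> x (i,j) - x (i,a) * x (a,j) / x (a,a)) * \<xi> j)"
    by (simp add: r_def)
qed

text \<open>Cholesky factorisation: the Schur complement removes a rank-one kernel and leaves a
  kernel on a smaller set.\<close>

lemma psd_kernel_decomposition:
  assumes "finite A" "psd_kernel A x"
  shows "\<exists>v :: 'a \<Rightarrow> 'a \<Rightarrow> complex. \<forall>i\<in>A. \<forall>j\<in>A. x (i,j) = (\<Sum>r\<in>A. v r i * cnj (v r j))"
  using assms
proof (induction A arbitrary: x rule: finite_induct)
  case (insert a A)
  note psd = insert.prems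
  obtain v where v: "\<forall>i\<in>A. \<forall>j\<in>A. x (i,j) - x (i,a) * x (a,j) / x (a,a) = (\<Sum>r\<in>A. v r i * cnj (v r j))"
    using insert.IH[OF psd_kernel_schur_complement[OF psd]] insert.hyps by auto
  define s where "s = complex_of_real (sqrt (Re (x (a,a))))"
  have "0 \<le> x (a,a)" using psd_kernel_diag[OF psd] insert.hyps by auto
  then have s: "s * cnj s = x (a,a)"
    by (simp add: s_def complex_eq_iff less_eq_complex_def)
  have herm: "x (j,i) = cnj (x (i,j))" if "i \<in> insert a A" "j \<in> insert a A" for i j
    by (rule psd_kernel_hermitian[OF psd]) (use that insert.hyps in simp_all)
  have zero: "x (i,a) = 0" if "i \<in> insert a A" "s = 0" for i
  proof -
    have "x (a,i) = 0" using psd_kernel_zero_row[OF psd, of a i] that insert.hyps s by simp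
    then show ?thesis using herm[of a i] that by simp
  qed
  \<comment> \<open>The new vector is column \<open>a\<close> divided by the square root of the
    pivot; the older vectors are extended by 0 at \<open>a\<close>. If the pivot is 0, the whole
    column is 0.\<close>
  define v' where "v' = (\<lambda>r i. if r = a then x (i,a) / cnj s else if i = a then 0 else v r i)"
  have "x (i,j) = (\<Sum>r\<in>insert a A. v' r i * cnj (v' r j))" if ij: "i \<in> insert a A" "j \<in> insert a A" for i j
  proof -
    have ne: "r \<noteq> a" if "r \<in> A" for r using that insert.hyps by auto
    have "(\<Sum>r\<in>A. v' r i * cnj (v' r j)) = (\<Sum>r\<in>A. if i = a \<or> j = a then 0 else v r i * cnj (v r j))"
      by (intro sum.cong refl) (auto simp: v'_def dest: ne)
    then have "(\<Sum>r\<in>insert a A. v' r i * cnj (v' r j))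
        = x (i,a) * cnj (x (j,a)) / (cnj s * s) + (\<Sum>r\<in>A. if i = a \<or> j = a then 0 else v r i * cnj (v r j))"
      using insert.hyps by (simp add: v'_def)
    also have "\<dots> = x (i,a) * x (a,j) / x (a,a) + (if i = a \<or> j = a then 0 else x (i,j) - x (i,a) * x (a,j) / x (a,a))"
    proof -
      have h: "cnj (x (j,a)) = x (a,j)" using herm[of j a] ij by simp
      have cs: "cnj s * s = x (a,a)" using s by (simp add: mult.commute)
      show ?thesis using v ij by (auto simp: h cs)
    qed
    also have "\<dots> = x (i,j)"
    proof (cases "s = 0")
      case True
      then show ?thesis
        using zero[OF ij(1)] zero[OF ij(2)] herm[of j a] ij by auto
    next
      case False
      then show ?thesis using s by auto
    qed
    finally show ?thesis ..
  qed
  then show ?case by blast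
qed auto

text \<open>With the same algebra on both sides, multiplying by a rank-one kernel on the left is a
  congruence by the left multiplication \<open>L_v\<close> with its vector: \<open>v v^*\<close>
  times \<open>y\<close> is \<open>L_v y L_v^*\<close>. Summing over a Cholesky factorisation gives
  the Schur product theorem for \<open>gsc S S\<close>.\<close>

lemma psd_kernel_smul:
  assumes "finite A" "psd_kernel A x" "psd_kernel A y"
  shows "psd_kernel P (smul (A \<times> A) (gsc S S) x y)"
proof -
  obtain v where v: "\<forall>i\<in>A. \<forall>j\<in>A. x (i,j) = (\<Sum>r\<in>A. v r i * cnj (v r j))"
    using psd_kernel_decomposition[OF assms(1,2)] by blast
  let ?L = "\<lambda>r p k. \<Sum>i\<in>A. v r i * S i k p"
  have eq: "smul (A \<times> A) (gsc S S) x y (p,q) = (\<Sum>r\<in>A. \<Sum>k\<in>A. \<Sum>l\<in>A. ?L r p k * y (k,l) * cnj (?L r q l))" for p q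
  proof -
    have "smul (A \<times> A) (gsc S S) x y (p,q)
        = (\<Sum>i\<in>A. \<Sum>j\<in>A. \<Sum>k\<in>A. \<Sum>l\<in>A. \<Sum>r\<in>A. (v r i * S i k p) * y (k,l) * (cnj (v r j) * cnj (S j l q)))"
      unfolding smul_def sum.cartesian_product'
      by (intro sum.cong refl) (simp add: v sum_distrib_right sum_distrib_left mult_ac)
    also have "\<dots> = (\<Sum>i\<in>A. \<Sum>j\<in>A. \<Sum>r\<in>A. \<Sum>k\<in>A. \<Sum>l\<in>A. (v r i * S i k p) * y (k,l) * (cnj (v r j) * cnj (S j l q)))"
      by (rule sum.cong[OF refl], rule sum.cong[OF refl], rule sum_rotate3[symmetric])
    also have "\<dots> = (\<Sum>r\<in>A. \<Sum>i\<in>A. \<Sum>j\<in>A. \<Sum>k\<in>A. \<Sum>l\<in>A. (v r i * S i k p) * y (k,l) * (cnj (v r j) * cnj (S j l q)))"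
      by (rule sum_rotate3[symmetric])
    also have "\<dots> = (\<Sum>r\<in>A. \<Sum>i\<in>A. \<Sum>k\<in>A. \<Sum>l\<in>A. \<Sum>j\<in>A. (v r i * S i k p) * y (k,l) * (cnj (v r j) * cnj (S j l q)))"
      by (rule sum.cong[OF refl], rule sum.cong[OF refl], rule sum_rotate3)
    also have "\<dots> = (\<Sum>r\<in>A. \<Sum>k\<in>A. \<Sum>l\<in>A. \<Sum>i\<in>A. \<Sum>j\<in>A. (v r i * S i k p) * y (k,l) * (cnj (v r j) * cnj (S j l q)))"
      by (rule sum.cong[OF refl], rule sum_rotate3)
    finally show ?thesis unfolding cnj_sum sum_mult_sum by simp
  qed
  have "psd_kernel P (\<lambda>z. \<Sum>r\<in>A. (\<lambda>(p,q). \<Sum>k\<in>A. \<Sum>l\<in>A. ?L r p k * y (k,l) * cnj (?L r q l)) z)"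
    by (intro psd_kernel_sum psd_kernel_congruence assms)
  then show ?thesis by (rule psd_kernel_cong[THEN iffD2, rotated]) (simp add: eq)
qed

lemma qform_eq:
  "M \<in> carrier_mat n n \<Longrightarrow> qform M x = (\<Sum>i<n. \<Sum>j<n. cnj (x $ i) * M $$ (i,j) * x $ j)"
  by (auto simp: qform_def)

lemma psd_iff_kernel:
  assumes "M \<in> carrier_mat n n"
  shows "psd M \<longleftrightarrow> psd_kernel {..<n} (($$) M)"
proof
  assume psd: "psd M"
  show "psd_kernel {..<n} (($$) M)"
    unfolding psd_kernel_def
  proof
    fix \<xi> :: "nat \<Rightarrow> complex"
    have "qform M (vec n \<xi>) = (\<Sum>i<n. \<Sum>j<n. cnj (\<xi> i) * M $$ (i,j) * \<xi> j)"
      by (simp add: qform_eq[OF assms])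
    then show "0 \<le> (\<Sum>i<n. \<Sum>j<n. cnj (\<xi> i) * M $$ (i,j) * \<xi> j)"
      using psd assms by (auto simp: psd_def less_eq_complex_def dest!: bspec[of _ _ "vec n \<xi>"])
  qed
next
  assume "psd_kernel {..<n} (($$) M)"
  then show "psd M" using assms
    by (auto simp: psd_def psd_kernel_def qform_eq[OF assms] less_eq_complex_def)
qed

lemma pd_imp_psd: assumes "pd M" shows "psd M"
  unfolding psd_def
proof (intro conjI ballI)
  fix x :: "complex vec" assume x: "x \<in> carrier_vec (dim_row M)"
  have sq: "dim_col M = dim_row M" using assms by (simp add: pd_def)
  have "Im (qform M x) = 0 \<and> 0 \<le> Re (qform M x)"
  proof (cases "x = 0\<^sub>v (dim_row M)")
    case True
    then show ?thesis using sq by (simp add: qform_def)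
  next
    case False
    then show ?thesis using assms x by (auto simp: pd_def intro: less_imp_le)
  qed
  then show "Im (qform M x) = 0" "0 \<le> Re (qform M x)" by auto
qed (use assms in \<open>simp add: pd_def\<close>)

lemma pd_add_multiple_of_identity:
  assumes M: "M \<in> carrier_mat n n" and e: "e > 0" and K: "psd_kernel {..<n} K"
    and eq: "\<And>i j. i < n \<Longrightarrow> j < n \<Longrightarrow> M $$ (i,j) = K (i,j) + (if i = j then of_real e else 0)"
  shows "pd M"
  unfolding pd_def
proof (intro conjI ballI impI)
  fix x :: "complex vec" assume "x \<in> carrier_vec (dim_row M)" "x \<noteq> 0\<^sub>v (dim_row M)"
  then have x: "dim_vec x = n" "x \<noteq> 0\<^sub>v n" using M by auto
  then obtain k where k: "k < n" "x $ k \<noteq> 0"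
    by (metis eq_vecI index_zero_vec(1) index_zero_vec(2))
  have "qform M x = (\<Sum>i<n. \<Sum>j<n. cnj (x $ i) * K (i,j) * x $ j + (if i = j then of_real e * (cnj (x $ i) * x $ j) else 0))"
    unfolding qform_eq[OF M] by (intro sum.cong refl) (auto simp: eq algebra_simps)
  also have "\<dots> = (\<Sum>i<n. \<Sum>j<n. cnj (x $ i) * K (i,j) * x $ j) + (\<Sum>i<n. of_real (e * (cmod (x $ i))\<^sup>2))"
    by (simp add: sum.distrib complex_norm_square mult.commute del: of_real_power)
  finally have q: "qform M x = (\<Sum>i<n. \<Sum>j<n. cnj (x $ i) * K (i,j) * x $ j) + of_real (\<Sum>i<n. e * (cmod (x $ i))\<^sup>2)"
    by simp
  have "0 < (\<Sum>i<n. e * (cmod (x $ i))\<^sup>2)"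
    using e k by (intro sum_pos2[of _ k]) auto
  then show "Im (qform M x) = 0" "0 < Re (qform M x)"
    using psd_kernelD[OF K, of "($) x"] unfolding q by (auto simp: less_eq_complex_def)
qed (use M in auto)

section \<open>Points of the domain\<close>

lemma sc_restrict_gsc:
  assumes "sc_restrict \<iota> I S J T" "sc_restrict \<kappa> I' S' J' T'"
  shows "sc_restrict (map_prod \<iota> \<kappa>) (I \<times> I') (gsc S S') (J \<times> J') (gsc T T')"
proof -
  have "gsc T T' i k (map_prod \<iota> \<kappa> p) = 0"
    if "p \<in> I \<times> I'" "i \<in> J \<times> J'" "k \<in> J \<times> J'"
      "i \<notin> map_prod \<iota> \<kappa> ` (I \<times> I') \<or> k \<notin> map_prod \<iota> \<kappa> ` (I \<times> I')" for i k p
  proof -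
    obtain p1 p2 i1 i2 k1 k2 where e: "p = (p1,p2)" "i = (i1,i2)" "k = (k1,k2)"
      by (metis prod.exhaust_sel)
    have "i1 \<notin> \<iota> ` I \<or> k1 \<notin> \<iota> ` I \<or> i2 \<notin> \<kappa> ` I' \<or> k2 \<notin> \<kappa> ` I'"
      using that(4) unfolding e by (auto simp: image_iff)
    then show ?thesis using that(1-3) assms unfolding e sc_restrict_def by auto
  qed
  moreover have "inj_on (map_prod \<iota> \<kappa>) (I \<times> I')"
    using assms by (intro map_prod_inj_on) (auto simp: sc_restrict_def)
  moreover have "map_prod \<iota> \<kappa> ` (I \<times> I') \<subseteq> J \<times> J'"
    using assms by (auto simp: sc_restrict_def)
  ultimately show ?thesis using assms unfolding sc_restrict_def by auto
qed

lemma word_val_cong: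
  assumes "\<And>i p. i \<in> set w \<Longrightarrow> p \<in> I \<Longrightarrow> Y i p = Y' i p"
  shows "word_val I S u Y w = word_val I S u Y' w"
  using assms
proof (induction w)
  case (Cons i w)
  then show ?case by (simp, intro smul_cong) auto
qed simp

lemma vanishing_cong:
  assumes "\<And>w p. w \<in> all_words d \<Longrightarrow> p \<in> I \<Longrightarrow> V w p = V' w p"
  shows "vanishing d I V \<longleftrightarrow> vanishing d I V'"
  unfolding vanishing_def using assms by (metis (no_types, lifting))

section \<open>Direct sums and Schur spectral contractions\<close>

lemma sum_lessThan_add_split:
  fixes f :: "nat \<Rightarrow> 'a :: comm_monoid_add"
  shows "(\<Sum>q<m+n. f q) = (\<Sum>q<m. f q) + (\<Sum>q<n. f (m + q))"
  by (induction n) (auto simp: add.assoc)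

lemma sc_algebra_dsum:
  assumes "sc_algebra {..<m} SB uB" "sc_algebra {..<n} SA uA"
  shows "sc_algebra {..<m+n} (dsum_sc m SB SA) (\<lambda>i. if i < m then uB i else uA (i - m))"
proof -
  interpret B: sc_algebra "{..<m}" SB uB by fact
  interpret A: sc_algebra "{..<n}" SA uA by fact
  show ?thesis
  proof
    fix i j k p assume "i \<in> {..<m+n}" "j \<in> {..<m+n}" "k \<in> {..<m+n}" "p \<in> {..<m+n}"
    then show "(\<Sum>q\<in>{..<m+n}. dsum_sc m SB SA i j q * dsum_sc m SB SA q k p)
        = (\<Sum>q\<in>{..<m+n}. dsum_sc m SB SA j k q * dsum_sc m SB SA i q p)"
      unfolding sum_lessThan_add_split
      by (cases "i < m"; cases "j < m"; cases "k < m"; cases "p < m")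
         (auto simp: dsum_sc_def B.struct_assoc A.struct_assoc)
  next
    fix i p assume "i \<in> {..<m+n}" "p \<in> {..<m+n}"
    then show "(\<Sum>k\<in>{..<m+n}. (if k < m then uB k else uA (k - m)) * dsum_sc m SB SA k i p) = (if i = p then 1 else 0)"
      "(\<Sum>k\<in>{..<m+n}. (if k < m then uB k else uA (k - m)) * dsum_sc m SB SA i k p) = (if i = p then 1 else 0)"
      unfolding sum_lessThan_add_split
      using B.unit_left[of i p] B.unit_right[of i p] A.unit_left[of "i - m" "p - m"] A.unit_right[of "i - m" "p - m"]
      by (cases "i < m"; cases "p < m"; auto simp: dsum_sc_def)+
  qed simp
qed

lemma sc_restrict_dsum_left: "sc_restrict (\<lambda>i. i) {..<m} SB {..<m+n} (dsum_sc m SB SA)"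
  by (simp add: sc_restrict_def dsum_sc_def inj_on_def)

lemma sc_restrict_dsum_right: "sc_restrict (\<lambda>i. m + i) {..<n} SA {..<m+n} (dsum_sc m SB SA)"
proof -
  have "(\<lambda>i. m + i) ` {..<n} = {m..<m+n}" by (simp add: lessThan_atLeast0 add.commute)
  then show ?thesis by (auto simp: sc_restrict_def inj_on_def dsum_sc_def)
qed

lemma Max_powr:
  fixes h :: "'a \<Rightarrow> real"
  assumes "finite W" "\<And>w. w \<in> W \<Longrightarrow> 0 \<le> h w" "e > 0"
  shows "Max (insert 0 ((\<lambda>w. h w powr e) ` W)) = Max (insert 0 (h ` W)) powr e"
proof (rule Max_eqI)
  have fin: "finite (insert 0 (h ` W))" using assms by simp
  fix y assume "y \<in> insert 0 ((\<lambda>w. h w powr e) ` W)"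
  then show "y \<le> Max (insert 0 (h ` W)) powr e"
    using assms fin by (auto intro!: powr_mono2 Max_ge)
next
  have "Max (insert 0 (h ` W)) \<in> insert 0 (h ` W)" using assms by (intro Max_in) auto
  then show "Max (insert 0 (h ` W)) powr e \<in> insert 0 ((\<lambda>w. h w powr e) ` W)"
    using assms by auto
qed (use assms in simp)

context gsp_algebra
begin

lemma frob_norm_monomial: "frob_norm (monomial G X w) = l2n idx (wvG (\<lambda>i. ($$) (X ! i)) w)"
proof -
  have "frob_norm (monomial G X w) = sqrt (\<Sum>z\<in>idx. (cmod (monomial G X w $$ z))\<^sup>2)"
    using carrier_matD[OF monomial_carrier] by (simp add: frob_norm_def sum.cartesian_product')
  also have "\<dots> = l2n idx (wvG (\<lambda>i. ($$) (X ! i)) w)"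
    unfolding l2n_def L2_set_def by (intro arg_cong[of _ _ sqrt] sum.cong refl) (simp add: monomial_index)
  finally show ?thesis .
qed

lemma jsr_lt1_iff:
  "jsr_lt1 G X \<longleftrightarrow> (\<exists>L<1. (\<lambda>k. word_max (length X) idx (wvG (\<lambda>i. ($$) (X ! i))) k powr (1 / real k)) \<longlonglongrightarrow> L)"
proof -
  have "Max (insert 0 ((\<lambda>w. frob_norm (monomial G X w) powr (1 / real k)) ` words (length X) k))
      = word_max (length X) idx (wvG (\<lambda>i. ($$) (X ! i))) k powr (1 / real k)" if "k > 0" for k
    unfolding frob_norm_monomial word_max_def using that by (intro Max_powr) auto
  \<comment> \<open>Only eventually: at \<open>k = 0\<close> the exponent \<open>1 / real k\<close>
    is 0, to which \<open>Max_powr\<close> does not apply.\<close>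
  then have "eventually (\<lambda>k. Max (insert 0 ((\<lambda>w. frob_norm (monomial G X w) powr (1 / real k)) ` words (length X) k))
      = word_max (length X) idx (wvG (\<lambda>i. ($$) (X ! i))) k powr (1 / real k)) sequentially"
    using eventually_gt_at_top[of 0] by (rule eventually_mono[rotated])
  then show ?thesis unfolding jsr_lt1_def by (simp add: tendsto_cong)
qed

lemma vanishing_monomial_iff:
  "vanishing d idx (\<lambda>w. ($$) (monomial G X w)) \<longleftrightarrow> vanishing d idx (wvG (\<lambda>i. ($$) (X ! i)))"
  by (rule vanishing_cong) (simp add: monomial_index)

end

text \<open>The blocks \<open>X + \<epsilon>, X, X, X + \<epsilon>\<close> are positive definite, and for \<open>\<epsilon> = 0\<close> every word in them
  consists of four copies of the word in \<open>X\<close>.\<close>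

lemma psd_point_in_Cd:
  assumes alg: "sc_algebra {..<n} S u" and X: "length X = d" "\<And>i. i < d \<Longrightarrow> X ! i \<in> carrier_mat n n"
    and psd: "\<And>i. i < d \<Longrightarrow> psd (X ! i)"
    and van: "vanishing d ({..<n} \<times> {..<n}) (\<lambda>w. ($$) (monomial (n, n, schur_prod n n S S) X w))"
  shows "((n, n, schur_prod n n S S), X) \<in> Cd d"
proof -
  define SD where "SD = dsum_sc n S S"
  define v where "v = (\<lambda>i. if i < n then u i else u (i - n))"
  interpret P: gsp_algebra n n S S u u using alg by (simp add: gsp_algebra_def)
  have algD: "sc_algebra {..<n+n} SD v" unfolding SD_def v_def by (rule sc_algebra_dsum[OF alg alg])
  interpret D: gsp_algebra "n+n" "n+n" SD SD v v using algD by (simp add: gsp_algebra_def)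
  \<comment> \<open>\<open>\<pi>\<close> identifies the two copies of the algebra; through every
    index \<open>p\<close> passes an embedding of one copy that \<open>\<pi>\<close>
    inverts.\<close>
  define \<pi> where "\<pi> = (\<lambda>p. if p < n then p else p - n)"
  have \<pi>: "\<pi> p < n" if "p < n + n" for p using that by (auto simp: \<pi>_def)
  have \<iota>: "\<exists>\<iota>. sc_restrict \<iota> {..<n} S {..<n+n} SD \<and> \<iota> (\<pi> p) = p \<and> (\<forall>x<n. \<pi> (\<iota> x) = x)" if "p < n + n" for p
  proof (cases "p < n")
    case True
    then show ?thesis unfolding SD_def
      by (intro exI[of _ "\<lambda>i. i"]) (auto simp: \<pi>_def sc_restrict_dsum_left)
  next
    case False
    then show ?thesis unfolding SD_def
      by (intro exI[of _ "\<lambda>i. n + i"]) (auto simp: \<pi>_def sc_restrict_dsum_right)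
  qed
  define Z where "Z = (\<lambda>i (p,q). X ! i $$ (\<pi> p, \<pi> q))"
  have words: "D.wvG Z w (p,q) = P.wvG (\<lambda>i. ($$) (X ! i)) w (\<pi> p, \<pi> q)" if pq: "p < n + n" "q < n + n" for w p q
  proof -
    obtain \<iota> \<kappa> where r: "sc_restrict \<iota> {..<n} S {..<n+n} SD" "\<iota> (\<pi> p) = p" "\<forall>x<n. \<pi> (\<iota> x) = x"
      "sc_restrict \<kappa> {..<n} S {..<n+n} SD" "\<kappa> (\<pi> q) = q" "\<forall>x<n. \<pi> (\<kappa> x) = x"
      using \<iota>[OF pq(1)] \<iota>[OF pq(2)] by blast
    have "D.wvG Z w (map_prod \<iota> \<kappa> (\<pi> p, \<pi> q)) = P.wvG (\<lambda>i. ($$) (X ! i)) w (\<pi> p, \<pi> q)"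
      by (rule word_val_restrict[OF P.T.sc_algebra_axioms D.T.sc_algebra_axioms sc_restrict_gsc[OF r(1,4)]])
         (use pq \<pi> r in \<open>auto simp: Z_def\<close>)
    then show ?thesis using r by simp
  qed
  have "vanishing d D.idx (D.wvG Z)"
    unfolding vanishing_def
  proof (intro allI impI)
    fix e :: real assume "e > 0"
    then obtain k0 where k0: "\<forall>w\<in>all_words d. k0 \<le> length w \<longrightarrow> (\<forall>p\<in>P.idx. cmod (P.wvG (\<lambda>i. ($$) (X ! i)) w p) < e)"
      using van unfolding P.vanishing_monomial_iff unfolding vanishing_def by blast
    show "\<exists>k0. \<forall>w\<in>all_words d. k0 \<le> length w \<longrightarrow> (\<forall>p\<in>D.idx. cmod (D.wvG Z w p) < e)"
      using k0 \<pi> by (intro exI[of _ k0]) (auto simp: words)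
  qed
  then obtain m where m: "m > 0" "\<forall>w\<in>words d m. D.T.mulC * l2n D.idx (D.wvG Z w) < 1"
    using D.T.contractive_if_vanishing by blast
  \<comment> \<open>The identity matrix in every letter: adding \<epsilon> times it makes the blocks
    positive definite, and for suitable \<epsilon> the words of length \<open>m\<close> stay
    contractive.\<close>
  define E :: "nat \<Rightarrow> nat \<times> nat \<Rightarrow> complex" where "E = (\<lambda>_ (p,q). if p = q then 1 else 0)"
  obtain \<epsilon> where \<epsilon>: "\<epsilon> > 0"
    "\<forall>w\<in>words d m. D.T.mulC * l2n D.idx (D.wvG (\<lambda>i p. Z i p + of_real \<epsilon> * E i p) w) < 1"
    using D.T.perturbation_contractive[OF m(2), of E] by blast
  define A where "A = map (\<lambda>M. M + of_real \<epsilon> \<cdot>\<^sub>m 1\<^sub>m n) X"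
  define Ys where "Ys = map (\<lambda>i. four_block_mat (A ! i) (adj (X ! i)) (X ! i) (A ! i)) [0..<d]"
  have Ac: "A ! i \<in> carrier_mat n n" if "i < d" for i using that X by (simp add: A_def)
  have Yc: "Ys ! i \<in> carrier_mat (n + n) (n + n)" if "i < d" for i
    using that Ac[OF that] X(2)[OF that] by (simp add: Ys_def)
  have kernel: "psd_kernel {..<n} (($$) (X ! i))" if "i < d" for i
    using psd_iff_kernel[OF X(2)] psd that by simp
  have herm: "adj (X ! i) = X ! i" if "i < d" for i
  proof (rule eq_matI)
    fix a b assume "a < dim_row (X ! i)" "b < dim_col (X ! i)"
    then have ab: "a < n" "b < n" using X(2)[OF that] by auto
    then have "X ! i $$ (a,b) = cnj (X ! i $$ (b,a))"
      by (intro psd_kernel_hermitian[OF kernel[OF that]]) auto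
    then show "adj (X ! i) $$ (a,b) = X ! i $$ (a,b)" using ab X(2)[OF that] by (simp add: adj_def)
  qed (use X(2)[OF that] in \<open>auto simp: adj_def\<close>)
  have Ye: "Ys ! i $$ (p,q) = Z i (p,q) + of_real \<epsilon> * E i (p,q)" if "i < d" "p < n + n" "q < n + n" for i p q
  proof -
    have c: "dim_row (X ! i) = n" "dim_col (X ! i) = n" "dim_row (A ! i) = n" "dim_col (A ! i) = n"
      using X(2) Ac that by (auto dest: carrier_matD)
    have "Ys ! i = four_block_mat (A ! i) (X ! i) (X ! i) (A ! i)" using that by (simp add: Ys_def herm)
    moreover have "A ! i $$ (a,b) = X ! i $$ (a,b) + of_real \<epsilon> * (if a = b then 1 else 0)" if "a < n" "b < n" for a b
      using that \<open>i < d\<close> X c by (simp add: A_def)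
    ultimately show ?thesis using that c by (auto simp: Z_def E_def \<pi>_def)
  qed
  have pd: "pd (Ys ! i)" if "i < d" for i
  proof (rule pd_add_multiple_of_identity[OF Yc[OF that] \<epsilon>(1)])
    show "psd_kernel {..<n+n} (Z i)"
      unfolding Z_def by (rule psd_kernel_pullback[OF kernel[OF that]]) (use \<pi> in auto)
  qed (use Ye that in \<open>auto simp: E_def\<close>)
  have "D.wvG (\<lambda>i. ($$) (Ys ! i)) w = D.wvG (\<lambda>i p. Z i p + of_real \<epsilon> * E i p) w" if "w \<in> words d m" for w
    using that Ye by (intro word_val_cong) (auto simp: words_def)
  then have "\<exists>L<1. (\<lambda>k. word_max d D.idx (D.wvG (\<lambda>i. ($$) (Ys ! i))) k powr (1 / real k)) \<longlonglongrightarrow> L"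
    using D.T.root_limit_if_contractive[OF m(1), of d "\<lambda>i. ($$) (Ys ! i)"] \<epsilon>(2) by simp
  moreover have "length Ys = d" by (simp add: Ys_def)
  ultimately have jsr: "jsr_lt1 D.G Ys" by (simp add: D.jsr_lt1_iff)
  have uaa: "unital_assoc_alg n S" using alg unital_assoc_alg_iff by blast
  have "((n, n, schur_prod n n S S), X) \<in> Sd d"
    using X P.is_gsp by (simp add: Sd_def)
  moreover have "length A = d" using X by (simp add: A_def)
  ultimately show ?thesis
    unfolding Cd_def schur_spectral_contraction_def mem_Collect_eq prod.case Let_def
    using uaa Ac pd jsr unfolding Ys_def SD_def by blast
qed

text \<open>\<open>X\<close> need not be square, let alone positive. A coordinate of a product in a
  direct sum depends only on coordinates in the same summand, so restricting rows to the second
  summand and columns to the first is a homomorphism onto the algebra of \<open>X\<close>. This is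
  the source of the offset \<open>m\<close> in the rows.\<close>

lemma Cd_corner:
  assumes "(G, X) \<in> Cd d"
  shows "\<exists>N S u Ys m. sc_algebra {..<N} S u \<and> length Ys = d \<and>
    (\<forall>i<d. Ys ! i \<in> carrier_mat N N \<and> psd (Ys ! i)) \<and>
    vanishing d ({..<N} \<times> {..<N}) (\<lambda>w. ($$) (monomial (N, N, schur_prod N N S S) Ys w)) \<and>
    (\<forall>p<fst G. m + p < N) \<and> (\<forall>q<fst (snd G). q < N) \<and>
    (\<forall>w\<in>all_words d. \<forall>p<fst G. \<forall>q<fst (snd G).
       monomial G X w $$ (p,q) = monomial (N, N, schur_prod N N S S) Ys w $$ (m + p, q))"
proof -
  obtain n m mul where G: "G = (n, m, mul)" by (cases G) auto
  have X: "length X = d" "\<And>i. i < d \<Longrightarrow> X ! i \<in> carrier_mat n m"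
    using assms by (auto simp: Cd_def schur_spectral_contraction_def Sd_def G)
  obtain SA SB A B where S: "unital_assoc_alg n SA" "unital_assoc_alg m SB" and mul: "mul = schur_prod n m SA SB"
    and AB: "\<forall>i<d. A ! i \<in> carrier_mat m m \<and> B ! i \<in> carrier_mat n n"
    and pd: "\<forall>i<d. pd (map (\<lambda>i. four_block_mat (A ! i) (adj (X ! i)) (X ! i) (B ! i)) [0..<d] ! i)"
    and jsr: "jsr_lt1 (m + n, m + n, schur_prod (m + n) (m + n) (dsum_sc m SB SA) (dsum_sc m SB SA))
        (map (\<lambda>i. four_block_mat (A ! i) (adj (X ! i)) (X ! i) (B ! i)) [0..<d])"
    using assms unfolding G Cd_def schur_spectral_contraction_def mem_Collect_eq prod.case Let_def by blast
  define Ys where "Ys = map (\<lambda>i. four_block_mat (A ! i) (adj (X ! i)) (X ! i) (B ! i)) [0..<d]"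
  obtain uA uB where alg: "sc_algebra {..<n} SA uA" "sc_algebra {..<m} SB uB"
    using S unfolding unital_assoc_alg_iff by blast
  define SD where "SD = dsum_sc m SB SA"
  define v where "v = (\<lambda>i. if i < m then uB i else uA (i - m))"
  have algD: "sc_algebra {..<m+n} SD v" unfolding SD_def v_def by (rule sc_algebra_dsum[OF alg(2,1)])
  interpret P: gsp_algebra n m SA SB uA uB using alg by (simp add: gsp_algebra_def)
  interpret D: gsp_algebra "m+n" "m+n" SD SD v v using algD by (simp add: gsp_algebra_def)
  have Yc: "Ys ! i \<in> carrier_mat (m + n) (m + n)" if "i < d" for i
    using that AB X(2)[OF that] by (simp add: Ys_def)
  have psd: "psd (Ys ! i)" if "i < d" for i using pd that pd_imp_psd by (auto simp: Ys_def)
  have len: "length Ys = d" by (simp add: Ys_def)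
  have "\<exists>L<1. (\<lambda>k. word_max d D.idx (D.wvG (\<lambda>i. ($$) (Ys ! i))) k powr (1 / real k)) \<longlonglongrightarrow> L"
    using D.jsr_lt1_iff[of Ys] jsr len by (simp add: SD_def Ys_def)
  then have "vanishing d D.idx (D.wvG (\<lambda>i. ($$) (Ys ! i)))"
    using vanishing_if_root_limit[of D.idx] by blast
  then have van: "vanishing d D.idx (\<lambda>w. ($$) (monomial D.G Ys w))"
    by (simp add: D.vanishing_monomial_iff)
  have corner: "monomial G X w $$ (p,q) = monomial D.G Ys w $$ (m + p, q)"
    if wpq: "w \<in> all_words d" "p < n" "q < m" for w p q
  proof -
    have "D.wvG (\<lambda>i. ($$) (Ys ! i)) w (map_prod (\<lambda>i. m + i) (\<lambda>i. i) (p,q)) = P.wvG (\<lambda>i. ($$) (X ! i)) w (p,q)"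
    proof (rule word_val_restrict[OF P.T.sc_algebra_axioms D.T.sc_algebra_axioms sc_restrict_gsc])
      show "sc_restrict (\<lambda>i. m + i) {..<n} SA {..<m+n} SD" unfolding SD_def by (rule sc_restrict_dsum_right)
      show "sc_restrict (\<lambda>i. i) {..<m} SB {..<m+n} SD" unfolding SD_def by (rule sc_restrict_dsum_left)
      fix i z assume "i \<in> set w" "z \<in> P.idx"
      then obtain a b where z: "z = (a,b)" "a < n" "b < m" and i: "i < d"
        using wpq(1) by (auto simp: all_words_def)
      have "dim_row (A ! i) = m" "dim_col (A ! i) = m" "dim_row (B ! i) = n" "dim_col (B ! i) = n"
        "dim_row (X ! i) = n" "dim_col (X ! i) = m"
        using AB X(2)[OF i] i by auto
      then show "Ys ! i $$ map_prod (\<lambda>i. m + i) (\<lambda>i. i) z = X ! i $$ z"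
        using i z by (simp add: Ys_def)
    qed (use wpq in auto)
    then show ?thesis using wpq by (simp add: G mul P.monomial_index D.monomial_index)
  qed
  show ?thesis
    by (rule exI[of _ "m+n"], rule exI[of _ SD], rule exI[of _ v], rule exI[of _ Ys], rule exI[of _ m])
       (use algD len Yc psd van corner in \<open>auto simp: G\<close>)
qed

lemma word_val_scale:
  "word_val I S u (\<lambda>i p. c * Y i p) w p = c ^ length w * word_val I S u Y w p"
proof (induction w arbitrary: p)
  case (Cons i w)
  show ?case by (simp add: smul_def Cons.IH sum_distrib_left mult_ac)
qed simp

text \<open>Perturbing \<open>Y\<close> in its own direction gives \<open>(1 + e) Y\<close>, whence
  \<open>t = 1 / (1 + e)\<close>. This room below 1 later supplies geometric convergence.\<close>

lemma (in sc_algebra) vanishing_scale: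
  assumes "vanishing d I (wv Y)"
  shows "\<exists>t. 0 < t \<and> t < 1 \<and> vanishing d I (wv (\<lambda>i p. of_real (1 / t) * Y i p))"
proof -
  obtain m where m: "m > 0" "\<forall>w\<in>words d m. mulC * l2n I (wv Y w) < 1"
    using contractive_if_vanishing[OF assms] by blast
  obtain e where e: "e > 0" "\<forall>w\<in>words d m. mulC * l2n I (wv (\<lambda>i p. Y i p + of_real e * Y i p) w) < 1"
    using perturbation_contractive[OF m(2), of Y] by blast
  define t where "t = 1 / (1 + e)"
  have t: "0 < t" "t < 1" "1 / t = 1 + e" using e by (auto simp: t_def)
  have eq: "(\<lambda>i p. of_real (1 / t) * Y i p) = (\<lambda>i p. Y i p + of_real e * Y i p)"
    unfolding t(3) by (simp add: distrib_right)
  have "vanishing d I (wv (\<lambda>i p. of_real (1 / t) * Y i p))"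
    unfolding eq using root_limit_if_contractive[OF m(1)] e(2) vanishing_if_root_limit[OF fin] by blast
  then show ?thesis using t by blast
qed

section \<open>Tensoring with full matrix algebras\<close>

definition mat_sc :: "'r \<times> 'r \<Rightarrow> 'r \<times> 'r \<Rightarrow> 'r \<times> 'r \<Rightarrow> complex" where
  "mat_sc = (\<lambda>(a,b) (c,e) (r,s). if b = c \<and> r = a \<and> s = e then 1 else 0)"

definition mat_one :: "'r \<times> 'r \<Rightarrow> complex" where
  "mat_one = (\<lambda>(a,b). if a = b then 1 else 0)"

lemma mat_sc_apply [simp]: "mat_sc (a,b) (c,e) (r,s) = (if b = c \<and> r = a \<and> s = e then 1 else 0)"
  by (simp add: mat_sc_def)

lemma mat_one_apply [simp]: "mat_one (a,b) = (if a = b then 1 else 0)"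
  by (simp add: mat_one_def)

text \<open>A product of two matrix units is one matrix unit or 0. Hence in the tensor product of
  the matrix algebra with its conjugate the diagonal coordinates multiply among themselves, exactly
  as in the matrix algebra.\<close>

lemma mat_sc_diagonal: "cnj (mat_sc i k p) * mat_sc i k q = (if p = q then mat_sc i k p else 0)"
  by (cases i; cases k; cases p; cases q) auto

lemma sc_algebra_mat_sc:
  assumes "finite R" shows "sc_algebra (R \<times> R) mat_sc mat_one"
proof
  fix i j k p assume "i \<in> R \<times> R" "j \<in> R \<times> R" "k \<in> R \<times> R" "p \<in> R \<times> R"
  then obtain a b c e g h r s where x: "i = (a,b)" "j = (c,e)" "k = (g,h)" "p = (r,s)"
    and R: "a \<in> R" "b \<in> R" "c \<in> R" "e \<in> R" "g \<in> R" "h \<in> R" "r \<in> R" "s \<in> R" by auto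
  let ?v = "if b = c \<and> e = g \<and> r = a \<and> s = h then 1 else 0 :: complex"
  have "(\<Sum>q\<in>R\<times>R. mat_sc i j q * mat_sc q k p) = (\<Sum>q\<in>R\<times>R. if q = (a,e) then ?v else 0)"
    by (rule sum.cong) (auto simp: x split: if_splits)
  moreover have "(\<Sum>q\<in>R\<times>R. mat_sc j k q * mat_sc i q p) = (\<Sum>q\<in>R\<times>R. if q = (c,h) then ?v else 0)"
    by (rule sum.cong) (auto simp: x split: if_splits)
  ultimately show "(\<Sum>q\<in>R\<times>R. mat_sc i j q * mat_sc q k p) = (\<Sum>q\<in>R\<times>R. mat_sc j k q * mat_sc i q p)"
    using R assms by simp
next
  fix i p assume "i \<in> R \<times> R" "p \<in> R \<times> R"
  then obtain a b r s where x: "i = (a,b)" "p = (r,s)" and R: "a \<in> R" "b \<in> R" "r \<in> R" "s \<in> R" by auto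
  let ?v = "if i = p then 1 else 0 :: complex"
  have "(\<Sum>k\<in>R\<times>R. mat_one k * mat_sc k i p) = (\<Sum>q\<in>R\<times>R. if q = (a,a) then ?v else 0)"
    by (rule sum.cong) (auto simp: x split: if_splits)
  then show "(\<Sum>k\<in>R\<times>R. mat_one k * mat_sc k i p) = ?v" using R assms by simp
  have "(\<Sum>k\<in>R\<times>R. mat_one k * mat_sc i k p) = (\<Sum>q\<in>R\<times>R. if q = (b,b) then ?v else 0)"
    by (rule sum.cong) (auto simp: x split: if_splits)
  then show "(\<Sum>k\<in>R\<times>R. mat_one k * mat_sc i k p) = ?v" using R assms by simp
qed (use assms in simp)

lemma smul_mat_sc:
  assumes "finite R" "r \<in> R" "s \<in> R"
  shows "smul (R \<times> R) mat_sc x y (r,s) = (\<Sum>t\<in>R. x (r,t) * y (t,s))"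
proof -
  have "smul (R \<times> R) mat_sc x y (r,s)
      = (\<Sum>a\<in>R. \<Sum>b\<in>R. \<Sum>c\<in>R. \<Sum>e\<in>R. x (a,b) * y (c,e) * mat_sc (a,b) (c,e) (r,s))"
    unfolding smul_def sum.cartesian_product' ..
  also have "\<dots> = (\<Sum>a\<in>R. if a = r then (\<Sum>b\<in>R. \<Sum>c\<in>R. if c = b then (\<Sum>e\<in>R. if e = s then x (a,b) * y (c,e) else 0) else 0) else 0)"
    by (intro sum.cong refl) (auto intro!: sum.cong sum.neutral)
  also have "\<dots> = (\<Sum>t\<in>R. x (r,t) * y (t,s))" using assms by simp
  finally show ?thesis .
qed

text \<open>\<open>x\<close> tensored with the diagonal matrix with entries \<open>w\<close>. For
  \<open>K = R \<times> R\<close> this diagonal lists the entries of a matrix \<open>w\<close>, and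
  it is positive semidefinite as soon as these are nonnegative.\<close>

definition diag_tensor :: "('i \<times> 'i \<Rightarrow> complex) \<Rightarrow> ('k \<Rightarrow> complex) \<Rightarrow> ('i \<times> 'k) \<times> ('i \<times> 'k) \<Rightarrow> complex" where
  "diag_tensor x w = (\<lambda>((a,k),(b,l)). if k = l then x (a,b) * w k else 0)"

lemma diag_tensor_apply [simp]: "diag_tensor x w ((a,k),(b,l)) = (if k = l then x (a,b) * w k else 0)"
  by (simp add: diag_tensor_def)

lemma sum_diag_tensor:
  assumes "finite K"
  shows "(\<Sum>z\<in>(I\<times>K)\<times>(I\<times>K). diag_tensor x w z * F z)
    = (\<Sum>(a,b)\<in>I\<times>I. \<Sum>k\<in>K. x (a,b) * w k * F ((a,k),(b,k)))"
proof -
  have "(\<Sum>z\<in>(I\<times>K)\<times>(I\<times>K). diag_tensor x w z * F z)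
      = (\<Sum>a\<in>I. \<Sum>k\<in>K. \<Sum>b\<in>I. \<Sum>l\<in>K. if k = l then x (a,b) * w k * F ((a,k),(b,l)) else 0)"
    unfolding sum.cartesian_product' by (intro sum.cong refl) auto
  also have "\<dots> = (\<Sum>a\<in>I. \<Sum>k\<in>K. \<Sum>b\<in>I. x (a,b) * w k * F ((a,k),(b,k)))"
    using assms by (intro sum.cong refl) simp
  also have "\<dots> = (\<Sum>a\<in>I. \<Sum>b\<in>I. \<Sum>k\<in>K. x (a,b) * w k * F ((a,k),(b,k)))"
    by (rule sum.cong[OF refl]) (rule sum.swap)
  finally show ?thesis by (simp add: sum.cartesian_product')
qed

lemma sum_separate4:
  fixes P :: "'a \<Rightarrow> 'a \<Rightarrow> complex"
  shows "(\<Sum>a\<in>A. \<Sum>k\<in>K. \<Sum>b\<in>A. \<Sum>l\<in>K. P a b * Q k l) = (\<Sum>a\<in>A. \<Sum>b\<in>A. P a b) * (\<Sum>k\<in>K. \<Sum>l\<in>K. Q k l)"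
proof -
  have "(\<Sum>a\<in>A. \<Sum>k\<in>K. \<Sum>b\<in>A. \<Sum>l\<in>K. P a b * Q k l) = (\<Sum>a\<in>A. \<Sum>b\<in>A. \<Sum>k\<in>K. \<Sum>l\<in>K. P a b * Q k l)"
    by (rule sum.cong[OF refl]) (rule sum.swap)
  then show ?thesis by (simp flip: sum_distrib_left sum_distrib_right)
qed

lemma smul_diag_tensor:
  assumes K: "finite K" and E: "\<And>i k p q. cnj (E i k p) * E i k q = (if p = q then E i k p else 0)"
  shows "smul ((I\<times>K)\<times>(I\<times>K)) (gsc (gsc S E) (gsc S E)) (diag_tensor x w) (diag_tensor x' w') ((c,p),(c',q))
    = diag_tensor (smul (I\<times>I) (gsc S S) x x') (smul K E w w') ((c,p),(c',q))"
proof -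
  let ?J = "(I\<times>K)\<times>(I\<times>K)" and ?T = "gsc (gsc S E) (gsc S E)"
  have "smul ?J ?T (diag_tensor x w) (diag_tensor x' w') ((c,p),(c',q))
      = (\<Sum>z\<in>?J. diag_tensor x w z * (\<Sum>z'\<in>?J. diag_tensor x' w' z' * ?T z z' ((c,p),(c',q))))"
    unfolding smul_def sum_distrib_left by (simp add: mult.assoc)
  also have "\<dots> = (\<Sum>(a,b)\<in>I\<times>I. \<Sum>k\<in>K. x (a,b) * w k * (\<Sum>(a',b')\<in>I\<times>I. \<Sum>k'\<in>K. x' (a',b') * w' k' *
      (S a a' c * cnj (S b b' c') * (cnj (E k k' p) * E k k' q))))"
    unfolding sum_diag_tensor[OF K] by (simp add: mult_ac)
  also have "\<dots> = (\<Sum>z\<in>I\<times>I. \<Sum>k\<in>K. \<Sum>z'\<in>I\<times>I. \<Sum>k'\<in>K. (x z * x' z' * gsc S S z z' (c,c')) *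
      (w k * w' k' * (if p = q then E k k' p else 0)))"
    unfolding E case_prod_unfold sum_distrib_left
    by (intro sum.cong refl) (auto simp: gsc_def mult_ac)
  also have "\<dots> = smul (I\<times>I) (gsc S S) x x' (c,c') * (\<Sum>k\<in>K. \<Sum>k'\<in>K. w k * w' k' * (if p = q then E k k' p else 0))"
    unfolding sum_separate4 smul_def ..
  also have "\<dots> = diag_tensor (smul (I\<times>I) (gsc S S) x x') (smul K E w w') ((c,p),(c',q))"
    by (simp add: smul_def)
  finally show ?thesis .
qed

lemma word_val_diag_tensor:
  assumes S: "sc_algebra I S u" and R: "finite R" and w: "w \<noteq> []"
    and p: "p \<in> (I \<times> (R \<times> R)) \<times> (I \<times> (R \<times> R))"
  shows "word_val ((I \<times> (R \<times> R)) \<times> (I \<times> (R \<times> R))) (gsc (gsc S mat_sc) (gsc S mat_sc))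
      (tensor_unit (tensor_unit u mat_one) (tensor_unit u mat_one)) (\<lambda>i. diag_tensor (y i) (W i)) w p
    = diag_tensor (word_val (I \<times> I) (gsc S S) (tensor_unit u u) y w) (word_val (R \<times> R) mat_sc mat_one W w) p"
proof -
  note M = sc_algebra_mat_sc[OF R]
  interpret A: sc_algebra "I \<times> I" "gsc S S" "tensor_unit u u" by (rule sc_algebra_gsc[OF S S])
  interpret M: sc_algebra "R \<times> R" mat_sc mat_one by (rule M)
  note SM = sc_algebra_gsc[OF S M]
  interpret B: sc_algebra "(I \<times> (R \<times> R)) \<times> (I \<times> (R \<times> R))" "gsc (gsc S mat_sc) (gsc S mat_sc)"
    "tensor_unit (tensor_unit u mat_one) (tensor_unit u mat_one)" by (rule sc_algebra_gsc[OF SM SM])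
  show ?thesis using w p
  proof (induction w arbitrary: p)
    case (Cons i w)
    obtain a k b l where p: "p = ((a,k),(b,l))" "a \<in> I" "b \<in> I" "k \<in> R \<times> R" "l \<in> R \<times> R"
      using Cons.prems(2) by auto
    show ?case
    \<comment> \<open>One letter is the base case: the unit of the amplified algebra is not diagonal
      in general, but multiplying a diagonal letter by it is harmless.\<close>
    proof (cases "w = []")
      case True
      then show ?thesis
        using B.mul_unit_right[OF Cons.prems(2)] A.mul_unit_right[of "(a,b)"] M.mul_unit_right[of k] M.mul_unit_right[of l] p
        by simp
    next
      case False
      have "B.wv (\<lambda>i. diag_tensor (y i) (W i)) (i # w) p
          = B.mul (diag_tensor (y i) (W i)) (diag_tensor (A.wv y w) (M.wv W w)) p"
        unfolding word_val_Cons by (intro fun_cong[OF smul_cong] refl Cons.IH False)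
      then show ?thesis
        unfolding p(1) by (simp only: smul_diag_tensor[OF M.fin mat_sc_diagonal] word_val_Cons)
    qed
  qed simp
qed

lemma psd_kernel_diag_tensor:
  assumes y: "psd_kernel I y" and I: "finite I" and K: "finite K" and W: "\<And>k. k \<in> K \<Longrightarrow> 0 \<le> W k"
  shows "psd_kernel (I \<times> K) (diag_tensor y W)"
proof -
  let ?L = "\<lambda>k p a. if p = (a,k) then 1 else 0 :: complex"
  let ?x = "\<lambda>k (p,q). \<Sum>a\<in>I. \<Sum>b\<in>I. ?L k p a * y (a,b) * cnj (?L k q b)"
  have "psd_kernel (I \<times> K) (\<lambda>z. \<Sum>k\<in>K. W k * ?x k z)"
    by (intro psd_kernel_sum psd_kernel_scale psd_kernel_congruence y W)
  moreover have "(\<Sum>k\<in>K. W k * ?x k (p,q)) = diag_tensor y W (p,q)" if "p \<in> I \<times> K" "q \<in> I \<times> K" for p q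
  proof -
    obtain a k b l where pq: "p = (a,k)" "q = (b,l)" and m: "a \<in> I" "b \<in> I" "k \<in> K" "l \<in> K"
      using \<open>p \<in> I \<times> K\<close> \<open>q \<in> I \<times> K\<close> by auto
    have "?x j (p,q) = (if j = k then if j = l then y (a,b) else 0 else 0)" for j
    proof -
      have "?x j (p,q) = (\<Sum>a'\<in>I. if a' = a then (\<Sum>b'\<in>I. if b' = b then (if j = k \<and> j = l then y (a,b) else 0) else 0) else 0)"
        unfolding prod.case by (intro sum.cong refl) (auto simp: pq intro!: sum.cong sum.neutral)
      then show ?thesis using m I by simp
    qed
    then have "(\<Sum>k\<in>K. W k * ?x k (p,q)) = (\<Sum>j\<in>K. if j = k then (if k = l then W k * y (a,b) else 0) else 0)"
      by (intro sum.cong refl) auto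
    then show ?thesis using m K by (simp add: pq mult.commute)
  qed
  ultimately show ?thesis by (rule psd_kernel_cong[THEN iffD1, rotated])
qed

section \<open>Values of \<open>f\<close> at amplified points\<close>

lemma sc_algebra_reindex:
  assumes S: "sc_algebra I S u" and h: "bij_betw h J I"
  shows "sc_algebra J (\<lambda>i k p. S (h i) (h k) (h p)) (\<lambda>i. u (h i))"
proof -
  interpret sc_algebra I S u by fact
  have m: "h i \<in> I" if "i \<in> J" for i using h that by (auto simp: bij_betw_def)
  have inj: "h i = h j \<longleftrightarrow> i = j" if "i \<in> J" "j \<in> J" for i j
    using h that by (auto simp: bij_betw_def inj_on_def)
  note re = sum.reindex_bij_betw[OF h]
  show ?thesis
  proof
    show "finite J" using h fin by (simp add: bij_betw_finite)
  next
    fix i j k p assume "i \<in> J" "j \<in> J" "k \<in> J" "p \<in> J"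
    then show "(\<Sum>q\<in>J. S (h i) (h j) (h q) * S (h q) (h k) (h p)) = (\<Sum>q\<in>J. S (h j) (h k) (h q) * S (h i) (h q) (h p))"
      using struct_assoc[of "h i" "h j" "h k" "h p"] m
      by (simp add: re[of "\<lambda>q. S (h i) (h j) q * S q (h k) (h p)"] re[of "\<lambda>q. S (h j) (h k) q * S (h i) q (h p)"])
  next
    fix i p assume "i \<in> J" "p \<in> J"
    then show "(\<Sum>k\<in>J. u (h k) * S (h k) (h i) (h p)) = (if i = p then 1 else 0)"
      "(\<Sum>k\<in>J. u (h k) * S (h i) (h k) (h p)) = (if i = p then 1 else 0)"
      using unit_left[of "h i" "h p"] unit_right[of "h i" "h p"] m inj[of i p]
      by (simp_all add: re[of "\<lambda>k. u k * S k (h i) (h p)"] re[of "\<lambda>k. u k * S (h i) k (h p)"])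
  qed
qed

lemma pos_preserving_gsp_same:
  assumes "sc_algebra {..<n} S u"
  shows "pos_preserving_gsp (n, n, schur_prod n n S S)"
  unfolding pos_preserving_gsp_def prod.case
proof (intro conjI ballI impI refl)
  interpret P: gsp_algebra n n S S u u using assms by (simp add: gsp_algebra_def)
  fix A B :: "complex mat" assume AB: "A \<in> carrier_mat n n" "B \<in> carrier_mat n n" and "psd A \<and> psd B"
  then have "psd_kernel {..<n} (smul P.idx (gsc S S) (($$) A) (($$) B))"
    by (intro psd_kernel_smul) (auto simp: psd_iff_kernel)
  then show "psd (schur_prod n n S S A B)"
    unfolding psd_iff_kernel[OF P.schur_prod_carrier]
    by (rule psd_kernel_cong[THEN iffD1, rotated]) (simp add: P.schur_prod_index)
qed

text \<open>\<open>F\<close> records entries of the value of \<open>f\<close> at a point of \<open>Cd d\<close>, and \<open>V w\<close> the same entries of the word \<open>w\<close>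
  in that point. All other entries are multiples of recorded ones, so that the recorded entries
  detect the polynomial relations of the point.\<close>

definition ncval :: "nat \<Rightarrow> (pt \<Rightarrow> complex mat) \<Rightarrow> 'e set \<Rightarrow> (nat list \<Rightarrow> 'e \<Rightarrow> complex) \<Rightarrow> ('e \<Rightarrow> complex) \<Rightarrow> bool" where
  "ncval d f E V F \<longleftrightarrow> (\<exists>G X \<kappa>. (G, X) \<in> Cd d \<and>
     (\<forall>e\<in>E. \<kappa> e \<in> {..<fst G} \<times> {..<fst (snd G)}) \<and>
     (\<forall>w\<in>all_words d. \<forall>e\<in>E. monomial G X w $$ \<kappa> e = V w e) \<and>
     (\<forall>z\<in>{..<fst G} \<times> {..<fst (snd G)}. \<exists>e\<in>E. \<exists>a. \<forall>w\<in>all_words d. monomial G X w $$ z = a * V w e) \<and>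
     (\<forall>e\<in>E. f (G, X) $$ \<kappa> e = F e))"

lemma ncval_point:
  "(G, X) \<in> Cd d \<Longrightarrow> ncval d f ({..<fst G} \<times> {..<fst (snd G)}) (\<lambda>w. ($$) (monomial G X w)) (($$) (f (G, X)))"
  unfolding ncval_def
  by (rule exI[of _ G], rule exI[of _ X], rule exI[of _ "\<lambda>z. z"]) (auto intro!: bexI exI[of _ 1])

lemma ncval_polynomial:
  assumes nc: "nc_function d (Cd d) f" and val: "ncval d f E V F"
  shows "\<exists>W c. finite W \<and> W \<subseteq> all_words d \<and> (\<forall>e\<in>E. F e = (\<Sum>\<alpha>\<in>W. c \<alpha> * V \<alpha> e))"
proof -
  obtain G X \<kappa> where P: "(G, X) \<in> Cd d" "\<forall>e\<in>E. \<kappa> e \<in> {..<fst G} \<times> {..<fst (snd G)}"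
    "\<forall>w\<in>all_words d. \<forall>e\<in>E. monomial G X w $$ \<kappa> e = V w e" "\<forall>e\<in>E. f (G, X) $$ \<kappa> e = F e"
    using val unfolding ncval_def by blast
  obtain W c where W: "finite W" "W \<subseteq> all_words d" "f (G, X) = lin_comb G X W c"
    using nc P(1) unfolding nc_function_def alg_gen_def by fastforce
  have "F e = (\<Sum>\<alpha>\<in>W. c \<alpha> * V \<alpha> e)" if "e \<in> E" for e
  proof -
    obtain p q where z: "\<kappa> e = (p,q)" "p < fst G" "q < fst (snd G)" using P(2) \<open>e \<in> E\<close> by (cases "\<kappa> e") force
    have "F e = f (G, X) $$ (p,q)" using P(4) that z by auto
    also have "\<dots> = (\<Sum>\<alpha>\<in>W. c \<alpha> * monomial G X \<alpha> $$ (p,q))" unfolding W(3) by (rule lin_comb_index[OF z(2,3)])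
    also have "\<dots> = (\<Sum>\<alpha>\<in>W. c \<alpha> * V \<alpha> e)"
      using P(3) W(2) that z by (intro sum.cong refl) (metis subsetD)
    finally show ?thesis .
  qed
  then show ?thesis using W by blast
qed

lemma ncval_transfer:
  assumes nc: "nc_function d (Cd d) f" and val: "ncval d f E V F" and val': "ncval d f E' V' F'"
    and W: "finite W" "W \<subseteq> all_words d" and F: "\<And>e. e \<in> E \<Longrightarrow> F e = (\<Sum>\<alpha>\<in>W. c \<alpha> * V \<alpha> e)"
    and rel: "\<And>W c e'. finite W \<Longrightarrow> W \<subseteq> all_words d \<Longrightarrow> (\<And>e. e \<in> E \<Longrightarrow> (\<Sum>\<alpha>\<in>W. c \<alpha> * V \<alpha> e) = 0) \<Longrightarrow>
        e' \<in> E' \<Longrightarrow> (\<Sum>\<alpha>\<in>W. c \<alpha> * V' \<alpha> e') = 0"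
    and e': "e' \<in> E'"
  shows "F' e' = (\<Sum>\<alpha>\<in>W. c \<alpha> * V' \<alpha> e')"
proof -
  obtain G X \<kappa> where P: "(G, X) \<in> Cd d" "\<forall>e\<in>E. \<kappa> e \<in> {..<fst G} \<times> {..<fst (snd G)}"
    "\<forall>w\<in>all_words d. \<forall>e\<in>E. monomial G X w $$ \<kappa> e = V w e"
    "\<forall>z\<in>{..<fst G} \<times> {..<fst (snd G)}. \<exists>e\<in>E. \<exists>a. \<forall>w\<in>all_words d. monomial G X w $$ z = a * V w e"
    "\<forall>e\<in>E. f (G, X) $$ \<kappa> e = F e"
    using val unfolding ncval_def by blast
  obtain H Y \<kappa>' where Q: "(H, Y) \<in> Cd d" "\<forall>e\<in>E'. \<kappa>' e \<in> {..<fst H} \<times> {..<fst (snd H)}"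
    "\<forall>w\<in>all_words d. \<forall>e\<in>E'. monomial H Y w $$ \<kappa>' e = V' w e"
    "\<forall>z\<in>{..<fst H} \<times> {..<fst (snd H)}. \<exists>e\<in>E'. \<exists>a. \<forall>w\<in>all_words d. monomial H Y w $$ z = a * V' w e"
    "\<forall>e\<in>E'. f (H, Y) $$ \<kappa>' e = F' e"
    using val' unfolding ncval_def by blast
  have at: "(\<Sum>\<alpha>\<in>W. c \<alpha> * V \<alpha> e) = lin_comb G X W c $$ \<kappa> e" if "e \<in> E" "W \<subseteq> all_words d" for e W c
  proof -
    obtain p q where z: "\<kappa> e = (p,q)" "p < fst G" "q < fst (snd G)" using P(2) \<open>e \<in> E\<close> by (cases "\<kappa> e") force
    show ?thesis unfolding z(1) lin_comb_index[OF z(2,3)]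
      using P(3) that z by (intro sum.cong refl) (metis subsetD)
  qed
  have at': "(\<Sum>\<alpha>\<in>W. c \<alpha> * V' \<alpha> e) = lin_comb H Y W c $$ \<kappa>' e" if "e \<in> E'" "W \<subseteq> all_words d" for e W c
  proof -
    obtain p q where z: "\<kappa>' e = (p,q)" "p < fst H" "q < fst (snd H)" using Q(2) \<open>e \<in> E'\<close> by (cases "\<kappa>' e") force
    show ?thesis unfolding z(1) lin_comb_index[OF z(2,3)]
      using Q(3) that z by (intro sum.cong refl) (metis subsetD)
  qed
  have scaled: "(\<Sum>\<alpha>\<in>W. c \<alpha> * monomial K Z \<alpha> $$ z) = a * (\<Sum>\<alpha>\<in>W. c \<alpha> * U \<alpha>)"
    if "\<forall>w\<in>all_words d. monomial K Z w $$ z = a * U w" "W \<subseteq> all_words d" for K Z z a U W c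
  proof -
    have "(\<Sum>\<alpha>\<in>W. c \<alpha> * monomial K Z \<alpha> $$ z) = (\<Sum>\<alpha>\<in>W. a * (c \<alpha> * U \<alpha>))"
      using that by (intro sum.cong refl) (auto dest: subsetD)
    then show ?thesis by (simp add: sum_distrib_left)
  qed
  obtain W0 c0 where W0: "finite W0" "W0 \<subseteq> all_words d" "f (G, X) = lin_comb G X W0 c0"
    using nc P(1) unfolding nc_function_def alg_gen_def by fastforce
  \<comment> \<open>\<open>c\<close> is only known to match the recorded entries. It agrees there
    with a polynomial \<open>c0\<close> for the whole matrix, and every entry is a multiple of a
    recorded one, so \<open>c\<close> represents \<open>f\<close> at \<open>X\<close> as
    well.\<close>
  have "lin_comb G X W0 c0 = lin_comb G X W c"
  proof (rule eq_matI)
    fix i j assume "i < dim_row (lin_comb G X W c)" "j < dim_col (lin_comb G X W c)"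
    then have ij: "i < fst G" "j < fst (snd G)" by (auto simp: lin_comb_def)
    then obtain e a where e: "e \<in> E" and a: "\<forall>w\<in>all_words d. monomial G X w $$ (i,j) = a * V w e"
      using P(4) by fastforce
    have "(\<Sum>\<alpha>\<in>W0. c0 \<alpha> * V \<alpha> e) = (\<Sum>\<alpha>\<in>W. c \<alpha> * V \<alpha> e)"
      using at[OF e W0(2), of c0] F[OF e] P(5) e W0(3) by auto
    then show "lin_comb G X W0 c0 $$ (i,j) = lin_comb G X W c $$ (i,j)"
      unfolding lin_comb_index[OF ij] scaled[OF a W0(2)] scaled[OF a W(2)] by simp
  qed (auto simp: lin_comb_def)
  then have fP: "f (G, X) = lin_comb G X W c" using W0 by simp
  have "f (H, Y) = lin_comb H Y W c"
  proof (rule nc_function_transfer[OF nc P(1) Q(1) _ W fP])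
    fix W c assume W: "finite W" "W \<subseteq> all_words d" and z: "lin_comb G X W c = 0\<^sub>m (fst G) (fst (snd G))"
    have "(\<Sum>\<alpha>\<in>W. c \<alpha> * V \<alpha> e) = 0" if "e \<in> E" for e
    proof -
      have "\<kappa> e \<in> {..<fst G} \<times> {..<fst (snd G)}" using P(2) that by blast
      then show ?thesis unfolding at[OF that W(2)] z by auto
    qed
    note zero = rel[OF W this]
    show "lin_comb H Y W c = 0\<^sub>m (fst H) (fst (snd H))"
    proof (rule eq_matI)
      fix i j assume "i < dim_row (0\<^sub>m (fst H) (fst (snd H)) :: complex mat)" "j < dim_col (0\<^sub>m (fst H) (fst (snd H)) :: complex mat)"
      then have ij: "i < fst H" "j < fst (snd H)" by auto
      then obtain e a where e: "e \<in> E'" and a: "\<forall>w\<in>all_words d. monomial H Y w $$ (i,j) = a * V' w e"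
        using Q(4) by fastforce
      show "lin_comb H Y W c $$ (i,j) = 0\<^sub>m (fst H) (fst (snd H)) $$ (i,j)"
        unfolding lin_comb_index[OF ij] scaled[OF a W(2)] using zero[OF _ e] ij by simp
    qed (auto simp: lin_comb_def)
  qed
  then show ?thesis using at'[OF e' W(2), of c] Q(5) e' by simp
qed

text \<open>The nonnegative matrices \<open>W i\<close> are placed on the diagonal of the tensor square of the matrix algebra.
  The diagonal is closed under the product but does not contain the unit, so the empty word has
  off-diagonal entries; these are multiples of the entries at \<open>(r0, r0)\<close>, where only the empty word is
  visible.\<close>

lemma ncval_amplification:
  fixes I :: "'i set" and S :: "'i \<Rightarrow> 'i \<Rightarrow> 'i \<Rightarrow> complex" and u :: "'i \<Rightarrow> complex"
    and R :: "'r set" and y :: "nat \<Rightarrow> 'i \<times> 'i \<Rightarrow> complex" and W :: "nat \<Rightarrow> 'r \<times> 'r \<Rightarrow> complex"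
  defines "V \<equiv> \<lambda>w (z,x). word_val (I \<times> I) (gsc S S) (tensor_unit u u) y w z * word_val (R \<times> R) mat_sc mat_one W w x"
  assumes nc: "nc_function d (Cd d) f" and pos: "pos_preserving_ncf d (Cd d) f"
    and S: "sc_algebra I S u" and R: "finite R"
    and y: "\<And>i. i < d \<Longrightarrow> psd_kernel I (y i)"
    and W: "\<And>i x. i < d \<Longrightarrow> x \<in> R \<times> R \<Longrightarrow> 0 \<le> W i x"
    and van: "vanishing d ((I \<times> I) \<times> (R \<times> R)) V"
    and r0: "r0 \<in> R" "\<And>w. w \<in> all_words d \<Longrightarrow> word_val (R \<times> R) mat_sc mat_one W w (r0,r0) = (if w = [] then 1 else 0)"
  shows "\<exists>F. ncval d f ((I \<times> I) \<times> (R \<times> R)) V F \<and> (\<forall>x\<in>R \<times> R. psd_kernel I (\<lambda>z. F (z,x)))"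
proof -
  define H where "H = I \<times> (R \<times> R)"
  note SM = sc_algebra_gsc[OF S sc_algebra_mat_sc[OF R]]
  interpret S: sc_algebra I S u by (rule S)
  have finH: "finite H" using R by (simp add: H_def)
  define N where "N = card H"
  \<comment> \<open>Generalized Schur products are indexed by initial segments of the naturals, so
    the tensor product is transported along a bijection.\<close>
  obtain h where h: "bij_betw h {..<N} H"
    using ex_bij_betw_nat_finite[OF finH] by (auto simp: N_def lessThan_atLeast0)
  define g where "g = the_inv_into {..<N} h"
  have g: "g p < N" "h (g p) = p" if "p \<in> H" for p
    using h that bij_betw_the_inv_into[OF h] unfolding g_def
    by (auto simp: bij_betw_def f_the_inv_into_f)
  have hH: "h p \<in> H" if "p < N" for p using h that by (auto simp: bij_betw_def)
  define T where "T = (\<lambda>i k p. gsc S mat_sc (h i) (h k) (h p))"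
  define v where "v = (\<lambda>i. tensor_unit u mat_one (h i))"
  have alg: "sc_algebra {..<N} T v"
    unfolding T_def v_def by (rule sc_algebra_reindex[OF SM]) (use h in \<open>simp add: H_def\<close>)
  interpret P: gsp_algebra N N T T v v using alg by (simp add: gsp_algebra_def)
  define X where "X = map (\<lambda>i. mat N N (\<lambda>(p,q). diag_tensor (y i) (W i) (h p, h q))) [0..<d]"
  have X: "length X = d" "\<And>i. i < d \<Longrightarrow> X ! i \<in> carrier_mat N N"
    "\<And>i p q. i < d \<Longrightarrow> p < N \<Longrightarrow> q < N \<Longrightarrow> X ! i $$ (p,q) = diag_tensor (y i) (W i) (h p, h q)"
    by (auto simp: X_def)
  define U where "U = word_val (H \<times> H) (gsc (gsc S mat_sc) (gsc S mat_sc))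
      (tensor_unit (tensor_unit u mat_one) (tensor_unit u mat_one)) (\<lambda>i. diag_tensor (y i) (W i))"
  have restr: "sc_restrict h {..<N} T H (gsc S mat_sc)"
    using h unfolding sc_restrict_def T_def bij_betw_def by auto
  have mono: "monomial P.G X w $$ (p,q) = U w (h p, h q)" if wpq: "w \<in> all_words d" "p < N" "q < N" for w p q
  proof -
    have SM': "sc_algebra H (gsc S mat_sc) (tensor_unit u mat_one)" using SM by (simp add: H_def)
    have "U w (map_prod h h (p,q)) = P.wvG (\<lambda>i. ($$) (X ! i)) w (p,q)"
      unfolding U_def
      by (rule word_val_restrict[OF P.T.sc_algebra_axioms sc_algebra_gsc[OF SM' SM'] sc_restrict_gsc[OF restr restr]])
         (use wpq X(3) in \<open>auto simp: all_words_def\<close>)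
    then show ?thesis using wpq by (simp add: P.monomial_index)
  qed
  have U: "U w ((a,k),(b,l)) = (if k = l then V w ((a,b),k) else mat_one k * mat_one l * V w ((a,b),(r0,r0)))"
    if "w \<in> all_words d" "(a,k) \<in> H" "(b,l) \<in> H" for w a b k l
  proof (cases "w = []")
    case True
    then show ?thesis by (cases k; cases l) (auto simp: U_def V_def)
  next
    case False
    then show ?thesis
      using word_val_diag_tensor[OF S R False, of "((a,k),(b,l))" y W] that r0(2)[OF that(1)]
      by (auto simp: U_def V_def H_def)
  qed
  have psdX: "psd (X ! i)" if i: "i < d" for i
  proof -
    have "psd_kernel H (diag_tensor (y i) (W i))"
      unfolding H_def by (rule psd_kernel_diag_tensor[OF y[OF i] S.fin]) (use R W[OF i] in auto)
    then have "psd_kernel {..<N} (\<lambda>(p,q). diag_tensor (y i) (W i) (h p, h q))"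
      by (rule psd_kernel_pullback) (use finH hH in auto)
    then show ?thesis
      unfolding psd_iff_kernel[OF X(2)[OF i]]
      by (rule psd_kernel_cong[THEN iffD1, rotated]) (use X(3)[OF i] in auto)
  qed
  have "vanishing d P.idx (\<lambda>w. ($$) (monomial P.G X w))"
    unfolding vanishing_def
  proof (intro allI impI)
    fix e :: real assume e: "e > 0"
    then obtain k0 where k0: "\<And>w z. w \<in> all_words d \<Longrightarrow> k0 \<le> length w \<Longrightarrow> z \<in> (I \<times> I) \<times> (R \<times> R) \<Longrightarrow> cmod (V w z) < e"
      using van unfolding vanishing_def by blast
    have "cmod (monomial P.G X w $$ (p,q)) < e" if w: "w \<in> all_words d" "k0 \<le> length w" and pq: "p < N" "q < N" for w p q
    proof -
      obtain a k b l where eq: "h p = (a,k)" "h q = (b,l)" by (meson surj_pair)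
      have m: "(a,k) \<in> H" "(b,l) \<in> H" using hH pq eq by metis+
      have "cmod (mat_one k * mat_one l * V w ((a,b),(r0,r0))) < e"
        using k0[OF w, of "((a,b),(r0,r0))"] m r0(1) e by (cases k; cases l) (auto simp: H_def)
      then show ?thesis
        using k0[OF w, of "((a,b),k)"] m by (auto simp: mono[OF w(1) pq] eq U[OF w(1) m] H_def)
    qed
    then show "\<exists>k0. \<forall>w\<in>all_words d. k0 \<le> length w \<longrightarrow> (\<forall>p\<in>P.idx. cmod (monomial P.G X w $$ p) < e)"
      by (intro exI[of _ k0]) auto
  qed
  then have C: "(P.G, X) \<in> Cd d" using psd_point_in_Cd[OF alg X(1,2) psdX] by blast
  have fpsd: "psd (f (P.G, X))"
    using pos C pos_preserving_gsp_same[OF alg] psdX unfolding pos_preserving_ncf_def by blast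
  have "f (P.G, X) \<in> alg_gen d (P.G, X)" using nc C by (auto simp: nc_function_def)
  then have "f (P.G, X) \<in> carrier_mat N N" by (auto simp: alg_gen_def lin_comb_def)
  then have kern: "psd_kernel {..<N} (($$) (f (P.G, X)))" using fpsd psd_iff_kernel by blast
  define \<kappa> where "\<kappa> = (\<lambda>((a,b),k). (g (a,k), g (b,k)))"
  define F where "F = (\<lambda>e. f (P.G, X) $$ \<kappa> e)"
  have \<kappa>: "\<kappa> e \<in> {..<N} \<times> {..<N}" if "e \<in> (I \<times> I) \<times> (R \<times> R)" for e
    using that g(1) by (auto simp: \<kappa>_def H_def)
  have mon\<kappa>: "monomial P.G X w $$ \<kappa> e = V w e" if we: "w \<in> all_words d" "e \<in> (I \<times> I) \<times> (R \<times> R)" for w e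
  proof -
    obtain a b k where e: "e = ((a,b),k)" and m: "(a,k) \<in> H" "(b,k) \<in> H"
      using we(2) by (auto simp: H_def)
    show ?thesis using mono[OF we(1) g(1)[OF m(1)] g(1)[OF m(2)]] U[OF we(1) m]
      by (simp add: e \<kappa>_def g(2) m)
  qed
  have sc: "\<exists>e\<in>(I \<times> I) \<times> (R \<times> R). \<exists>c. \<forall>w\<in>all_words d. monomial P.G X w $$ z = c * V w e"
    if "z \<in> {..<N} \<times> {..<N}" for z
  proof -
    obtain p q where z: "z = (p,q)" and pq: "p < N" "q < N" using \<open>z \<in> {..<N} \<times> {..<N}\<close> by auto
    obtain a k b l where eq: "h p = (a,k)" "h q = (b,l)" by (meson surj_pair)
    have m: "(a,k) \<in> H" "(b,l) \<in> H" using hH pq eq by metis+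
    define e where "e = (if k = l then ((a,b),k) else ((a,b),(r0,r0)))"
    define c where "c = (if k = l then 1 else mat_one k * mat_one l :: complex)"
    have "e \<in> (I \<times> I) \<times> (R \<times> R)" using m r0 by (auto simp: e_def H_def)
    moreover have "\<forall>w\<in>all_words d. monomial P.G X w $$ z = c * V w e"
      using U[OF _ m] mono[OF _ pq] by (auto simp: z eq c_def e_def)
    ultimately show ?thesis by blast
  qed
  have "ncval d f ((I \<times> I) \<times> (R \<times> R)) V F"
    unfolding ncval_def
    by (rule exI[of _ P.G], rule exI[of _ X], rule exI[of _ \<kappa>]) (simp only: fst_conv snd_conv, use C \<kappa> mon\<kappa> sc F_def in blast)
  \<comment> \<open>Fixing the matrix position \<open>x\<close> in row and column selects a
    principal submatrix of the positive semidefinite value, which gives one condition for each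
    position.\<close>
  moreover have "psd_kernel I (\<lambda>z. F (z,x))" if "x \<in> R \<times> R" for x
  proof -
    have "psd_kernel I (\<lambda>(a,b). f (P.G, X) $$ (g (a,x), g (b,x)))"
      by (rule psd_kernel_pullback[OF kern]) (use g(1) that in \<open>auto simp: H_def\<close>)
    then show ?thesis
      by (rule psd_kernel_cong[THEN iffD1, rotated]) (simp add: F_def \<kappa>_def)
  qed
  ultimately show ?thesis by blast
qed

section \<open>Coefficients and remainders\<close>

lemma ncval_cong:
  fixes E :: "'a set"
  assumes "\<And>w e. w \<in> all_words d \<Longrightarrow> e \<in> E \<Longrightarrow> V w e = V' w e"
  shows "ncval d f E V F \<longleftrightarrow> ncval d f E V' F"
proof -
  have mon: "(\<forall>w\<in>all_words d. \<forall>e\<in>E. monomial G X w $$ \<kappa> e = V w e) \<longleftrightarrow>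
      (\<forall>w\<in>all_words d. \<forall>e\<in>E. monomial G X w $$ \<kappa> e = V' w e)" for G X and \<kappa> :: "'a \<Rightarrow> nat \<times> nat"
    using assms by auto
  have sc: "(\<exists>e\<in>E. \<exists>a. \<forall>w\<in>all_words d. monomial G X w $$ z = a * V w e) \<longleftrightarrow>
      (\<exists>e\<in>E. \<exists>a. \<forall>w\<in>all_words d. monomial G X w $$ z = a * V' w e)" for G X z
    using assms by (intro bex_cong refl ex_cong1 ball_cong) simp
  show ?thesis unfolding ncval_def mon sc ..
qed

section \<open>Shifts on words and the coefficients\<close>

lemma finite_words_upto [simp]: "finite (words_upto d N)"
  using finite_lists_length_le[of "{..<d}" N] by (simp add: words_upto_def conj_commute)

lemma words_upto_subset: "words_upto d N \<subseteq> all_words d"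
  by (auto simp: words_upto_def all_words_def)

lemma word_val_mat_Cons:
  assumes "finite R" "r \<in> R" "s \<in> R"
  shows "word_val (R \<times> R) mat_sc mat_one W (i # w) (r,s)
    = (\<Sum>t\<in>R. W i (r,t) * word_val (R \<times> R) mat_sc mat_one W w (t,s))"
  using assms by (simp add: smul_mat_sc)

lemma word_val_shift:
  assumes "w \<in> all_words d" "\<alpha> \<in> words_upto d N" "\<beta> \<in> words_upto d N"
  shows "word_val (words_upto d N \<times> words_upto d N) mat_sc mat_one
      (\<lambda>i (\<alpha>,\<beta>). if \<beta> = \<alpha> @ [i] then 1 else 0) w (\<alpha>,\<beta>) = (if \<beta> = \<alpha> @ w then 1 else 0)"
  using assms
proof (induction w arbitrary: \<alpha>)
  case (Cons i w)
  let ?R = "words_upto d N" and ?W = "\<lambda>i (\<alpha>,\<beta>). if \<beta> = \<alpha> @ [i] then 1 else 0 :: complex"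
  have w: "w \<in> all_words d" using Cons.prems(1) by (auto simp: all_words_def)
  have "word_val (?R \<times> ?R) mat_sc mat_one ?W (i # w) (\<alpha>,\<beta>)
      = (\<Sum>\<gamma>\<in>?R. (if \<gamma> = \<alpha> @ [i] then 1 else 0) * word_val (?R \<times> ?R) mat_sc mat_one ?W w (\<gamma>,\<beta>))"
    using Cons.prems by (simp only: word_val_mat_Cons finite_words_upto prod.case)
  also have "\<dots> = (\<Sum>\<gamma>\<in>?R. if \<gamma> = \<alpha> @ [i] then (if \<beta> = \<alpha> @ i # w then 1 else 0) else 0)"
    using Cons.IH[OF w _ Cons.prems(3)] by (intro sum.cong refl) auto
  also have "\<dots> = (if \<beta> = \<alpha> @ i # w then 1 else 0)"
  \<comment> \<open>Truncation is harmless: if \<open>\<beta> = \<alpha> @ i # w\<close> is short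
    enough, so is the intermediate word \<open>\<alpha> @ [i]\<close>.\<close>
  proof (cases "\<beta> = \<alpha> @ i # w")
    case True
    then have "\<alpha> @ [i] \<in> ?R" using Cons.prems(3) by (auto simp: words_upto_def)
    then show ?thesis by simp
  qed simp
  finally show ?case .
qed auto

definition shift_val :: "nat list \<Rightarrow> (unit \<times> unit) \<times> (nat list \<times> nat list) \<Rightarrow> complex" where
  "shift_val w = (\<lambda>(z,(\<alpha>,\<beta>)). if \<beta> = \<alpha> @ w then 1 else 0)"

lemma sc_algebra_scalars: "sc_algebra {()} (\<lambda>_ _ _. 1) (\<lambda>_. 1)"
  by unfold_locales auto

text \<open>The amplified algebra is the scalars and every \<open>y i\<close> is 1, so that only the
  shifts remain; \<open>[]\<close> serves as \<open>r0\<close>, because no nonempty word leads back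
  to it.\<close>

lemma ncval_shift:
  assumes nc: "nc_function d (Cd d) f" and pos: "pos_preserving_ncf d (Cd d) f"
  shows "\<exists>F. ncval d f (({()} \<times> {()}) \<times> (words_upto d N \<times> words_upto d N)) shift_val F \<and>
    (\<forall>x \<in> words_upto d N \<times> words_upto d N. 0 \<le> F (((),()),x))"
proof -
  let ?R = "words_upto d N" and ?W = "\<lambda>i (\<alpha>,\<beta>). if \<beta> = \<alpha> @ [i] then 1 else 0 :: complex"
  let ?V = "\<lambda>w (z,x). word_val ({()} \<times> {()}) (gsc (\<lambda>_ _ _. 1) (\<lambda>_ _ _. 1)) (tensor_unit (\<lambda>_. 1) (\<lambda>_. 1)) (\<lambda>_ _. 1) w z *
      word_val (?R \<times> ?R) mat_sc mat_one ?W w x"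
  have one: "word_val ({()} \<times> {()}) (gsc (\<lambda>_ _ _. 1) (\<lambda>_ _ _. 1)) (tensor_unit (\<lambda>_. 1) (\<lambda>_. 1)) (\<lambda>_ _. 1) w z = 1" for w z
    by (induction w arbitrary: z) (auto simp: smul_def tensor_unit_def gsc_def)
  have V: "?V w e = shift_val w e" if "w \<in> all_words d" "e \<in> ({()} \<times> {()}) \<times> (?R \<times> ?R)" for w e
    using that one by (auto simp: shift_val_def word_val_shift)
  have "vanishing d (({()} \<times> {()}) \<times> (?R \<times> ?R)) shift_val"
    unfolding vanishing_def shift_val_def
    by (intro allI impI exI[of _ "Suc N"]) (auto simp: words_upto_def)
  then have van: "vanishing d (({()} \<times> {()}) \<times> (?R \<times> ?R)) ?V"
    using vanishing_cong[of d "({()} \<times> {()}) \<times> (?R \<times> ?R)" ?V shift_val] V by blast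
  have nil: "[] \<in> ?R" by (simp add: words_upto_def)
  have psd: "psd_kernel {()} (\<lambda>_. 1)" by (simp add: psd_kernel_def less_eq_complex_def)
  have W: "0 \<le> ?W i x" for i x by (cases x) (simp add: less_eq_complex_def)
  have r0: "word_val (?R \<times> ?R) mat_sc mat_one ?W w ([],[]) = (if w = [] then 1 else 0)" if "w \<in> all_words d" for w
    using word_val_shift[OF that nil nil] by simp
  obtain F where F: "ncval d f (({()} \<times> {()}) \<times> (?R \<times> ?R)) ?V F"
    "\<And>x. x \<in> ?R \<times> ?R \<Longrightarrow> psd_kernel {()} (\<lambda>z. F (z,x))"
    using ncval_amplification[OF nc pos sc_algebra_scalars finite_words_upto psd W van nil r0] by blast
  have "ncval d f (({()} \<times> {()}) \<times> (?R \<times> ?R)) shift_val F"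
    using F(1) ncval_cong[of d "({()} \<times> {()}) \<times> (?R \<times> ?R)" ?V shift_val] V by blast
  moreover have "0 \<le> F (((),()),x)" if "x \<in> ?R \<times> ?R" for x
    using psd_kernel_diag[OF F(2)[OF that]] by simp
  ultimately show ?thesis by blast
qed

text \<open>In row \<open>[]\<close> distinct words have their single 1 in distinct columns, so no
  relation hides the coefficient of a word of length at most \<open>N\<close>.\<close>

lemma shift_coefficients:
  assumes "finite W" "\<alpha> \<in> words_upto d N"
    and "\<And>e. e \<in> ({()} \<times> {()}) \<times> (words_upto d N \<times> words_upto d N) \<Longrightarrow> F e = (\<Sum>\<beta>\<in>W. p \<beta> * shift_val \<beta> e)"
  shows "(if \<alpha> \<in> W then p \<alpha> else 0) = F (((),()),([],\<alpha>))"
proof -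
  have "F (((),()),([],\<alpha>)) = (\<Sum>\<beta>\<in>W. p \<beta> * shift_val \<beta> (((),()),([],\<alpha>)))"
    using assms(2) by (intro assms(3)) (auto simp: words_upto_def)
  also have "\<dots> = (\<Sum>\<beta>\<in>W. if \<beta> = \<alpha> then p \<beta> else 0)"
    by (intro sum.cong refl) (auto simp: shift_val_def)
  finally have "F (((),()),([],\<alpha>)) = (\<Sum>\<beta>\<in>W. if \<beta> = \<alpha> then p \<beta> else 0)" .
  then show ?thesis using assms(1) by simp
qed

text \<open>The points at which all long words vanish are specialisations of the shifts on words, so
  the coefficients that can be read off at the shifts compute the function there.\<close>

lemma nilpotent_values:
  assumes nc: "nc_function d (Cd d) f" and pos: "pos_preserving_ncf d (Cd d) f"
  shows "\<exists>c. (\<forall>\<alpha>. 0 \<le> c \<alpha>) \<and> (\<forall>N (E :: 'e set) V F. ncval d f E V F \<longrightarrow>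
     (\<forall>\<beta>\<in>all_words d. N < length \<beta> \<longrightarrow> (\<forall>e\<in>E. V \<beta> e = 0)) \<longrightarrow>
     (\<forall>e\<in>E. F e = (\<Sum>\<beta>\<in>words_upto d N. c \<beta> * V \<beta> e)))"
proof -
  let ?E = "\<lambda>N. ({()} \<times> {()}) \<times> (words_upto d N \<times> words_upto d N)"
  obtain Fu where Fu: "\<And>N. ncval d f (?E N) shift_val (Fu N)"
    "\<And>N x. x \<in> words_upto d N \<times> words_upto d N \<Longrightarrow> 0 \<le> Fu N (((),()),x)"
    using ncval_shift[OF nc pos] by metis
  \<comment> \<open>\<open>c \<alpha>\<close> is read off at the smallest truncation that contains
    \<open>\<alpha>\<close>; words with letters outside the alphabet get 0.\<close>
  define c where "c = (\<lambda>\<alpha>. if \<alpha> \<in> all_words d then Fu (length \<alpha>) (((),()),([],\<alpha>)) else 0)"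
  have "0 \<le> c \<alpha>" for \<alpha>
    using Fu(2)[of "([],\<alpha>)" "length \<alpha>"] by (auto simp: c_def words_upto_def all_words_def)
  moreover have "F e = (\<Sum>\<beta>\<in>words_upto d N. c \<beta> * V \<beta> e)"
    if val: "ncval d f E V F" and zero: "\<forall>\<beta>\<in>all_words d. N < length \<beta> \<longrightarrow> (\<forall>e\<in>E. V \<beta> e = 0)" and e: "e \<in> E"
    for N and E :: "'e set" and V F e
  proof -
    obtain W p where W: "finite W" "W \<subseteq> all_words d"
      and p: "\<And>e. e \<in> ?E N \<Longrightarrow> Fu N e = (\<Sum>\<alpha>\<in>W. p \<alpha> * shift_val \<alpha> e)"
      using ncval_polynomial[OF nc Fu(1)[of N]] by blast
    have coeff: "(if \<alpha> \<in> W then p \<alpha> else 0) = c \<alpha>" if \<alpha>: "\<alpha> \<in> words_upto d N" for \<alpha>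
    proof -
      \<comment> \<open>A smaller truncation records part of the entries of a larger one, so the
        polynomial \<open>p\<close> found for \<open>N\<close> also serves there. Hence the
        coefficients do not depend on the truncation.\<close>
      have sub: "?E (length \<alpha>) \<subseteq> ?E N" using \<alpha> by (auto simp: words_upto_def)
      have "Fu (length \<alpha>) e = (\<Sum>\<beta>\<in>W. p \<beta> * shift_val \<beta> e)" if "e \<in> ?E (length \<alpha>)" for e
        by (rule ncval_transfer[OF nc Fu(1) Fu(1) W p _ that]) (use sub in blast)+
      then show ?thesis
        using shift_coefficients[OF W(1), of \<alpha> d "length \<alpha>" "Fu (length \<alpha>)" p] \<alpha>
        by (auto simp: c_def words_upto_def all_words_def)
    qed
    have "F e = (\<Sum>\<beta>\<in>W. p \<beta> * V \<beta> e)"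
    proof (rule ncval_transfer[OF nc Fu(1) val W p _ e])
      \<comment> \<open>A relation at the shifts has zero coefficients up to length
        \<open>N\<close>, and the longer words vanish at \<open>V\<close> by assumption.\<close>
      fix W q e' assume W: "finite W" "W \<subseteq> all_words d"
        and q: "\<And>e. e \<in> ?E N \<Longrightarrow> (\<Sum>\<alpha>\<in>W. q \<alpha> * shift_val \<alpha> e) = 0" and e': "e' \<in> E"
      have "q \<beta> = 0" if "\<beta> \<in> W" "length \<beta> \<le> N" for \<beta>
        using shift_coefficients[OF W(1), of \<beta> d N "\<lambda>_. 0" q] q that W(2)
        by (auto simp: words_upto_def all_words_def)
      then show "(\<Sum>\<alpha>\<in>W. q \<alpha> * V \<alpha> e') = 0"
        using zero W(2) e' by (intro sum.neutral ballI) (metis not_less mult_zero_left mult_zero_right subsetD)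
    qed
    also have "\<dots> = (\<Sum>\<beta>\<in>W \<inter> words_upto d N. p \<beta> * V \<beta> e)"
    proof (intro sum.mono_neutral_right ballI)
      fix \<beta> assume "\<beta> \<in> W - W \<inter> words_upto d N"
      then have "\<beta> \<in> all_words d" "N < length \<beta>" using W(2) by (auto simp: words_upto_def all_words_def)
      then show "p \<beta> * V \<beta> e = 0" using zero e by simp
    qed (use W in auto)
    also have "\<dots> = (\<Sum>\<beta>\<in>words_upto d N. c \<beta> * V \<beta> e)"
    proof -
      have "p \<beta> = c \<beta>" if "\<beta> \<in> W \<inter> words_upto d N" for \<beta> using coeff[of \<beta>] that by simp
      moreover have "c \<beta> = 0" if "\<beta> \<in> words_upto d N - W \<inter> words_upto d N" for \<beta> using coeff[of \<beta>] that by auto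
      ultimately show ?thesis by (intro sum.mono_neutral_cong_left) auto
    qed
    finally show ?thesis .
  qed
  ultimately show ?thesis by blast
qed

section \<open>Comparison of the values at \<open>y\<close> and \<open>ty\<close>\<close>

definition nil_chain :: "nat \<Rightarrow> nat \<times> nat \<Rightarrow> complex" where
  "nil_chain k = (\<lambda>(a,b). if b = a + k then 1 else 0)"

text \<open>Powers of a nilpotent Jordan block, the same for all letters, sort words by length: in
  row 0 and column \<open>k\<close> of an amplified point a polynomial shows its homogeneous part of
  degree \<open>k\<close>.\<close>

lemma word_val_nil_chain:
  assumes "a < N" "b < N"
  shows "word_val ({..<N} \<times> {..<N}) mat_sc mat_one (\<lambda>_. nil_chain 1) w (a,b) = nil_chain (length w) (a,b)"
  using assms
proof (induction w arbitrary: a)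
  case (Cons i w)
  have "word_val ({..<N} \<times> {..<N}) mat_sc mat_one (\<lambda>_. nil_chain 1) (i # w) (a,b)
      = (\<Sum>r<N. nil_chain 1 (a,r) * nil_chain (length w) (r,b))"
    using Cons.prems Cons.IH by (subst word_val_mat_Cons) (auto intro!: sum.cong)
  also have "\<dots> = (\<Sum>r<N. if r = Suc a then nil_chain (Suc (length w)) (a,b) else 0)"
    by (intro sum.cong refl) (auto simp: nil_chain_def)
  also have "\<dots> = nil_chain (Suc (length w)) (a,b)"
    using Cons.prems by (auto simp: nil_chain_def)
  finally show ?case by simp
qed (simp add: nil_chain_def eq_commute)

text \<open>\<open>chain t k\<close> is the \<open>k\<close>-th power of the matrix with diagonal \<open>1, t, 0, \<dots>, 0\<close> and
  superdiagonal \<open>1 - t, 1, 1, \<dots>\<close>. A polynomial \<open>\<Sum>p\<^sub>k x\<^sup>k\<close> evaluated at this matrix has the values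
  \<open>p(1)\<close> and \<open>p(t)\<close> and the low coefficients of \<open>p\<close> among its entries, and its last entries in rows 1 and 0
  are the remainder \<open>\<Sum>p\<^sub>k t\<^sup>k\<^sup>-\<^sup>N\<close> over \<open>k \<ge> N\<close> and the difference of the remainders at 1 and \<open>t\<close>.\<close>

definition chain :: "real \<Rightarrow> nat \<Rightarrow> nat \<times> nat \<Rightarrow> complex" where
  "chain t k = (\<lambda>(a,b).
     if a = 0 then (if b = 0 then 1 else if b - 1 \<le> k then 1 - of_real t ^ (k - (b - 1)) else 0)
     else if a = 1 then (if b = 0 then 0 else if b - 1 \<le> k then of_real t ^ (k - (b - 1)) else 0)
     else (if b = a + k then 1 else 0))"

lemma chain_step:
  assumes "N \<ge> 1" "a < N + 2" "b < N + 2"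
  shows "(\<Sum>r<N+2. chain t 1 (a,r) * chain t k (r,b)) = chain t (Suc k) (a,b)"
proof -
  consider "a = 0" | "a = 1" | "a \<ge> 2" by linarith
  then show ?thesis
  proof cases
    case 1
    have "(\<Sum>r<N+2. chain t 1 (a,r) * chain t k (r,b))
        = (\<Sum>r<N+2. (if r = 0 then chain t k (0,b) else 0) + (if r = 1 then (1 - of_real t) * chain t k (1,b) else 0))"
      by (intro sum.cong refl) (auto simp: 1 chain_def)
    also have "\<dots> = chain t k (0,b) + (1 - of_real t) * chain t k (1,b)"
      by (simp add: sum.distrib)
    \<comment> \<open>At the boundary \<open>b - 1 = Suc k\<close> the new entry is
      \<open>1 - t ^ 0\<close>, which agrees with the default 0.\<close>
    also have "\<dots> = chain t (Suc k) (a,b)"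
      using Suc_diff_le[of "b - 1" k] by (auto simp: 1 chain_def algebra_simps not_le le_Suc_eq)
    finally show ?thesis .
  next
    case 2
    have "(\<Sum>r<N+2. chain t 1 (a,r) * chain t k (r,b))
        = (\<Sum>r<N+2. (if r = 1 then of_real t * chain t k (1,b) else 0) + (if r = 2 then chain t k (2,b) else 0))"
      by (intro sum.cong refl) (auto simp: 2 chain_def)
    also have "\<dots> = of_real t * chain t k (1,b) + chain t k (2,b)"
      using assms by (simp add: sum.distrib)
    also have "\<dots> = chain t (Suc k) (a,b)"
      using Suc_diff_le[of "b - 1" k] by (auto simp: 2 chain_def not_le le_Suc_eq)
    finally show ?thesis .
  next
    case 3
    have "(\<Sum>r<N+2. chain t 1 (a,r) * chain t k (r,b)) = (\<Sum>r<N+2. if r = Suc a then chain t (Suc k) (a,b) else 0)"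
      using 3 by (intro sum.cong refl) (auto simp: chain_def)
    also have "\<dots> = chain t (Suc k) (a,b)"
      using assms 3 by (auto simp: chain_def)
    finally show ?thesis .
  qed
qed

lemma word_val_chain:
  assumes "N \<ge> 1" "a < N + 2" "b < N + 2"
  shows "word_val ({..<N+2} \<times> {..<N+2}) mat_sc mat_one (\<lambda>_. chain t 1) w (a,b) = chain t (length w) (a,b)"
  using assms(2)
proof (induction w arbitrary: a)
  case (Cons i w)
  have "word_val ({..<N+2} \<times> {..<N+2}) mat_sc mat_one (\<lambda>_. chain t 1) (i # w) (a,b)
      = (\<Sum>r<N+2. chain t 1 (a,r) * chain t (length w) (r,b))"
    using Cons.prems Cons.IH assms(3) by (subst word_val_mat_Cons) (auto intro!: sum.cong)
  then show ?case using chain_step[OF assms(1) Cons.prems assms(3)] by simp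
qed (auto simp: chain_def)

text \<open>Nonnegativity admits the chain as a factor in the amplification. Although it has the
  eigenvalue 1, its powers stay bounded, so the amplified words still vanish in the limit.\<close>

lemma chain_bounds:
  assumes "0 < t" "t < 1" shows "0 \<le> chain t k z" "cmod (chain t k z) \<le> 1"
proof -
  obtain a b where z: "z = (a,b)" by (cases z)
  define x where "x = (if a = 0 then (if b = 0 then 1 else if b - 1 \<le> k then 1 - t ^ (k - (b - 1)) else 0)
     else if a = 1 then (if b = 0 then 0 else if b - 1 \<le> k then t ^ (k - (b - 1)) else 0)
     else (if b = a + k then 1 else 0))"
  have "chain t k z = complex_of_real x" by (simp add: z chain_def x_def)
  moreover have "0 \<le> x" "x \<le> 1" using assms power_le_one[of t "k - (b - 1)"] by (auto simp: x_def)
  ultimately show "0 \<le> chain t k z" "cmod (chain t k z) \<le> 1" by (auto simp: less_eq_complex_def)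
qed

lemma psd_kernel_word_val:
  assumes "finite I" "\<And>i. i < d \<Longrightarrow> psd_kernel I (y i)" "w \<in> all_words d"
  shows "psd_kernel I (word_val (I \<times> I) (gsc S S) (tensor_unit u u) y w)"
  using assms(3)
proof (induction w)
  case Nil
  have one: "psd_kernel {()} (\<lambda>_. 1)" by (simp add: psd_kernel_def less_eq_complex_def)
  show ?case
    using psd_kernel_congruence[OF one, of I "\<lambda>p _. u p"] by (simp add: tensor_unit_def)
next
  case (Cons i w)
  then show ?case using assms(1,2)
    by (auto simp: all_words_def intro!: psd_kernel_smul)
qed

text \<open>One polynomial \<open>p\<close> represents \<open>f\<close> at the point amplified by
  the chain, and its entries there give \<open>Fy\<close>, \<open>Ft\<close> and the parts of low
  degree. Both kernels become entries of this one positive value, up to the factor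
  \<open>t ^ Suc M\<close> and a sum of positive terms.\<close>

lemma remainder_bounds:
  fixes I :: "nat set" and S :: sconst and u :: "nat \<Rightarrow> complex" and y :: "nat \<Rightarrow> nat \<times> nat \<Rightarrow> complex"
    and Ft :: "nat \<times> nat \<Rightarrow> complex" and c :: "nat list \<Rightarrow> complex" and t :: real and d :: nat
  defines "yv \<equiv> word_val (I \<times> I) (gsc S S) (tensor_unit u u) y"
  assumes nc: "nc_function d (Cd d) f" and pos: "pos_preserving_ncf d (Cd d) f"
    and S: "sc_algebra I S u" and y: "\<And>i. i < d \<Longrightarrow> psd_kernel I (y i)"
    and van: "vanishing d (I \<times> I) yv" and t: "0 < t" "t < 1"
    and c0: "\<And>\<alpha>. 0 \<le> c \<alpha>"
    and c: "\<forall>N (E :: ((nat \<times> nat) \<times> (nat \<times> nat)) set) V F. ncval d f E V F \<longrightarrow>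
       (\<forall>\<beta>\<in>all_words d. N < length \<beta> \<longrightarrow> (\<forall>e\<in>E. V \<beta> e = 0)) \<longrightarrow>
       (\<forall>e\<in>E. F e = (\<Sum>\<beta>\<in>words_upto d N. c \<beta> * V \<beta> e))"
    and Fy: "ncval d f (I \<times> I) yv Fy"
    and Ft: "ncval d f (I \<times> I) (\<lambda>w z. of_real t ^ length w * yv w z) Ft"
  defines "D \<equiv> \<lambda>M z. Ft z - (\<Sum>\<beta>\<in>words_upto d M. c \<beta> * (of_real t ^ length \<beta> * yv \<beta> z))"
  shows "psd_kernel I (D M)" "psd_kernel I (\<lambda>z. of_real t ^ Suc M * Fy z - D M z)"
proof -
  \<comment> \<open>The least degree left in the remainder \<open>D M\<close>; the last index of the
    chain is \<open>N + 1\<close>.\<close>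
  define N where "N = Suc M"
  have N: "N \<ge> 1" by (simp add: N_def)
  interpret S: sc_algebra I S u by (rule S)
  let ?R = "{..<N+2}" and ?Z = "{..<N}"
  define Vc where "Vc = (\<lambda>w (z,x). yv w z * word_val (?R \<times> ?R) mat_sc mat_one (\<lambda>_. chain t 1) w x)"
  define Vz where "Vz = (\<lambda>w (z,x). yv w z * word_val (?Z \<times> ?Z) mat_sc mat_one (\<lambda>_. nil_chain 1) w x)"
  have VcE: "Vc w (z,(a,b)) = yv w z * chain t (length w) (a,b)" if "a < N + 2" "b < N + 2" for w z a b
    using word_val_chain[OF N that] by (simp add: Vc_def)
  have VzE: "Vz w (z,(a,b)) = yv w z * nil_chain (length w) (a,b)" if "a < N" "b < N" for w z a b
    using word_val_nil_chain[OF that] by (simp add: Vz_def)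
  have van': "\<exists>k0. \<forall>w\<in>all_words d. k0 \<le> length w \<longrightarrow> (\<forall>z\<in>I\<times>I. cmod (yv w z) < e)" if "e > 0" for e :: real
    using van that unfolding vanishing_def by blast
  have vanC: "vanishing d ((I \<times> I) \<times> (?R \<times> ?R)) Vc"
    unfolding vanishing_def
  proof (intro allI impI)
    fix e :: real assume e: "e > 0"
    obtain k0 where k0: "\<forall>w\<in>all_words d. k0 \<le> length w \<longrightarrow> (\<forall>z\<in>I\<times>I. cmod (yv w z) < e)" using van'[OF e] by blast
    have "cmod (Vc w (z,(a,b))) < e" if "w \<in> all_words d" "k0 \<le> length w" "z \<in> I \<times> I" "a < N + 2" "b < N + 2" for w z a b
    proof -
      have "cmod (Vc w (z,(a,b))) \<le> cmod (yv w z) * 1"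
        unfolding VcE[OF that(4,5)] norm_mult by (intro mult_left_mono chain_bounds t) simp
      also have "\<dots> < e" using k0 that by auto
      finally show ?thesis .
    qed
    then show "\<exists>k0. \<forall>w\<in>all_words d. k0 \<le> length w \<longrightarrow> (\<forall>p\<in>(I \<times> I) \<times> (?R \<times> ?R). cmod (Vc w p) < e)"
      by (intro exI[of _ k0]) auto
  qed
  \<comment> \<open>Index 2 begins the nilpotent block of the chain; the indices 0 and 1 carry the
    eigenvalues 1 and \<open>t\<close> and would not isolate the empty word.\<close>
  have rC: "2 \<in> ?R" "word_val (?R \<times> ?R) mat_sc mat_one (\<lambda>_. chain t 1) w (2,2) = (if w = [] then 1 else 0)" for w
    using word_val_chain[OF N, of 2 2 t w] N by (auto simp: chain_def)
  obtain Fc where Fc: "ncval d f ((I \<times> I) \<times> (?R \<times> ?R)) Vc Fc"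
    and psd: "\<And>x. x \<in> ?R \<times> ?R \<Longrightarrow> psd_kernel I (\<lambda>z. Fc (z,x))"
    using ncval_amplification[where W = "\<lambda>_. chain t 1" and R = ?R, OF nc pos S finite_lessThan y
        chain_bounds(1)[OF t] vanC[unfolded Vc_def yv_def] rC]
    unfolding Vc_def yv_def by blast
  have zeroZ: "Vz \<beta> e = 0" if \<beta>: "\<beta> \<in> all_words d" "M < length \<beta>" and e: "e \<in> (I \<times> I) \<times> (?Z \<times> ?Z)" for \<beta> e
  proof -
    obtain z a b where e': "e = (z,(a,b))" and ab: "a < N" "b < N" using e by auto
    have "nil_chain (length \<beta>) (a,b) = 0" using \<beta> ab by (simp add: nil_chain_def N_def)
    then show ?thesis using VzE[OF ab, of \<beta> z] unfolding e' by simp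
  qed
  then have vanZ: "vanishing d ((I \<times> I) \<times> (?Z \<times> ?Z)) Vz"
    unfolding vanishing_def by (intro allI impI exI[of _ "Suc M"]) (metis Suc_le_lessD norm_zero)
  have rZ: "0 \<in> ?Z" "word_val (?Z \<times> ?Z) mat_sc mat_one (\<lambda>_. nil_chain 1) w (0,0) = (if w = [] then 1 else 0)" for w
    using word_val_nil_chain[of 0 N 0 w] N by (auto simp: nil_chain_def)
  have nonneg: "0 \<le> nil_chain 1 x" for x by (simp add: nil_chain_def less_eq_complex_def split: prod.split)
  obtain Fz where Fz: "ncval d f ((I \<times> I) \<times> (?Z \<times> ?Z)) Vz Fz"
    using ncval_amplification[where W = "\<lambda>_. nil_chain 1" and R = ?Z, OF nc pos S finite_lessThan y
        nonneg vanZ[unfolded Vz_def yv_def] rZ]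
    unfolding Vz_def yv_def by blast
  obtain W p where W: "finite W" "W \<subseteq> all_words d"
    and p: "\<And>e. e \<in> (I \<times> I) \<times> (?R \<times> ?R) \<Longrightarrow> Fc e = (\<Sum>\<alpha>\<in>W. p \<alpha> * Vc \<alpha> e)"
    using ncval_polynomial[OF nc Fc] by blast
  have FcE: "Fc (z,(a,b)) = (\<Sum>\<alpha>\<in>W. p \<alpha> * (yv \<alpha> z * chain t (length \<alpha>) (a,b)))"
    if "z \<in> I \<times> I" "a < N + 2" "b < N + 2" for z a b
    using p[of "(z,(a,b))"] that VcE[OF that(2,3)] by simp
  have FyE: "Fy z = (\<Sum>\<alpha>\<in>W. p \<alpha> * yv \<alpha> z)" if "z \<in> I \<times> I" for z
  proof (rule ncval_transfer[OF nc Fc Fy W p _ that])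
    fix W p z assume z: "z \<in> I \<times> I" and *: "\<And>e. e \<in> (I \<times> I) \<times> (?R \<times> ?R) \<Longrightarrow> (\<Sum>\<alpha>\<in>W. p \<alpha> * Vc \<alpha> e) = 0"
    show "(\<Sum>\<alpha>\<in>W. p \<alpha> * yv \<alpha> z) = 0"
      using *[of "(z,(0,0))"] z VcE[of 0 0] by (simp add: chain_def)
  qed
  have FtE: "Ft z = (\<Sum>\<alpha>\<in>W. p \<alpha> * (of_real t ^ length \<alpha> * yv \<alpha> z))" if "z \<in> I \<times> I" for z
  proof (rule ncval_transfer[OF nc Fc Ft W p _ that])
    fix W p z assume z: "z \<in> I \<times> I" and *: "\<And>e. e \<in> (I \<times> I) \<times> (?R \<times> ?R) \<Longrightarrow> (\<Sum>\<alpha>\<in>W. p \<alpha> * Vc \<alpha> e) = 0"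
    show "(\<Sum>\<alpha>\<in>W. p \<alpha> * (of_real t ^ length \<alpha> * yv \<alpha> z)) = 0"
      using *[of "(z,(1,1))"] z VcE[of 1 1] by (simp add: chain_def mult.commute)
  qed
  have FzE: "Fz (z,(0,k)) = (\<Sum>\<alpha>\<in>W. p \<alpha> * (yv \<alpha> z * nil_chain (length \<alpha>) (0,k)))" if z: "z \<in> I \<times> I" and k: "k < N" for z k
  proof -
    have "Fz (z,(0,k)) = (\<Sum>\<alpha>\<in>W. p \<alpha> * Vz \<alpha> (z,(0,k)))"
    proof (rule ncval_transfer[OF nc Fc Fz W p])
      fix W p e assume e: "e \<in> (I \<times> I) \<times> (?Z \<times> ?Z)"
        and *: "\<And>e. e \<in> (I \<times> I) \<times> (?R \<times> ?R) \<Longrightarrow> (\<Sum>\<alpha>\<in>W. p \<alpha> * Vc \<alpha> e) = 0"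
      obtain z a b where e': "e = (z,(a,b))" and z: "z \<in> I \<times> I" and ab: "a < N" "b < N" using e by auto
      \<comment> \<open>The nilpotent point is the block of the chain point beyond the indices 0 and
        1, hence the shift by 2.\<close>
      have "Vz \<alpha> e = Vc \<alpha> (z,(a + 2, b + 2))" for \<alpha>
        using VcE[of "a + 2" "b + 2" \<alpha> z] VzE[OF ab, of \<alpha> z] ab unfolding e' by (simp add: chain_def nil_chain_def)
      then show "(\<Sum>\<alpha>\<in>W. p \<alpha> * Vz \<alpha> e) = 0" using *[of "(z,(a+2,b+2))"] z ab by simp
    qed (use z k in auto)
    then show ?thesis using VzE[of 0 k] k by simp
  qed
  \<comment> \<open>Both sides compute \<open>f\<close> at the nilpotent point. They equate
    homogeneous parts at \<open>y\<close>, degree by degree; the coefficients \<open>p\<close> and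
    \<open>c\<close> themselves may differ.\<close>
  have low: "(\<Sum>\<alpha>\<in>W. p \<alpha> * (yv \<alpha> z * nil_chain (length \<alpha>) (0,k)))
      = (\<Sum>\<alpha>\<in>words_upto d M. c \<alpha> * (yv \<alpha> z * nil_chain (length \<alpha>) (0,k)))" if z: "z \<in> I \<times> I" and k: "k < N" for z k
  proof -
    have "Fz (z,(0,k)) = (\<Sum>\<beta>\<in>words_upto d M. c \<beta> * Vz \<beta> (z,(0,k)))"
      by (rule c[rule_format, OF Fz]) (use zeroZ z k in auto)
    then show ?thesis using FzE[OF z k] VzE[of 0 k] k by simp
  qed
  \<comment> \<open>The degrees are recombined with weights \<open>s\<close>: powers of
    \<open>t\<close> for the truncation at \<open>ty\<close>, and 1 for the one at
    \<open>y\<close>.\<close>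
  have weighted: "(\<Sum>\<alpha>\<in>W. p \<alpha> * (yv \<alpha> z * (if length \<alpha> < N then s (length \<alpha>) else 0)))
      = (\<Sum>\<alpha>\<in>words_upto d M. c \<alpha> * (s (length \<alpha>) * yv \<alpha> z))" if z: "z \<in> I \<times> I" for z and s :: "nat \<Rightarrow> complex"
  proof -
    have expand: "(\<Sum>\<alpha>\<in>X. q \<alpha> * (yv \<alpha> z * (if length \<alpha> < N then s (length \<alpha>) else 0)))
        = (\<Sum>k<N. s k * (\<Sum>\<alpha>\<in>X. q \<alpha> * (yv \<alpha> z * nil_chain (length \<alpha>) (0,k))))" for X q
    proof -
      have "(if l < N then s l else 0) = (\<Sum>k<N. s k * nil_chain l (0,k))" for l
      proof -
        have "(\<Sum>k<N. s k * nil_chain l (0,k)) = (\<Sum>k<N. if k = l then s k else 0)"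
          by (intro sum.cong refl) (auto simp: nil_chain_def)
        then show ?thesis by simp
      qed
      then show ?thesis
        by (simp only: sum_distrib_left, subst sum.swap) (simp add: mult_ac)
    qed
    have "(\<Sum>\<alpha>\<in>W. p \<alpha> * (yv \<alpha> z * (if length \<alpha> < N then s (length \<alpha>) else 0)))
        = (\<Sum>\<alpha>\<in>words_upto d M. c \<alpha> * (yv \<alpha> z * (if length \<alpha> < N then s (length \<alpha>) else 0)))"
      unfolding expand using low[OF z] by simp
    then show ?thesis by (simp add: words_upto_def N_def less_Suc_eq_le mult.commute)
  qed
  have t0: "0 \<le> (of_real t ^ N :: complex)" using t by (simp add: less_eq_complex_def flip: of_real_power)
  have D1: "D M z = of_real t ^ N * Fc (z,(1,N+1))" if z: "z \<in> I \<times> I" for z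
  proof -
    have "D M z = (\<Sum>\<alpha>\<in>W. p \<alpha> * (of_real t ^ length \<alpha> * yv \<alpha> z)
        - p \<alpha> * (yv \<alpha> z * (if length \<alpha> < N then of_real t ^ length \<alpha> else 0)))"
      unfolding D_def FtE[OF z] sum_subtractf weighted[OF z, of "\<lambda>k. of_real t ^ k"] ..
    \<comment> \<open>Terms of degree below \<open>N\<close> cancel; from \<open>N\<close> on,
      \<open>t ^ k\<close> is \<open>t ^ N\<close> times the chain entry
      \<open>t ^ (k - N)\<close>.\<close>
    also have "\<dots> = (\<Sum>\<alpha>\<in>W. of_real t ^ N * (p \<alpha> * (yv \<alpha> z * chain t (length \<alpha>) (1,N+1))))"
      by (intro sum.cong refl) (auto simp: chain_def not_less mult_ac simp flip: power_add)
    also have "\<dots> = of_real t ^ N * Fc (z,(1,N+1))"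
      using FcE[OF z, of 1 "N+1"] by (simp add: sum_distrib_left)
    finally show ?thesis .
  qed
  have "psd_kernel I (\<lambda>z. of_real t ^ N * Fc (z,(1,N+1)))"
    by (intro psd_kernel_scale psd t0) simp
  then show "psd_kernel I (D M)"
    by (rule psd_kernel_cong[THEN iffD2, rotated]) (simp add: D1)
  have D2: "of_real t ^ N * Fy z - D M z
      = of_real t ^ N * ((\<Sum>\<alpha>\<in>words_upto d M. c \<alpha> * yv \<alpha> z) + Fc (z,(0,N+1)))" if z: "z \<in> I \<times> I" for z
  proof -
    have "Fy z - Fc (z,(1,N+1)) = (\<Sum>\<alpha>\<in>W. p \<alpha> * yv \<alpha> z - p \<alpha> * (yv \<alpha> z * chain t (length \<alpha>) (1,N+1)))"
      using FyE[OF z] FcE[OF z, of 1 "N+1"] by (simp add: sum_subtractf)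
    \<comment> \<open>From degree \<open>N\<close> on, \<open>1 - t ^ (k - N)\<close> is the last
      entry of row 0 of the chain; below \<open>N\<close> the whole term remains.\<close>
    also have "\<dots> = (\<Sum>\<alpha>\<in>W. p \<alpha> * (yv \<alpha> z * (if length \<alpha> < N then 1 else 0)) + p \<alpha> * (yv \<alpha> z * chain t (length \<alpha>) (0,N+1)))"
      by (intro sum.cong refl) (auto simp: chain_def algebra_simps)
    also have "\<dots> = (\<Sum>\<alpha>\<in>words_upto d M. c \<alpha> * yv \<alpha> z) + Fc (z,(0,N+1))"
      using FcE[OF z, of 0 "N+1"] weighted[OF z, of "\<lambda>_. 1"] by (simp add: sum.distrib)
    finally show ?thesis unfolding D1[OF z] by (simp flip: right_diff_distrib)
  qed
  have "psd_kernel I (\<lambda>z. \<Sum>\<alpha>\<in>words_upto d M. c \<alpha> * yv \<alpha> z)"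
    unfolding yv_def using words_upto_subset
    by (intro psd_kernel_sum psd_kernel_scale psd_kernel_word_val[where d = d] c0 y) auto
  then have "psd_kernel I (\<lambda>z. of_real t ^ N * ((\<Sum>\<alpha>\<in>words_upto d M. c \<alpha> * yv \<alpha> z) + Fc (z,(0,N+1))))"
    by (intro psd_kernel_scale psd_kernel_add psd t0) auto
  then show "psd_kernel I (\<lambda>z. of_real t ^ Suc M * Fy z - D M z)"
    by (rule psd_kernel_cong[THEN iffD2, rotated]) (use D2 in \<open>simp add: N_def\<close>)
qed

section \<open>Convergence of the series\<close>

lemma squeezed_psd_kernels_tendsto_0:
  assumes I: "finite I" "i \<in> I" "j \<in> I" and t: "0 < t" "t < 1"
    and D: "\<And>M. psd_kernel I (D M)" "\<And>M. psd_kernel I (\<lambda>z. of_real t ^ Suc M * K z - D M z)"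
  shows "(\<lambda>M. D M (i,j)) \<longlonglongrightarrow> 0"
proof -
  have diag: "Re (D M (k,k)) \<le> t ^ Suc M * Re (K (k,k))" if "k \<in> I" for M k
    using psd_kernel_diag[OF D(2)[of M] I(1) that]
    by (simp add: less_eq_complex_def flip: of_real_power of_real_mult)
  have bound: "norm (D M (i,j)) \<le> t ^ M * (t * (Re (K (i,i)) + Re (K (j,j))))" for M
    using psd_kernel_norm_le[OF D(1)[of M] I] diag[OF I(2), of M] diag[OF I(3), of M]
    by (simp add: algebra_simps)
  have "(\<lambda>M. t ^ M) \<longlonglongrightarrow> 0" using t by (intro LIMSEQ_realpow_zero) auto
  then show ?thesis
    by (rule tendsto_0_le[where K = "t * (Re (K (i,i)) + Re (K (j,j)))"]) (use bound t in simp)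
qed

theorem mainTheorem5:
  fixes d :: nat and f :: "pt \<Rightarrow> complex mat"
  assumes "nc_function d (Cd d) f"
    and "pos_preserving_ncf d (Cd d) f"
  shows "\<exists>c :: nat list \<Rightarrow> complex.
           (\<forall>\<alpha>. Im (c \<alpha>) = 0 \<and> Re (c \<alpha>) \<ge> 0) \<and>
           (\<forall>G X. (G, X) \<in> Cd d \<longrightarrow>
              (\<forall>p < fst G. \<forall>q < fst (snd G).
                 (\<lambda>N. lin_comb G X (words_upto d N) c $$ (p, q)) \<longlonglongrightarrow> f (G, X) $$ (p, q)))"
proof -
  note nc = assms(1) and pos = assms(2)
  \<comment> \<open>The index type is the one of amplifications by nilpotent chains, the points
    where \<open>c\<close> is consulted below.\<close>
  obtain c where c0: "\<And>\<alpha>. 0 \<le> c \<alpha>"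
    and c: "\<forall>N (E :: ((nat \<times> nat) \<times> (nat \<times> nat)) set) V F. ncval d f E V F \<longrightarrow>
     (\<forall>\<beta>\<in>all_words d. N < length \<beta> \<longrightarrow> (\<forall>e\<in>E. V \<beta> e = 0)) \<longrightarrow>
     (\<forall>e\<in>E. F e = (\<Sum>\<beta>\<in>words_upto d N. c \<beta> * V \<beta> e))"
    using nilpotent_values[OF nc pos, where 'e = "(nat \<times> nat) \<times> (nat \<times> nat)"] by blast
  have "(\<lambda>N. lin_comb G X (words_upto d N) c $$ (p, q)) \<longlonglongrightarrow> f (G, X) $$ (p, q)"
    if C: "(G, X) \<in> Cd d" and p: "p < fst G" and q: "q < fst (snd G)" for G X p q
  proof -
    obtain n S u Ys m where S: "sc_algebra {..<n} S u" and len: "length Ys = d"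
      and Ys: "\<forall>i<d. Ys ! i \<in> carrier_mat n n \<and> psd (Ys ! i)"
      and van: "vanishing d ({..<n} \<times> {..<n}) (\<lambda>w. ($$) (monomial (n, n, schur_prod n n S S) Ys w))"
      and mp: "\<forall>p<fst G. m + p < n" "\<forall>q<fst (snd G). q < n"
      and corner: "\<forall>w\<in>all_words d. \<forall>p<fst G. \<forall>q<fst (snd G).
        monomial G X w $$ (p,q) = monomial (n, n, schur_prod n n S S) Ys w $$ (m + p, q)"
      using Cd_corner[OF C] by blast
    interpret P: gsp_algebra n n S S u u using S by (simp add: gsp_algebra_def)
    obtain t where t: "0 < t" "t < 1"
      and van_y: "vanishing d P.idx (P.wvG (\<lambda>i z. of_real (1 / t) * Ys ! i $$ z))"
      using P.T.vanishing_scale van unfolding P.vanishing_monomial_iff by blast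
    define y where "y = (\<lambda>i z. of_real (1 / t) * Ys ! i $$ z)"
    \<comment> \<open>\<open>Ys\<close> is \<open>t\<close> times \<open>ys\<close>, and both are
      positive points of the domain; the estimates take place there, before the return to the corner
      \<open>X\<close>.\<close>
    define ys where "ys = map (\<lambda>M. of_real (1 / t) \<cdot>\<^sub>m M) Ys"
    have ys: "length ys = d" "\<And>i. i < d \<Longrightarrow> ys ! i \<in> carrier_mat n n"
      "\<And>i z. i < d \<Longrightarrow> z \<in> P.idx \<Longrightarrow> ys ! i $$ z = y i z"
      using len Ys by (auto simp: ys_def y_def)
    have mon_ys: "monomial P.G ys w $$ z = P.wvG y w z" if w: "w \<in> all_words d" and z: "z \<in> P.idx" for w z
    proof -
      have "P.wvG (\<lambda>i. ($$) (ys ! i)) w = P.wvG y w"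
        using w ys(3) by (intro word_val_cong) (auto simp: all_words_def)
      then show ?thesis by (simp add: P.monomial_index[OF z])
    qed
    have mon_Ys: "monomial P.G Ys w $$ z = of_real t ^ length w * P.wvG y w z" if "z \<in> P.idx" for w z
      using t unfolding P.monomial_index[OF that] y_def word_val_scale
      by (simp flip: mult.assoc power_mult_distrib)
    have psd_y: "psd_kernel {..<n} (y i)" if "i < d" for i
      unfolding y_def using Ys that psd_iff_kernel[of "Ys ! i" n] t
      by (intro psd_kernel_scale) (auto simp: less_eq_complex_def)
    have psd_ys: "psd (ys ! i)" if i: "i < d" for i
      unfolding psd_iff_kernel[OF ys(2)[OF i]]
      by (rule psd_kernel_cong[THEN iffD2, OF _ psd_y[OF i]]) (use ys(3)[OF i] in auto)
    have van_ys: "vanishing d P.idx (\<lambda>w. ($$) (monomial P.G ys w))"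
      using van_y vanishing_cong[of d P.idx "\<lambda>w. ($$) (monomial P.G ys w)" "P.wvG y"] mon_ys
      unfolding y_def by blast
    have C_ys: "(P.G, ys) \<in> Cd d" by (rule psd_point_in_Cd[OF S ys(1,2) psd_ys van_ys])
    have C_Ys: "(P.G, Ys) \<in> Cd d" by (rule psd_point_in_Cd[OF S len _ _ van]) (use Ys in auto)
    define Fy where "Fy = ($$) (f (P.G, ys))"
    define Ft where "Ft = ($$) (f (P.G, Ys))"
    have vy: "ncval d f P.idx (P.wvG y) Fy"
      using ncval_point[OF C_ys, of f] ncval_cong[of d P.idx "\<lambda>w. ($$) (monomial P.G ys w)" "P.wvG y" f Fy] mon_ys
      unfolding Fy_def by simp
    have vt: "ncval d f P.idx (\<lambda>w z. of_real t ^ length w * P.wvG y w z) Ft"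
      using ncval_point[OF C_Ys, of f] mon_Ys
        ncval_cong[of d P.idx "\<lambda>w. ($$) (monomial P.G Ys w)" "\<lambda>w z. of_real t ^ length w * P.wvG y w z" f Ft]
      unfolding Ft_def by simp
    have van_y': "vanishing d P.idx (P.wvG y)" using van_y by (simp add: y_def)
    note bounds = remainder_bounds[OF nc pos S psd_y van_y' t c0 c vy vt]
    let ?D = "\<lambda>M z. Ft z - (\<Sum>\<beta>\<in>words_upto d M. c \<beta> * (of_real t ^ length \<beta> * P.wvG y \<beta> z))"
    have z: "(m + p, q) \<in> P.idx" and mpq: "m + p \<in> {..<n}" "q \<in> {..<n}" using mp p q by auto
    have "(\<lambda>M. ?D M (m + p, q)) \<longlonglongrightarrow> 0"
      by (rule squeezed_psd_kernels_tendsto_0[where K = Fy, OF finite_lessThan mpq t bounds])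
    then have "(\<lambda>M. Ft (m + p, q) - ?D M (m + p, q)) \<longlonglongrightarrow> Ft (m + p, q) - 0"
      by (intro tendsto_intros)
    moreover have "Ft (m + p, q) - ?D M (m + p, q) = lin_comb G X (words_upto d M) c $$ (p, q)" for M
    proof -
      have "lin_comb G X (words_upto d M) c $$ (p, q) = (\<Sum>\<beta>\<in>words_upto d M. c \<beta> * monomial P.G Ys \<beta> $$ (m + p, q))"
        unfolding lin_comb_index[OF p q] using corner p q words_upto_subset by (intro sum.cong refl) auto
      then show ?thesis by (simp add: mon_Ys[OF z])
    qed
    \<comment> \<open>Every relation at \<open>Ys\<close> holds in its corner \<open>X\<close>, so a
      polynomial for \<open>f\<close> at \<open>Ys\<close> also represents \<open>f\<close> at
      \<open>X\<close>.\<close>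
    moreover have "Ft (m + p, q) = f (G, X) $$ (p, q)"
    proof -
      note val = ncval_point[OF C_Ys, of f] and val' = ncval_point[OF C, of f]
      obtain W b where W: "finite W" "W \<subseteq> all_words d"
        and b: "\<And>e. e \<in> {..<fst P.G} \<times> {..<fst (snd P.G)} \<Longrightarrow> f (P.G, Ys) $$ e = (\<Sum>\<alpha>\<in>W. b \<alpha> * monomial P.G Ys \<alpha> $$ e)"
        using ncval_polynomial[OF nc val] by blast
      have eq: "(\<Sum>\<alpha>\<in>W. b \<alpha> * monomial G X \<alpha> $$ (i,j)) = (\<Sum>\<alpha>\<in>W. b \<alpha> * monomial P.G Ys \<alpha> $$ (m + i, j))"
        if "W \<subseteq> all_words d" "i < fst G" "j < fst (snd G)" for W b i j
        using corner that by (intro sum.cong refl) auto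
      have "f (G, X) $$ (p,q) = (\<Sum>\<alpha>\<in>W. b \<alpha> * monomial G X \<alpha> $$ (p,q))"
      proof (rule ncval_transfer[OF nc val val' W b])
        fix W b e assume W: "W \<subseteq> all_words d" and e: "e \<in> {..<fst G} \<times> {..<fst (snd G)}"
          and zero: "\<And>e. e \<in> {..<fst P.G} \<times> {..<fst (snd P.G)} \<Longrightarrow> (\<Sum>\<alpha>\<in>W. b \<alpha> * monomial P.G Ys \<alpha> $$ e) = 0"
        obtain i j where ij: "e = (i,j)" "i < fst G" "j < fst (snd G)" using e by auto
        then show "(\<Sum>\<alpha>\<in>W. b \<alpha> * monomial G X \<alpha> $$ e) = 0"
          using eq[OF W ij(2,3), of b] zero[of "(m + i, j)"] mp by simp
      qed (use p q in auto)
      then show ?thesis using b[of "(m + p, q)"] eq[OF W(2) p q, of b] z by (simp add: Ft_def)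
    qed
    ultimately show ?thesis by simp
  qed
  moreover have "\<forall>\<alpha>. Im (c \<alpha>) = 0 \<and> Re (c \<alpha>) \<ge> 0" using c0 by (auto simp: less_eq_complex_def)
  ultimately show ?thesis by blast
qed

end
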